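(* Assume that $\mathrm{BQP}\ne\mathrm{NBQP}$. Then, for every positive polynomial triplet $(p,p',p'')$ with $p'(n)>p(n)$ for all numbers $n\in\mathbb{N}$, there exists an NBQP-search problem $\mathcal{P}=(\Sigma^*,M,p)$ that satisfies the following: for any solution function $f$ for $\mathcal{P}$, there is no polynomial-time quantum algorithm $\mathcal{B}$ such that (i) on each input $x\in L_M$ of length $n$, $\mathcal{B}$ finds, with probability at least $1-\frac{2p(n)}{p'(n)(p(n)+2)}$, a string $y$ whose relative distance $\Delta(y,f(x))$ is at most $1/2-1/p(n)$, and (ii) on every input $x\notin L_M$ of length $n$, $\mathcal{B}$ outputs $\bot$ with probability at least $1/2+1/p''(n)$.
   Context: Here $\Sigma=\{0,1\}$. $\mathrm{Prob}_M[M(x)=b]$ denotes the probability that measuring the final configuration of the quantum algorithm $M$ started on input $x$ yields $b$. An NBQP-search problem is a triplet $\mathcal{P}=(\Sigma^*,M,p)$, where $M$ is a polynomial-time quantum algorithm taking inputs from $\Sigma^*\times\Sigma^*$ and $p$ is a polynomial, such that for every $x\in\Sigma^*$ and every $y\in\Sigma^{p(|x|)}$ there is a bit $b$ with $\mathrm{Prob}_M[M(x,y)=b]\ge2/3$. Let $S_{x,M}=\{y\in\Sigma^{p(|x|)}\mid\mathrm{Prob}_M[M(x,y)=1]\ge2/3\}$ be the set of solutions of $x$ and $L_M=\{x\mid S_{x,M}\ne\emptyset\}$. The task is, on input $x$, to output an element of $S_{x,M}$ if this set is nonempty, and the special symbol $\bot\notin\Sigma$ otherwise. A solution function $f$ for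 $\mathcal{P}$ is a function with $f(x)\in S_{x,M}$ for every $x\in L_M$ and $f(x)=\bot$ for every $x\notin L_M$. $\mathrm{NBQP}$ is the class of languages $L$ such that $L=L_M$ for some NBQP-search problem $(\Sigma^*,M,p)$. $\mathrm{BQP}$ is the class of decision problems solvable by polynomial-time quantum algorithms with success probability at least $2/3$. For two strings of the same length, $\Delta$ denotes the Hamming distance divided by the length.
   Formalization: The polynomial p is additionally assumed nonconstant: for constant p such as p=2, p'=3, p''=3, a quantum algorithm can test all solutions of constant length, so (i) and (ii) hold for the first-solution function f and the claim fails when BQP≠NBQP. *)

theory Defs
  imports Complex_Main "HOL-Computational_Algebra.Polynomial"
begin

text \<open>Real coefficients are allowed so that every integer-valued polynomial without negative
  values, such as \<open>n (n + 1) / 2\<close>, is covered.\<close>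

definition polynomial_fun :: "(nat \<Rightarrow> nat) \<Rightarrow> bool" where
  "polynomial_fun p \<longleftrightarrow> (\<exists>P :: real poly. \<forall>n. real (p n) = poly P (real n))"

definition positive_polynomial :: "(nat \<Rightarrow> nat) \<Rightarrow> bool" where
  "positive_polynomial p \<longleftrightarrow> polynomial_fun p \<and> (\<forall>n. p n > 0)"

text \<open>Control states are \<open>0, \<dots>, num_states - 1\<close>; state \<open>0\<close> is the start state and the number
  \<open>num_states\<close> itself is the halting state.  Tape symbols are \<open>0, \<dots>, num_syms - 1\<close>; symbol \<open>0\<close> is
  the blank, and \<open>1\<close>, \<open>2\<close> represent the two bits.  Tapes are infinite in both directions; a tape is
  its contents together with the head position.\<close>

datatype dir = Leftward | Stay | Rightward

record tm =
  num_tapes :: nat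
  num_states :: nat
  num_syms :: nat
  delta :: "nat \<Rightarrow> nat list \<Rightarrow> nat \<times> (nat \<times> dir) list"

definition wf_tm :: "tm \<Rightarrow> bool" where
  "wf_tm T \<longleftrightarrow> num_syms T \<ge> 3 \<and>
     (\<forall>q < num_states T. \<forall>ss. length ss = num_tapes T \<and> set ss \<subseteq> {..<num_syms T} \<longrightarrow>
        (case delta T q ss of (q', acts) \<Rightarrow>
           q' \<le> num_states T \<and> length acts = num_tapes T \<and> fst ` set acts \<subseteq> {..<num_syms T}))"

type_synonym tape = "(int \<Rightarrow> nat) \<times> int"
type_synonym config = "nat \<times> tape list"

fun move :: "dir \<Rightarrow> int \<Rightarrow> int" where
  "move Leftward h = h - 1"
| "move Stay h = h"
| "move Rightward h = h + 1"

fun act :: "nat \<times> dir \<Rightarrow> tape \<Rightarrow> tape" where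
  "act (s, d) (c, h) = (c(h := s), move d h)"

definition tm_step :: "tm \<Rightarrow> config \<Rightarrow> config" where
  "tm_step T cfg = (case cfg of (q, ts) \<Rightarrow>
     if q < num_states T
     then (case delta T q (map (\<lambda>(c, h). c h) ts) of (q', acts) \<Rightarrow> (q', map2 act acts ts))
     else (q, ts))"

definition bit_sym :: "bool \<Rightarrow> nat" where
  "bit_sym b = (if b then 2 else 1)"

definition string_tape :: "bool list \<Rightarrow> tape" where
  "string_tape w =
     ((\<lambda>i. if 0 \<le> i \<and> i < int (length w) then bit_sym (w ! nat i) else 0), 0)"

text \<open>The input strings are placed on the first tapes, all other tapes are blank.  The output is
  what stands on the last tape between cell \<open>0\<close> and the first blank to its right.\<close>

definition tm_init :: "tm \<Rightarrow> bool list list \<Rightarrow> config" where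
  "tm_init T xs = (0, map string_tape xs @ replicate (num_tapes T - length xs) (string_tape []))"

definition tm_outputs_within :: "tm \<Rightarrow> bool list list \<Rightarrow> nat \<Rightarrow> bool list \<Rightarrow> bool" where
  "tm_outputs_within T xs t w \<longleftrightarrow>
     (case (tm_step T ^^ t) (tm_init T xs) of (q, ts) \<Rightarrow>
        q = num_states T \<and>
        (\<forall>i < length w. fst (last ts) (int i) = bit_sym (w ! i)) \<and>
        fst (last ts) (int (length w)) = 0)"

text \<open>Here \<open>inp\<close> says how an input is presented as a list of strings, one per input tape; the running
  time is measured in the total length of these strings.  The output tape is not an input tape.\<close>

definition polytime_computable :: "('a \<Rightarrow> bool list list) \<Rightarrow> ('a \<Rightarrow> bool list) \<Rightarrow> bool" where
  "polytime_computable inp g \<longleftrightarrow>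
     (\<exists>T t. wf_tm T \<and> polynomial_fun t \<and>
        (\<forall>a. length (inp a) < num_tapes T \<and>
             tm_outputs_within T (inp a) (t (sum_list (map length (inp a)))) (g a)))"

text \<open>Circuits over the standard universal basis consisting of the Hadamard gate, the phase gate
  \<open>diag(1, \<i>)\<close> and its inverse, the controlled NOT and the Toffoli gate.  The last argument of a
  controlled gate is the target.  A circuit acts on qubits \<open>0, \<dots>, width - 1\<close>, and the first
  \<open>out_len\<close> of them form its output register.\<close>

datatype gate =
    Had nat
  | Phase nat
  | PhaseInv nat
  | CNot nat nat
  | Toffoli nat nat nat

datatype qcircuit = QCircuit (width: nat) (out_len: nat) (gates: "gate list")

fun gate_qubits :: "gate \<Rightarrow> nat list" where
  "gate_qubits (Had i) = [i]"
| "gate_qubits (Phase i) = [i]"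
| "gate_qubits (PhaseInv i) = [i]"
| "gate_qubits (CNot i j) = [i, j]"
| "gate_qubits (Toffoli i j k) = [i, j, k]"

definition wf_circuit :: "qcircuit \<Rightarrow> bool" where
  "wf_circuit C \<longleftrightarrow> out_len C \<le> width C \<and>
     (\<forall>g \<in> set (gates C). distinct (gate_qubits g) \<and> set (gate_qubits g) \<subseteq> {..<width C})"

text \<open>A state of \<open>m\<close> qubits is given by its amplitudes on the basis states, the bit strings of
  length \<open>m\<close>.\<close>

type_synonym qstate = "bool list \<Rightarrow> complex"

fun apply_gate :: "gate \<Rightarrow> qstate \<Rightarrow> qstate" where
  "apply_gate (Had i) \<psi> =
     (\<lambda>z. (\<psi> (z[i := False]) + (if z ! i then - 1 else 1) * \<psi> (z[i := True])) / complex_of_real (sqrt 2))"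
| "apply_gate (Phase i) \<psi> = (\<lambda>z. (if z ! i then \<i> else 1) * \<psi> z)"
| "apply_gate (PhaseInv i) \<psi> = (\<lambda>z. (if z ! i then - \<i> else 1) * \<psi> z)"
| "apply_gate (CNot i j) \<psi> = (\<lambda>z. \<psi> (z[j := (z ! j \<noteq> z ! i)]))"
| "apply_gate (Toffoli i j k) \<psi> = (\<lambda>z. \<psi> (z[k := (z ! k \<noteq> (z ! i \<and> z ! j))]))"

definition zero_state :: "nat \<Rightarrow> qstate" where
  "zero_state m = (\<lambda>z. if z = replicate m False then 1 else 0)"

definition final_state :: "qcircuit \<Rightarrow> qstate" where
  "final_state C = fold apply_gate (gates C) (zero_state (width C))"

text \<open>The probability that measuring the output register of the final state yields a string
  satisfying \<open>E\<close>.\<close>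

definition qprob :: "qcircuit \<Rightarrow> (bool list \<Rightarrow> bool) \<Rightarrow> real" where
  "qprob C E = (\<Sum>z | length z = width C \<and> E (take (out_len C) z). (cmod (final_state C z))\<^sup>2)"

fun enc_nat :: "nat \<Rightarrow> bool list" where
  "enc_nat n = replicate n True @ [False]"

definition enc_nats :: "nat list \<Rightarrow> bool list" where
  "enc_nats ns = concat (map enc_nat ns)"

fun enc_gate :: "gate \<Rightarrow> bool list" where
  "enc_gate (Had i) = enc_nats [0, i]"
| "enc_gate (Phase i) = enc_nats [1, i]"
| "enc_gate (PhaseInv i) = enc_nats [2, i]"
| "enc_gate (CNot i j) = enc_nats [3, i, j]"
| "enc_gate (Toffoli i j k) = enc_nats [4, i, j, k]"

definition enc_circuit :: "qcircuit \<Rightarrow> bool list" where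
  "enc_circuit C = enc_nats [width C, out_len C] @ concat (map enc_gate (gates C))"

lemma enc_nat_append_eq: "enc_nat a @ u = enc_nat b @ v \<longleftrightarrow> a = b \<and> u = v"
proof (induction a arbitrary: b)
  case 0
  then show ?case by (cases b) auto
next
  case (Suc a)
  then show ?case by (cases b) auto
qed

lemma enc_gate_append_eq: "enc_gate g @ u = enc_gate h @ v \<longleftrightarrow> g = h \<and> u = v"
  by (cases g; cases h)
     (auto simp: enc_nats_def enc_nat_append_eq simp del: enc_nat.simps)

lemma inj_enc_circuit: "inj enc_circuit"
proof (rule injI)
  have ne: "enc_gate g \<noteq> []" for g
    by (cases g) (auto simp: enc_nats_def)
  have *: "concat (map enc_gate gs) = concat (map enc_gate hs) \<Longrightarrow> gs = hs" for gs hs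
  proof (induction gs arbitrary: hs)
    case Nil
    then show ?case using ne by (cases hs) auto
  next
    case (Cons g gs)
    then show ?case using ne by (cases hs) (auto simp: enc_gate_append_eq)
  qed
  fix C D assume "enc_circuit C = enc_circuit D"
  then show "C = D"
    using * by (cases C; cases D)
      (auto simp: enc_circuit_def enc_nats_def enc_nat_append_eq simp del: enc_nat.simps)
qed

text \<open>A quantum algorithm is a classical algorithm that maps an input \<open>a\<close> to the description of a
  quantum circuit \<open>Z a\<close>; this circuit is then run on the all-zero basis state and measured
  (Kitaev, Shen and Vyalyi, Classical and Quantum Computation, Section 9).  It runs in polynomial
  time if a deterministic Turing machine computes \<open>a \<mapsto> Z a\<close> in polynomial time.  The algorithm is
  represented by the function \<open>Z\<close>.  Qubit numbers are written in unary, so a circuit with a short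
  description has few qubits.\<close>

type_synonym 'a qalg = "'a \<Rightarrow> qcircuit"

definition polytime_qalg :: "('a \<Rightarrow> bool list list) \<Rightarrow> 'a qalg \<Rightarrow> bool" where
  "polytime_qalg inp Z \<longleftrightarrow>
     (\<forall>a. wf_circuit (Z a)) \<and> polytime_computable inp (\<lambda>a. enc_circuit (Z a))"

definition one_string :: "bool list \<Rightarrow> bool list list" where
  "one_string x = [x]"

definition two_strings :: "bool list \<times> bool list \<Rightarrow> bool list list" where
  "two_strings = (\<lambda>(x, y). [x, y])"

definition prob_bit :: "'a qalg \<Rightarrow> 'a \<Rightarrow> bool \<Rightarrow> real" where
  "prob_bit M a b = qprob (M a) (\<lambda>w. w = [b])"

text \<open>For algorithms with outputs in \<open>\<Sigma>\<^sup>* \<union> {\<bottom>}\<close>, the first output bit tells whether the output is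
  the string formed by the remaining output bits (\<^const>\<open>Some\<close>) or \<open>\<bottom>\<close> (\<^const>\<open>None\<close>).\<close>

fun decode_output :: "bool list \<Rightarrow> bool list option" where
  "decode_output (True # y) = Some y"
| "decode_output _ = None"

definition prob_output :: "'a qalg \<Rightarrow> 'a \<Rightarrow> (bool list option \<Rightarrow> bool) \<Rightarrow> real" where
  "prob_output B a E = qprob (B a) (\<lambda>w. E (decode_output w))"

definition BQP :: "bool list set set" where
  "BQP = {L. \<exists>A. polytime_qalg one_string A \<and>
     (\<forall>x. prob_bit A x (x \<in> L) \<ge> 2/3)}"

text \<open>The NBQP-search problem \<open>(\<Sigma>\<^sup>*, M, p)\<close> is given by \<open>M\<close> and \<open>p\<close>.\<close>

definition nbqp_search_problem :: "(bool list \<times> bool list) qalg \<Rightarrow> (nat \<Rightarrow> nat) \<Rightarrow> bool" where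
  "nbqp_search_problem M p \<longleftrightarrow>
     polytime_qalg two_strings M \<and> polynomial_fun p \<and>
     (\<forall>x y. length y = p (length x) \<longrightarrow> (\<exists>b. prob_bit M (x, y) b \<ge> 2/3))"

definition solutions ::
  "(bool list \<times> bool list) qalg \<Rightarrow> (nat \<Rightarrow> nat) \<Rightarrow> bool list \<Rightarrow> bool list set" where
  "solutions M p x = {y. length y = p (length x) \<and> prob_bit M (x, y) True \<ge> 2/3}"

definition search_language ::
  "(bool list \<times> bool list) qalg \<Rightarrow> (nat \<Rightarrow> nat) \<Rightarrow> bool list set" where
  "search_language M p = {x. solutions M p x \<noteq> {}}"

definition solution_function ::
  "(bool list \<times> bool list) qalg \<Rightarrow> (nat \<Rightarrow> nat) \<Rightarrow> (bool list \<Rightarrow> bool list option) \<Rightarrow> bool" where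
  "solution_function M p f \<longleftrightarrow>
     (\<forall>x. (x \<in> search_language M p \<longrightarrow> (\<exists>s \<in> solutions M p x. f x = Some s)) \<and>
          (x \<notin> search_language M p \<longrightarrow> f x = None))"

definition NBQP :: "bool list set set" where
  "NBQP = {L. \<exists>M p. nbqp_search_problem M p \<and> L = search_language M p}"

definition rel_dist :: "bool list \<Rightarrow> bool list \<Rightarrow> real" where
  "rel_dist y s = real (card {i. i < length s \<and> y ! i \<noteq> s ! i}) / real (length s)"

text \<open>The output \<open>r\<close> is a string within relative distance \<open>d\<close> of the string \<open>u\<close>; this requires equal
  lengths, since relative distance is meaningful only then.\<close>

definition close_output :: "bool list option \<Rightarrow> real \<Rightarrow> bool list option \<Rightarrow> bool" where
  "close_output u d r \<longleftrightarrow>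
     (\<exists>y s. r = Some y \<and> u = Some s \<and> length y = length s \<and> rel_dist y s \<le> d)"

end

theory Submission
  imports Defs
begin

text \<open>
  An output \<open>\<bottom>\<close> is never close to a solution, and \<open>p' > p\<close> makes the success probability in (i) at
  least \<open>2/3\<close>.  So an algorithm \<open>B\<close> with (i) and (ii) outputs a string with probability at least \<open>2/3\<close>
  on inputs in \<open>L\<^sub>M\<close> and with probability at most \<open>1/2\<close> on all others: it decides \<open>L\<^sub>M\<close> with a
  constant gap, whatever \<open>f\<close> is.  It therefore suffices that \<open>L\<^sub>M \<notin> BQP\<close>.  Take a language in
  \<open>NBQP - BQP\<close> and pad its inputs until \<open>p\<close>, which is not constant, reaches the length of its
  witnesses; \<open>M\<close> ignores the superfluous bits of a solution.

  Six rounds of replacing the acceptance probability \<open>a\<close> by \<open>1 - a\<^sup>2\<close>, i.e. of running two copies and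
  negating the conjunction of their answers, turn the gap \<open>(1/2, 2/3)\<close> into \<open>(1/3, 2/3)\<close>.

  Turing machines are produced by compiling while programs on tapes.  Polynomial-time computable
  functions are closed under composition, and all translations needed, including the one on circuit
  descriptions, are composed of finite-state transductions, concatenation and repetition.
\<close>

subsection \<open>While programs on tapes\<close>

text \<open>The two thresholds \<open>2/3\<close> and \<open>1/2\<close> do not lie symmetrically
  about \<open>1/2\<close>, whereas \<open>BQP\<close> asks for \<open>2/3\<close> on both sides.
  The map \<open>a \<mapsto> 1 - a * a\<close> has the fixed point \<open>(sqrt 5 - 1) / 2\<close>,
  about 0.618, strictly inside the gap, and it is repelling: the slope there is about -1.24. The map
  is decreasing, so an even number of rounds keeps the two sides in order and drives them apart; six
  is the least even number that takes \<open>1/2\<close> below \<open>1/3\<close>. A round costs two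
  copies and one Toffoli gate, which keeps the change to a circuit description simple enough for a
  transducer. Polynomial time refers to actual machines, so the padding, the cutting of witnesses
  and the rewriting of circuits all need explicit ones. Machines supplied by hypotheses are
  simulated by programs, composition takes place among programs, and compilation comes last. The
  remaining obstacle is a polynomial with real coefficients: it is evaluated in unary through its
  Newton expansion, whose coefficients are integers.\<close>

datatype prog =
    Act "(nat \<Rightarrow> nat) \<Rightarrow> nat \<Rightarrow> nat \<times> dir"
  | Seq prog prog
  | While "(nat \<Rightarrow> nat) \<Rightarrow> bool" prog

fun scan :: "tape \<Rightarrow> nat" where
  "scan (c, h) = c h"

definition scans :: "(nat \<Rightarrow> tape) \<Rightarrow> nat \<Rightarrow> nat" where
  "scans Ts = (\<lambda>i. scan (Ts i))"

definition act_all :: "(nat \<Rightarrow> nat \<times> dir) \<Rightarrow> (nat \<Rightarrow> tape) \<Rightarrow> nat \<Rightarrow> tape" where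
  "act_all f Ts = (\<lambda>i. act (f i) (Ts i))"

definition idle :: "(nat \<Rightarrow> nat) \<Rightarrow> nat \<Rightarrow> nat \<times> dir" where
  "idle r = (\<lambda>i. (r i, Stay))"

text \<open>The counts are exact machine steps: an action and each evaluation of a loop test cost
  one, while passing from \<open>P\<close> to \<open>Q\<close> in \<open>Seq P Q\<close> costs
  nothing.\<close>

inductive exec :: "prog \<Rightarrow> (nat \<Rightarrow> tape) \<Rightarrow> nat \<Rightarrow> (nat \<Rightarrow> tape) \<Rightarrow> bool" where
  exec_Act: "exec (Act f) Ts 1 (act_all (f (scans Ts)) Ts)"
| exec_Seq: "exec P Ts m Us \<Longrightarrow> exec Q Us n Vs \<Longrightarrow> exec (Seq P Q) Ts (m + n) Vs"
| exec_While_False: "\<not> c (scans Ts) \<Longrightarrow> exec (While c P) Ts 1 Ts"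
| exec_While_True: "c (scans Ts) \<Longrightarrow> exec P Ts m Us \<Longrightarrow> exec (While c P) Us n Vs \<Longrightarrow>
    exec (While c P) Ts (1 + m + n) Vs"

lemma act_idle [simp]: "act (scan t, Stay) t = t"
  by (cases t) simp

lemma act_all_idle [simp]: "act_all (idle (scans Ts)) Ts = Ts"
  by (simp add: act_all_def idle_def scans_def)

lemma act_all_upd [simp]: "act_all (f(i := a)) Ts = (act_all f Ts)(i := act a (Ts i))"
  by (auto simp: act_all_def)

section \<open>Compilation into Turing machines\<close>

fun valid :: "nat \<Rightarrow> nat \<Rightarrow> prog \<Rightarrow> bool" where
  "valid N K (Act f) \<longleftrightarrow> (\<forall>r. (\<forall>i. r i < K) \<longrightarrow>
     (\<forall>i. fst (f r i) < K) \<and> (\<forall>i \<ge> N. f r i = (r i, Stay)))"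
| "valid N K (Seq P Q) \<longleftrightarrow> valid N K P \<and> valid N K Q"
| "valid N K (While c P) \<longleftrightarrow> valid N K P"

fun psize :: "prog \<Rightarrow> nat" where
  "psize (Act f) = 1"
| "psize (Seq P Q) = psize P + psize Q"
| "psize (While c P) = 1 + psize P"

text \<open>The control states of \<open>P\<close> are \<open>b, \<dots>, b + psize P - 1\<close>; it is entered at \<open>b\<close> and left for \<open>e\<close>.\<close>

fun code :: "prog \<Rightarrow> nat \<Rightarrow> nat \<Rightarrow> nat \<Rightarrow> (nat \<Rightarrow> nat) \<Rightarrow> nat \<times> (nat \<Rightarrow> nat \<times> dir)" where
  "code (Act f) b e q r = (e, f r)"
| "code (Seq P Q) b e q r =
     (if q < b + psize P then code P b (b + psize P) q r else code Q (b + psize P) e q r)"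
| "code (While c P) b e q r =
     (if q = b then (if c r then b + 1 else e, idle r) else code P (b + 1) b q r)"

text \<open>A program sees infinitely many tapes, the machine only the first \<open>N\<close>. The
  default symbol \<open>0\<close> is what the remaining tapes show as long as they are
  blank.\<close>

definition compile :: "nat \<Rightarrow> nat \<Rightarrow> prog \<Rightarrow> tm" where
  "compile N K P = \<lparr>num_tapes = N, num_states = psize P, num_syms = K,
     delta = \<lambda>q ss. case code P 0 (psize P) q (\<lambda>i. if i < N then ss ! i else 0) of
       (q', f) \<Rightarrow> (q', map f [0..<N])\<rparr>"

lemma psize_pos: "psize P > 0"
  by (induction P) auto

lemma code_valid:
  assumes "valid N K P" "\<forall>i. r i < K" "b \<le> q" "q < b + psize P" "code P b e q r = (q', f)"
  shows "(q' = e \<or> (b \<le> q' \<and> q' < b + psize P)) \<and> (\<forall>i. fst (f i) < K) \<and> (\<forall>i \<ge> N. f i = (r i, Stay))"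
  using assms
proof (induction P arbitrary: b e q q' f)
  case (Act x)
  then show ?case by auto
next
  case (Seq P Q)
  show ?case
  proof (cases "q < b + psize P")
    case True
    have "(q' = b + psize P \<or> (b \<le> q' \<and> q' < b + psize P)) \<and> (\<forall>i. fst (f i) < K) \<and>
        (\<forall>i \<ge> N. f i = (r i, Stay))"
      by (rule Seq.IH(1)) (use Seq.prems True in simp_all)
    with psize_pos[of Q] show ?thesis by (elim conjE disjE) simp_all
  next
    case False
    have "(q' = e \<or> (b + psize P \<le> q' \<and> q' < b + psize P + psize Q)) \<and> (\<forall>i. fst (f i) < K) \<and>
        (\<forall>i \<ge> N. f i = (r i, Stay))"
      by (rule Seq.IH(2)) (use Seq.prems False in simp_all)
    then show ?thesis by (elim conjE disjE) simp_all
  qed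
next
  case (While c P)
  show ?case
  proof (cases "q = b")
    case True
    with While.prems psize_pos[of P] show ?thesis by (auto simp: idle_def split: if_splits)
  next
    case False
    have "(q' = b \<or> (b + 1 \<le> q' \<and> q' < b + 1 + psize P)) \<and> (\<forall>i. fst (f i) < K) \<and>
        (\<forall>i \<ge> N. f i = (r i, Stay))"
      by (rule While.IH) (use While.prems False in simp_all)
    then show ?thesis by (elim conjE disjE) simp_all
  qed
qed

lemma wf_compile:
  assumes "valid N K P" "K \<ge> 3"
  shows "wf_tm (compile N K P)"
proof -
  have *: "case delta (compile N K P) q ss of (q', acts) \<Rightarrow>
      q' \<le> psize P \<and> length acts = N \<and> fst ` set acts \<subseteq> {..<K}"
    if q: "q < psize P" and ss: "length ss = N" "set ss \<subseteq> {..<K}" for q ss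
  proof -
    let ?r = "\<lambda>i. if i < N then ss ! i else 0"
    have r: "\<forall>i. ?r i < K"
      using ss assms(2) nth_mem by fastforce
    obtain q' f where qf: "code P 0 (psize P) q ?r = (q', f)"
      by (cases "code P 0 (psize P) q ?r")
    with code_valid[OF assms(1) r, of 0 q "psize P" q' f] q have "q' \<le> psize P" "\<forall>i. fst (f i) < K"
      by auto
    with qf show ?thesis by (auto simp: compile_def)
  qed
  show ?thesis
    unfolding wf_tm_def using * assms(2) by (auto simp: compile_def)
qed

definition tapes_ok :: "nat \<Rightarrow> nat \<Rightarrow> (nat \<Rightarrow> tape) \<Rightarrow> bool" where
  "tapes_ok N K Ts \<longleftrightarrow> (\<forall>i \<ge> N. Ts i = string_tape []) \<and> (\<forall>i j. fst (Ts i) j < K)"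

lemma scan_string_tape_Nil [simp]: "scan (string_tape []) = 0"
  by (simp add: string_tape_def)

lemma tapes_ok_scans: "tapes_ok N K Ts \<Longrightarrow> scans Ts i < K"
  unfolding tapes_ok_def scans_def by (cases "Ts i") (metis fst_conv scan.simps)

lemma tapes_ok_act_all:
  assumes "tapes_ok N K Ts" "\<forall>i. fst (f i) < K" "\<forall>i \<ge> N. f i = (scans Ts i, Stay)"
  shows "tapes_ok N K (act_all f Ts)"
proof -
  have "fst (act (f i) (Ts i)) j < K" for i j
  proof (cases "f i")
    case (Pair s d)
    obtain c h where "Ts i = (c, h)" by fastforce
    with Pair assms show ?thesis
      by (simp add: tapes_ok_def) (metis fst_conv)
  qed
  moreover have "act (f i) (Ts i) = string_tape []" if "i \<ge> N" for i
    using assms that act_idle[of "Ts i"] by (auto simp: tapes_ok_def scans_def)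
  ultimately show ?thesis by (auto simp: tapes_ok_def act_all_def)
qed

lemma compile_step:
  assumes ok: "tapes_ok N K Ts" and "q < psize P" "code P 0 (psize P) q (scans Ts) = (q', f)"
  shows "tm_step (compile N K P) (q, map Ts [0..<N]) = (q', map (act_all f Ts) [0..<N])"
proof -
  have r: "(\<lambda>i. if i < N then map (\<lambda>(c, h). c h) (map Ts [0..<N]) ! i else 0) = scans Ts"
  proof
    fix i
    show "(if i < N then map (\<lambda>(c, h). c h) (map Ts [0..<N]) ! i else 0) = scans Ts i"
    proof (cases "i < N")
      case True
      then show ?thesis by (cases "Ts i") (simp add: scans_def)
    qed (use ok in \<open>simp add: tapes_ok_def scans_def\<close>)
  qed
  have "map2 act (map f [0..<N]) (map Ts [0..<N]) = map (act_all f Ts) [0..<N]"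
    by (rule nth_equalityI) (auto simp: act_all_def)
  then show ?thesis
    using assms r by (simp add: tm_step_def compile_def)
qed

text \<open>Here \<open>P\<close> is a block of the enclosing program \<open>W\<close>, entered at
  \<open>b\<close> and left for \<open>e\<close>; all that is known of \<open>W\<close> is that its
  table agrees with that of \<open>P\<close> on this block. This generality lets the induction
  descend into sequences and re-enter loops.\<close>

lemma exec_compile:
  assumes "exec P Ts n Us" "valid N K P" "tapes_ok N K Ts"
    and "\<And>q r. b \<le> q \<Longrightarrow> q < b + psize P \<Longrightarrow> code W 0 (psize W) q r = code P b e q r"
    and "b + psize P \<le> psize W"
  shows "tapes_ok N K Us \<and>
    (tm_step (compile N K W) ^^ n) (b, map Ts [0..<N]) = (e, map Us [0..<N])"
  using assms
proof (induction arbitrary: b e rule: exec.induct)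
  case (exec_Act f Ts)
  have "\<forall>i. scans Ts i < K" using exec_Act tapes_ok_scans by blast
  with exec_Act have "tapes_ok N K (act_all (f (scans Ts)) Ts)"
    by (intro tapes_ok_act_all) auto
  moreover have "code W 0 (psize W) b (scans Ts) = (e, f (scans Ts))"
    using exec_Act.prems(3)[of b] by simp
  ultimately show ?case
    using compile_step[OF exec_Act.prems(2)] exec_Act.prems(4) by simp
next
  case (exec_Seq P Ts m Us Q n Vs)
  have 1: "tapes_ok N K Us \<and>
    (tm_step (compile N K W) ^^ m) (b, map Ts [0..<N]) = (b + psize P, map Us [0..<N])"
    using exec_Seq.prems by (intro exec_Seq.IH(1)) auto
  have "tapes_ok N K Vs \<and>
    (tm_step (compile N K W) ^^ n) (b + psize P, map Us [0..<N]) = (e, map Vs [0..<N])"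
    using exec_Seq.prems 1 by (intro exec_Seq.IH(2)) auto
  with 1 show ?case by (simp add: add.commute[of m] funpow_add)
next
  case (exec_While_False c Ts P)
  have "code W 0 (psize W) b (scans Ts) = (e, idle (scans Ts))"
    using exec_While_False.prems(3)[of b] exec_While_False.hyps by simp
  with compile_step[OF exec_While_False.prems(2)] exec_While_False.prems show ?case by simp
next
  case (exec_While_True c Ts P m Us n Vs)
  have "code W 0 (psize W) b (scans Ts) = (b + 1, idle (scans Ts))"
    using exec_While_True.prems(3)[of b] exec_While_True.hyps by simp
  with compile_step[OF exec_While_True.prems(2)] exec_While_True.prems
  have 0: "tm_step (compile N K W) (b, map Ts [0..<N]) = (b + 1, map Ts [0..<N])" by simp
  have 1: "tapes_ok N K Us \<and>
    (tm_step (compile N K W) ^^ m) (b + 1, map Ts [0..<N]) = (b, map Us [0..<N])"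
    using exec_While_True.prems by (intro exec_While_True.IH(1)) auto
  have 2: "tapes_ok N K Vs \<and>
    (tm_step (compile N K W) ^^ n) (b, map Us [0..<N]) = (e, map Vs [0..<N])"
    using exec_While_True.prems 1 by (intro exec_While_True.IH(2)) auto
  \<comment> \<open>Iterates compose from right to left, so the phases appear in reverse order of
    execution.\<close>
  have "1 + m + n = n + m + 1" by simp
  with 0 1 2 show ?case by (simp only: funpow_add o_apply) simp
qed

lemma tm_step_halted: "(tm_step T ^^ n) (num_states T, ts) = (num_states T, ts)"
  by (induction n) (auto simp: tm_step_def)

text \<open>A halted machine keeps its configuration, so the result of \<open>n\<close> steps can
  still be read at the prescribed time \<open>t\<close>.\<close>

lemma tm_outputs_within_compile:
  assumes "exec P Ts n Us" "valid (Suc N) K P" "K \<ge> 3" "n \<le> t" "length ws \<le> N"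
    and Ts: "map Ts [0..<length ws] = map string_tape ws" "\<And>j. j \<ge> length ws \<Longrightarrow> Ts j = string_tape []"
    and Us: "Us N = string_tape w"
  shows "tm_outputs_within (compile (Suc N) K P) ws t w"
proof -
  let ?T = "compile (Suc N) K P"
  have fst_less: "fst (string_tape v) j < K" for v j
    using assms(3) by (simp add: string_tape_def bit_sym_def)
  have "fst (Ts i) j < K" for i j
  proof (cases "i < length ws")
    case True
    then have "Ts i = string_tape (ws ! i)"
      using arg_cong[OF Ts(1), of "\<lambda>l. l ! i"] by simp
    then show ?thesis using fst_less by simp
  qed (use Ts(2) fst_less in simp)
  then have "tapes_ok (Suc N) K Ts"
    using assms(5) Ts(2) by (auto simp: tapes_ok_def)
  from exec_compile[OF assms(1,2) this, of 0 P "psize P"]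
  have run: "(tm_step ?T ^^ n) (0, map Ts [0..<Suc N]) = (psize P, map Us [0..<Suc N])"
    by simp
  have "map Ts [0..<Suc N] = map Ts [0..<length ws] @ map Ts [length ws..<Suc N]"
    using assms(5) by (metis map_append upt_add_eq_append le_SucI bot_nat_0.extremum le_add_diff_inverse)
  moreover have "map Ts [length ws..<Suc N] = replicate (Suc N - length ws) (string_tape [])"
    using Ts(2) by (intro nth_equalityI) (auto simp del: upt_Suc)
  ultimately have init: "tm_init ?T ws = (0, map Ts [0..<Suc N])"
    unfolding tm_init_def Ts(1) by (simp add: compile_def)
  have [simp]: "num_states ?T = psize P" by (simp add: compile_def)
  have "t = (t - n) + n" using assms(4) by simp
  then have "(tm_step ?T ^^ t) (tm_init ?T ws) =
      (tm_step ?T ^^ (t - n)) ((tm_step ?T ^^ n) (tm_init ?T ws))"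
    by (metis funpow_add o_apply)
  also have "\<dots> = (psize P, map Us [0..<Suc N])"
    unfolding init run using tm_step_halted[of "t - n" ?T] by simp
  finally have "(tm_step ?T ^^ t) (tm_init ?T ws) = (psize P, map Us [0..<Suc N])" .
  then show ?thesis
    using Us by (simp add: tm_outputs_within_def string_tape_def)
qed

subsection \<open>Functions computed by While programs in polynomial time\<close>

definition poly_bounded :: "(nat \<Rightarrow> nat) \<Rightarrow> bool" where
  "poly_bounded t \<longleftrightarrow> mono t \<and> (\<exists>c d. \<forall>n. t n \<le> c * (n + 1) ^ d)"

lemma poly_bounded_const: "poly_bounded (\<lambda>n. c)"
proof -
  have "\<forall>n. c \<le> c * (n + 1) ^ 0" by simp
  then show ?thesis unfolding poly_bounded_def by (blast intro: monoI order_refl)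
qed

lemma poly_bounded_id: "poly_bounded (\<lambda>n. n)"
proof -
  have "\<forall>n::nat. n \<le> 1 * (n + 1) ^ 1" by simp
  then show ?thesis unfolding poly_bounded_def by (blast intro: monoI)
qed

lemma poly_bounded_add:
  assumes "poly_bounded s" "poly_bounded t"
  shows "poly_bounded (\<lambda>n. s n + t n)"
proof -
  obtain c d c' d' where b: "\<And>n. s n \<le> c * (n + 1) ^ d" "\<And>n. t n \<le> c' * (n + 1) ^ d'"
    using assms unfolding poly_bounded_def by blast
  have "s n + t n \<le> (c + c') * (n + 1) ^ (d + d')" for n
  proof -
    have "c * (n + 1) ^ d \<le> c * (n + 1) ^ (d + d')" "c' * (n + 1) ^ d' \<le> c' * (n + 1) ^ (d + d')"
      by (intro mult_le_mono2 power_increasing; simp)+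
    then have "s n + t n \<le> c * (n + 1) ^ (d + d') + c' * (n + 1) ^ (d + d')"
      using b[of n] by linarith
    then show ?thesis by (simp add: algebra_simps)
  qed
  moreover have "mono (\<lambda>n. s n + t n)"
    using assms by (auto simp: poly_bounded_def mono_def intro: add_mono)
  ultimately show ?thesis unfolding poly_bounded_def by blast
qed

lemma poly_bounded_mult:
  assumes "poly_bounded s" "poly_bounded t"
  shows "poly_bounded (\<lambda>n. s n * t n)"
proof -
  obtain c d c' d' where b: "\<And>n. s n \<le> c * (n + 1) ^ d" "\<And>n. t n \<le> c' * (n + 1) ^ d'"
    using assms unfolding poly_bounded_def by blast
  have "s n * t n \<le> (c * c') * (n + 1) ^ (d + d')" for n
    using mult_le_mono[OF b(1)[of n] b(2)[of n]] by (simp add: power_add algebra_simps)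
  moreover have "mono (\<lambda>n. s n * t n)"
    using assms by (auto simp: poly_bounded_def mono_def intro: mult_le_mono)
  ultimately show ?thesis unfolding poly_bounded_def by blast
qed

lemma poly_bounded_comp:
  assumes "poly_bounded s" "poly_bounded t"
  shows "poly_bounded (\<lambda>n. s (t n))"
proof -
  obtain c d c' d' where b: "\<And>n. s n \<le> c * (n + 1) ^ d" "\<And>n. t n \<le> c' * (n + 1) ^ d'"
    using assms unfolding poly_bounded_def by blast
  have "s (t n) \<le> (c * (c' + 1) ^ d) * (n + 1) ^ (d' * d)" for n
  proof -
    have "t n + 1 \<le> (c' + 1) * (n + 1) ^ d'"
      using b(2)[of n] one_le_power[of "n + 1" d'] by (simp only: add_mult_distrib) linarith
    then have "(t n + 1) ^ d \<le> ((c' + 1) * (n + 1) ^ d') ^ d" by (intro power_mono) auto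
    also have "\<dots> = (c' + 1) ^ d * (n + 1) ^ (d' * d)"
      by (simp only: power_mult_distrib power_mult)
    finally have "c * (t n + 1) ^ d \<le> c * ((c' + 1) ^ d * (n + 1) ^ (d' * d))"
      by (rule mult_le_mono2)
    with b(1)[of "t n"] show ?thesis by (simp only: mult.assoc)
  qed
  moreover have "mono (\<lambda>n. s (t n))"
    using assms by (auto simp: poly_bounded_def mono_def)
  ultimately show ?thesis unfolding poly_bounded_def by blast
qed

lemmas poly_bounded_intros =
  poly_bounded_const poly_bounded_id poly_bounded_add poly_bounded_mult

lemma polynomial_fun_const: "polynomial_fun (\<lambda>n. c)"
  unfolding polynomial_fun_def by (rule exI[of _ "[:real c:]"]) simp

lemma polynomial_fun_bound: "polynomial_fun (\<lambda>n. c * (n + 1) ^ d)"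
  unfolding polynomial_fun_def
  by (rule exI[of _ "smult (real c) ([:1, 1:] ^ d)"]) (simp add: algebra_simps)

text \<open>Horner's scheme with every coefficient replaced by its absolute value rounded up: this
  gives a monotone bound even where the polynomial itself decreases.\<close>

lemma polynomial_fun_le:
  assumes "polynomial_fun t"
  shows "\<exists>t'. poly_bounded t' \<and> (\<forall>n. t n \<le> t' n)"
proof -
  obtain P where P: "\<And>n. real (t n) = poly P (real n)"
    using assms unfolding polynomial_fun_def by blast
  have "\<exists>t'. poly_bounded t' \<and> (\<forall>n::nat. \<bar>poly P (real n)\<bar> \<le> real (t' n))"
  proof (induction P)
    case 0
    then show ?case using poly_bounded_const by (intro exI[of _ "\<lambda>n. 0"]) auto
  next
    case (pCons a P)
    then obtain t' where t': "poly_bounded t'" "\<And>n::nat. \<bar>poly P (real n)\<bar> \<le> real (t' n)" by blast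
    have "\<bar>poly (pCons a P) (real n)\<bar> \<le> real (nat \<lceil>\<bar>a\<bar>\<rceil> + n * t' n)" for n
    proof -
      have "\<bar>poly (pCons a P) (real n)\<bar> \<le> \<bar>a\<bar> + real n * \<bar>poly P (real n)\<bar>"
        by (simp add: abs_mult abs_triangle_ineq[THEN order_trans])
      also have "\<dots> \<le> real (nat \<lceil>\<bar>a\<bar>\<rceil>) + real n * real (t' n)"
        using t'(2)[of n] by (intro add_mono mult_left_mono) (auto simp: real_nat_ceiling_ge)
      finally show ?thesis by simp
    qed
    moreover have "poly_bounded (\<lambda>n. nat \<lceil>\<bar>a\<bar>\<rceil> + n * t' n)"
      by (intro poly_bounded_intros t')
    ultimately show ?case by blast
  qed
  then obtain t' where "poly_bounded t'" "\<And>n. \<bar>poly P (real n)\<bar> \<le> real (t' n)" by blast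
  moreover from this have "t n \<le> t' n" for n
    using P[of n] by (metis abs_of_nat of_nat_le_iff)
  ultimately show ?thesis by blast
qed

section \<open>Computability relative to a choice of tapes\<close>

abbreviation blank :: tape where
  "blank \<equiv> string_tape []"

definition total :: "bool list list \<Rightarrow> nat" where
  "total ws = sum_list (map length ws)"

text \<open>\<open>P\<close> reads its inputs on the tapes \<open>ins\<close>, writes its output on tape \<open>out\<close> and has the scratch
  tapes \<open>b, \<dots>, b + s - 1\<close>.  If \<open>keep\<close> is false, it may destroy its inputs.\<close>

definition runs :: "bool \<Rightarrow> nat list \<Rightarrow> nat \<Rightarrow> nat \<Rightarrow> nat \<Rightarrow> (nat \<Rightarrow> nat) \<Rightarrow>
    ('a \<Rightarrow> bool list list) \<Rightarrow> ('a \<Rightarrow> bool list) \<Rightarrow> prog \<Rightarrow> bool" where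
  "runs keep ins out b s t inp g P \<longleftrightarrow>
     (\<forall>a Ts. map Ts ins = map string_tape (inp a) \<longrightarrow> Ts out = blank \<longrightarrow>
        (\<forall>j \<in> {b..<b + s}. Ts j = blank) \<longrightarrow>
        (\<exists>n Us. n \<le> t (total (inp a)) \<and> exec P Ts n Us \<and> Us out = string_tape (g a) \<and>
           (\<forall>j. j \<noteq> out \<longrightarrow> j \<notin> {b..<b + s} \<longrightarrow> (keep \<or> j \<notin> set ins) \<longrightarrow> Us j = Ts j)))"

text \<open>The constants precede the quantifier over tape layouts: a program can be placed anywhere
  at the same cost, and blocks for different functions can be laid side by side. Admitting all
  larger alphabets lets such programs share one machine.\<close>

definition computable :: "bool \<Rightarrow> ('a \<Rightarrow> bool list list) \<Rightarrow> ('a \<Rightarrow> bool list) \<Rightarrow> bool" where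
  "computable keep inp g \<longleftrightarrow>
     (\<exists>K s t. poly_bounded t \<and>
        (\<forall>ins out b. distinct (out # ins) \<and> set ins \<subseteq> {..<b} \<and> out \<notin> {b..<b + s} \<longrightarrow>
           (\<exists>P. (\<forall>N K'. K \<le> K' \<and> b + s \<le> N \<and> out < N \<longrightarrow> valid N K' P) \<and>
                runs keep ins out b s t inp g P)))"

lemma computableI:
  assumes "poly_bounded t"
    and "\<And>ins out b. distinct (out # ins) \<Longrightarrow> set ins \<subseteq> {..<b} \<Longrightarrow> out \<notin> {b..<b + s} \<Longrightarrow>
      \<exists>P. (\<forall>N K'. K \<le> K' \<and> b + s \<le> N \<and> out < N \<longrightarrow> valid N K' P) \<and>
          runs keep ins out b s t inp g P"
  shows "computable keep inp g"
  unfolding computable_def using assms by blast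

text \<open>Symbols are written only under the head, which advances by at most one cell per step; so
  the right border of the used region does too. The purpose is to bound the length of an output by
  the running time.\<close>

lemma exec_extent:
  assumes "exec P Ts n Us" "snd (Ts i) \<le> B" "\<And>x. fst (Ts i) x \<noteq> 0 \<Longrightarrow> x < B"
  shows "snd (Us i) \<le> B + int n \<and> (\<forall>x. fst (Us i) x \<noteq> 0 \<longrightarrow> x < B + int n)"
  using assms
proof (induction arbitrary: B rule: exec.induct)
  case (exec_Act f Ts)
  obtain s d where sd: "f (scans Ts) i = (s, d)" by fastforce
  obtain c h where ch: "Ts i = (c, h)" by fastforce
  have "move d h \<le> h + 1" by (cases d) auto
  then show ?case using exec_Act.prems sd ch by (fastforce simp: act_all_def)
next
  case (exec_Seq P Ts m Us Q n Vs)
  have Us: "snd (Us i) \<le> B + int m" "\<And>x. fst (Us i) x \<noteq> 0 \<Longrightarrow> x < B + int m"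
    using exec_Seq.IH(1)[OF exec_Seq.prems] by blast+
  show ?case using exec_Seq.IH(2)[OF Us] by (simp add: add.assoc)
next
  case (exec_While_False c Ts P)
  then show ?case by fastforce
next
  case (exec_While_True c Ts P m Us n Vs)
  have Us: "snd (Us i) \<le> B + int m" "\<And>x. fst (Us i) x \<noteq> 0 \<Longrightarrow> x < B + int m"
    using exec_While_True.IH(1)[OF exec_While_True.prems] by blast+
  have Vs: "snd (Vs i) \<le> B + int m + int n" "fst (Vs i) x \<noteq> 0 \<Longrightarrow> x < B + int m + int n" for x
    using exec_While_True.IH(2)[OF Us] by blast+
  have "x < B + int (1 + m + n)" if "fst (Vs i) x \<noteq> 0" for x using Vs(2)[OF that] by simp
  moreover have "snd (Vs i) \<le> B + int (1 + m + n)" using Vs(1) by simp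
  ultimately show ?case by blast
qed

lemma exec_output_length:
  assumes "exec P Ts n Us" "Ts i = blank" "Us i = string_tape w"
  shows "length w \<le> n"
proof (cases "w = []")
  case False
  have "fst blank x = 0" "snd blank = 0" for x by (simp_all add: string_tape_def)
  then have "\<forall>x. fst (Us i) x \<noteq> 0 \<longrightarrow> x < 0 + int n"
    by (intro exec_extent[OF assms(1), THEN conjunct2]) (simp_all only: assms(2))
  moreover have "fst (Us i) (int (length w - 1)) = bit_sym (w ! (length w - 1))"
    using False assms(3) by (simp add: string_tape_def)
  moreover have "bit_sym (w ! (length w - 1)) \<noteq> 0" by (simp add: bit_sym_def)
  ultimately have "int (length w - 1) < 0 + int n" by metis
  then show ?thesis by simp
qed simp

text \<open>The bound is obtained by running the program in one concrete layout: inputs on the first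
  tapes, scratch tapes next, the output tape after them.\<close>

lemma computable_length:
  assumes t: "\<And>ins out b. distinct (out # ins) \<Longrightarrow> set ins \<subseteq> {..<b} \<Longrightarrow> out \<notin> {b..<b + s} \<Longrightarrow>
      \<exists>P. runs keep ins out b s t inp g P"
  shows "length (g a) \<le> t (total (inp a))"
proof -
  let ?k = "length (inp a)"
  obtain P where P: "runs keep [0..<?k] (?k + s) ?k s t inp g P"
    using t[of "?k + s" "[0..<?k]" ?k] by (auto simp: lessThan_atLeast0)
  define Ts where "Ts = (\<lambda>i. if i < ?k then string_tape (inp a ! i) else blank)"
  have Ts: "map Ts [0..<?k] = map string_tape (inp a)"
    by (rule nth_equalityI) (auto simp: Ts_def)
  have "\<exists>n Us. n \<le> t (total (inp a)) \<and> exec P Ts n Us \<and> Us (?k + s) = string_tape (g a)"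
    using P[unfolded runs_def, rule_format, OF Ts] by (auto simp: Ts_def)
  then obtain n Us where *: "n \<le> t (total (inp a))" "exec P Ts n Us" "Us (?k + s) = string_tape (g a)"
    by blast
  have "length (g a) \<le> n" by (rule exec_output_length[OF *(2) _ *(3)]) (simp add: Ts_def)
  with *(1) show ?thesis by simp
qed

lemma computableE:
  assumes "computable keep inp g"
  obtains K s t where "poly_bounded t" "\<And>a. length (g a) \<le> t (total (inp a))"
    "\<And>ins out b. distinct (out # ins) \<Longrightarrow> set ins \<subseteq> {..<b} \<Longrightarrow> out \<notin> {b..<b + s} \<Longrightarrow>
      \<exists>P. (\<forall>N K'. K \<le> K' \<and> b + s \<le> N \<and> out < N \<longrightarrow> valid N K' P) \<and>
          runs keep ins out b s t inp g P"
proof -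
  obtain K s t where t: "poly_bounded t" and
    P: "\<And>ins out b. distinct (out # ins) \<Longrightarrow> set ins \<subseteq> {..<b} \<Longrightarrow> out \<notin> {b..<b + s} \<Longrightarrow>
      \<exists>P. (\<forall>N K'. K \<le> K' \<and> b + s \<le> N \<and> out < N \<longrightarrow> valid N K' P) \<and>
          runs keep ins out b s t inp g P"
    using assms unfolding computable_def by meson
  have "\<exists>P. runs keep ins out b s t inp g P"
    if "distinct (out # ins)" "set ins \<subseteq> {..<b}" "out \<notin> {b..<b + s}" for ins out b
    using P[OF that] by blast
  then have "length (g a) \<le> t (total (inp a))" for a by (rule computable_length)
  from that[OF t this P] show thesis by blast
qed

lemma computable_imp_polytime_computable:
  assumes g: "computable keep inp g" and k: "\<And>a. length (inp a) = k"
  shows "polytime_computable inp g"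
proof -
  obtain K s t where t: "poly_bounded t"
    and P: "\<And>ins out b. distinct (out # ins) \<and> set ins \<subseteq> {..<b} \<and> out \<notin> {b..<b + s} \<longrightarrow>
           (\<exists>P. (\<forall>N K'. K \<le> K' \<and> b + s \<le> N \<and> out < N \<longrightarrow> valid N K' P) \<and>
                runs keep ins out b s t inp g P)"
    using g unfolding computable_def by blast
  define N where "N = k + s"
  define K' where "K' = max K 3"
  have "\<exists>P. (\<forall>M K'. K \<le> K' \<and> k + s \<le> M \<and> N < M \<longrightarrow> valid M K' P) \<and>
      runs keep [0..<k] N k s t inp g P"
    using P[of N "[0..<k]" k] by (auto simp: N_def)
  then obtain P where val: "valid (Suc N) K' P" and run: "runs keep [0..<k] N k s t inp g P"
    by (metis N_def K'_def lessI less_imp_le_nat max.cobounded1)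
  \<comment> \<open>The time bound \<open>t\<close> need not be a polynomial itself; the machine is
    given a polynomial that dominates it.\<close>
  obtain c d where cd: "\<And>n. t n \<le> c * (n + 1) ^ d"
    using t unfolding poly_bounded_def by blast
  have "tm_outputs_within (compile (Suc N) K' P) (inp a) (c * (total (inp a) + 1) ^ d) (g a)" for a
  proof -
    define Ts where "Ts = (\<lambda>i. if i < k then string_tape (inp a ! i) else blank)"
    have Ts: "map Ts [0..<k] = map string_tape (inp a)"
      by (rule nth_equalityI) (auto simp: k Ts_def)
    have "\<exists>n Us. n \<le> t (total (inp a)) \<and> exec P Ts n Us \<and> Us N = string_tape (g a)"
      using run[unfolded runs_def, rule_format, OF Ts] by (auto simp: Ts_def N_def)
    then obtain n Us where *: "n \<le> t (total (inp a))" "exec P Ts n Us" "Us N = string_tape (g a)"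
      by blast
    show ?thesis
      by (rule tm_outputs_within_compile[OF *(2) val _ _ _ _ _ *(3)])
        (use *(1) cd[of "total (inp a)"] Ts in \<open>auto simp: k K'_def N_def Ts_def\<close>)
  qed
  moreover have "wf_tm (compile (Suc N) K' P)"
    by (intro wf_compile val) (simp add: K'_def)
  moreover have "length (inp a) < num_tapes (compile (Suc N) K' P)" for a
    by (simp add: compile_def k N_def)
  ultimately show ?thesis
    unfolding polytime_computable_def total_def[symmetric]
    using polynomial_fun_bound by (intro exI conjI allI) auto
qed

section \<open>Several outputs and composition\<close>

definition runs_list :: "nat list \<Rightarrow> nat list \<Rightarrow> nat \<Rightarrow> nat \<Rightarrow> (nat \<Rightarrow> nat) \<Rightarrow>
    ('a \<Rightarrow> bool list list) \<Rightarrow> ('a \<Rightarrow> bool list) list \<Rightarrow> prog \<Rightarrow> bool" where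
  "runs_list ins outs b s t inp gs P \<longleftrightarrow>
     (\<forall>a Ts. map Ts ins = map string_tape (inp a) \<longrightarrow>
        (\<forall>j \<in> set outs \<union> {b..<b + s}. Ts j = blank) \<longrightarrow>
        (\<exists>n Us. n \<le> t (total (inp a)) \<and> exec P Ts n Us \<and>
           map Us outs = map (\<lambda>g. string_tape (g a)) gs \<and>
           (\<forall>j. j \<notin> set outs \<longrightarrow> j \<notin> {b..<b + s} \<longrightarrow> Us j = Ts j)))"

definition list_computable :: "('a \<Rightarrow> bool list list) \<Rightarrow> ('a \<Rightarrow> bool list) list \<Rightarrow> bool" where
  "list_computable inp gs \<longleftrightarrow>
     (\<exists>K s t. poly_bounded t \<and> (\<forall>a. total (map (\<lambda>g. g a) gs) \<le> t (total (inp a))) \<and>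
        (\<forall>ins outs b. distinct (outs @ ins) \<and> length outs = length gs \<and> set (outs @ ins) \<subseteq> {..<b} \<longrightarrow>
           (\<exists>P. (\<forall>N K'. K \<le> K' \<and> b + s \<le> N \<longrightarrow> valid N K' P) \<and>
                runs_list ins outs b s t inp gs P)))"

lemma list_computableI:
  assumes "poly_bounded t" "\<And>a. total (map (\<lambda>g. g a) gs) \<le> t (total (inp a))"
    and "\<And>ins outs b. distinct (outs @ ins) \<Longrightarrow> length outs = length gs \<Longrightarrow>
      set (outs @ ins) \<subseteq> {..<b} \<Longrightarrow>
      \<exists>P. (\<forall>N K'. K \<le> K' \<and> b + s \<le> N \<longrightarrow> valid N K' P) \<and> runs_list ins outs b s t inp gs P"
  shows "list_computable inp gs"
  unfolding list_computable_def using assms by blast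

lemma list_computableE:
  assumes "list_computable inp gs"
  obtains K s t where "poly_bounded t" "\<And>a. total (map (\<lambda>g. g a) gs) \<le> t (total (inp a))"
    "\<And>ins outs b. distinct (outs @ ins) \<Longrightarrow> length outs = length gs \<Longrightarrow>
      set (outs @ ins) \<subseteq> {..<b} \<Longrightarrow>
      \<exists>P. (\<forall>N K'. K \<le> K' \<and> b + s \<le> N \<longrightarrow> valid N K' P) \<and> runs_list ins outs b s t inp gs P"
  using assms unfolding list_computable_def by (elim exE conjE) (rule that; blast)

text \<open>Scratch tapes are left dirty, so \<open>g\<close> and \<open>gs\<close> receive disjoint
  blocks of them; each function still finds its inputs because the previous ones were computed with
  \<open>keep\<close>.\<close>

lemma computable_list:
  assumes "\<And>g. g \<in> set gs \<Longrightarrow> computable True inp g"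
  shows "list_computable inp gs"
  using assms
proof (induction gs)
  case Nil
  have run: "exec (Act idle) Ts 1 Ts" for Ts
    using exec_Act[of idle Ts] by simp
  show ?case
  proof (rule list_computableI[where t = "\<lambda>n. 1" and s = 0 and K = 0])
    show "poly_bounded (\<lambda>n. 1)" by (rule poly_bounded_const)
    show "total (map (\<lambda>g. g a) []) \<le> 1" for a by (simp add: total_def)
    fix ins outs :: "nat list" and b :: nat
    assume "length outs = length ([] :: ('a \<Rightarrow> bool list) list)"
    then have "runs_list ins outs b 0 (\<lambda>n. 1) inp [] (Act idle)"
      using run unfolding runs_list_def by fastforce
    then show "\<exists>P. (\<forall>N K'. 0 \<le> K' \<and> b + 0 \<le> N \<longrightarrow> valid N K' P) \<and>
        runs_list ins outs b 0 (\<lambda>n. 1) inp [] P"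
      by (intro exI[of _ "Act idle"]) (simp add: idle_def)
  qed
next
  case (Cons g gs)
  have "list_computable inp gs" by (rule Cons.IH, rule Cons.prems) simp
  then obtain K1 s1 t1 where t1: "poly_bounded t1"
      "\<And>a. total (map (\<lambda>g. g a) gs) \<le> t1 (total (inp a))"
    and P1: "\<And>ins outs b. distinct (outs @ ins) \<Longrightarrow> length outs = length gs \<Longrightarrow>
        set (outs @ ins) \<subseteq> {..<b} \<Longrightarrow>
        \<exists>P. (\<forall>N K'. K1 \<le> K' \<and> b + s1 \<le> N \<longrightarrow> valid N K' P) \<and>
           runs_list ins outs b s1 t1 inp gs P"
    by (rule list_computableE) blast
  have "computable True inp g" by (rule Cons.prems) simp
  then obtain K2 s2 t2 where t2: "poly_bounded t2"
      "\<And>a. length (g a) \<le> t2 (total (inp a))"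
    and P2: "\<And>ins out b. distinct (out # ins) \<Longrightarrow> set ins \<subseteq> {..<b} \<Longrightarrow> out \<notin> {b..<b + s2} \<Longrightarrow>
           \<exists>P. (\<forall>N K'. K2 \<le> K' \<and> b + s2 \<le> N \<and> out < N \<longrightarrow> valid N K' P) \<and>
                runs True ins out b s2 t2 inp g P"
    by (rule computableE) blast
  show ?case
  proof (rule list_computableI[where t = "\<lambda>n. t2 n + t1 n" and s = "s1 + s2" and K = "max K1 K2"])
    show "poly_bounded (\<lambda>n. t2 n + t1 n)" using t1 t2 by (intro poly_bounded_intros)
    show "total (map (\<lambda>g. g a) (g # gs)) \<le> t2 (total (inp a)) + t1 (total (inp a))" for a
      using t1(2)[of a] t2(2)[of a] by (simp add: total_def)
    fix ins outs :: "nat list" and b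
    assume *: "distinct (outs @ ins)" "length outs = length (g # gs)" "set (outs @ ins) \<subseteq> {..<b}"
    then obtain out outs' where outs: "outs = out # outs'" by (cases outs) auto
    obtain Q1 where Q1: "\<And>N K'. K1 \<le> K' \<Longrightarrow> b + s1 \<le> N \<Longrightarrow> valid N K' Q1"
        "runs_list ins outs' b s1 t1 inp gs Q1"
      using P1[of outs' ins b] * outs by auto
    obtain Q2 where Q2: "\<And>N K'. K2 \<le> K' \<Longrightarrow> b + s1 + s2 \<le> N \<Longrightarrow> out < N \<Longrightarrow> valid N K' Q2"
        "runs True ins out (b + s1) s2 t2 inp g Q2"
      using P2[of out ins "b + s1"] * outs by fastforce
    show "\<exists>P. (\<forall>N K'. max K1 K2 \<le> K' \<and> b + (s1 + s2) \<le> N \<longrightarrow> valid N K' P) \<and>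
runs_list ins outs b (s1 + s2) (\<lambda>n. t2 n + t1 n) inp (g # gs) P"
    proof (intro exI[of _ "Seq Q2 Q1"] conjI allI impI)
      fix N K' assume "max K1 K2 \<le> K' \<and> b + (s1 + s2) \<le> N"
      then show "valid N K' (Seq Q2 Q1)" using Q1(1) Q2(1) * outs by auto
    next
      show "runs_list ins outs b (s1 + s2) (\<lambda>n. t2 n + t1 n) inp (g # gs) (Seq Q2 Q1)"
        unfolding runs_list_def
      proof (intro allI impI)
        fix a Ts
        assume Ts: "map Ts ins = map string_tape (inp a)"
          and bl: "\<forall>j \<in> set outs \<union> {b..<b + (s1 + s2)}. Ts j = blank"
        obtain m Us where Us: "m \<le> t2 (total (inp a))" "exec Q2 Ts m Us" "Us out = string_tape (g a)"
            "\<And>j. j \<noteq> out \<Longrightarrow> j \<notin> {b + s1..<b + s1 + s2} \<Longrightarrow> Us j = Ts j"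
          using Q2(2)[unfolded runs_def, rule_format, OF Ts] bl outs by auto
        have same: "Us j = Ts j" if "j \<in> set ins \<union> set outs' \<union> {b..<b + s1}" for j
          using that * outs by (intro Us(4)) auto
        have "map Us ins = map Ts ins" using same by auto
        then have "map Us ins = map string_tape (inp a)" using Ts by simp
        moreover have "Us j = blank" if "j \<in> set outs' \<union> {b..<b + s1}" for j
          using same[of j] bl that outs by auto
        ultimately obtain n Vs where Vs: "n \<le> t1 (total (inp a))" "exec Q1 Us n Vs"
            "map Vs outs' = map (\<lambda>g. string_tape (g a)) gs"
            "\<And>j. j \<notin> set outs' \<Longrightarrow> j \<notin> {b..<b + s1} \<Longrightarrow> Vs j = Us j"
          using Q1(2) unfolding runs_list_def by blast
        have "Vs out = Us out" using * outs by (intro Vs(4)) auto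
        then have "map Vs outs = map (\<lambda>g. string_tape (g a)) (g # gs)"
          using Us(3) Vs(3) outs by simp
        moreover have "\<forall>j. j \<notin> set outs \<longrightarrow> j \<notin> {b..<b + (s1 + s2)} \<longrightarrow> Vs j = Ts j"
          using Vs(4) Us(4) outs by auto
        moreover have "exec (Seq Q2 Q1) Ts (m + n) Vs" using Us(2) Vs(2) by (rule exec_Seq)
        moreover have "m + n \<le> t2 (total (inp a)) + t1 (total (inp a))" using Us Vs by simp
        ultimately show "\<exists>n Us. n \<le> t2 (total (inp a)) + t1 (total (inp a)) \<and>
            exec (Seq Q2 Q1) Ts n Us \<and> map Us outs = map (\<lambda>g. string_tape (g a)) (g # gs) \<and>
            (\<forall>j. j \<notin> set outs \<longrightarrow> j \<notin> {b..<b + (s1 + s2)} \<longrightarrow> Us j = Ts j)"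
          by blast
      qed
    qed
  qed
qed

text \<open>The program for \<open>h\<close> may destroy its inputs, since these are intermediate
  strings on fresh tapes; the original inputs survive. With projections as \<open>gs\<close>, a
  destructive program becomes one that keeps its inputs.\<close>

lemma computable_comp:
  assumes h: "computable keep inp' h" and gs: "\<And>g. g \<in> set gs \<Longrightarrow> computable True inp g"
    and inp': "\<And>a. inp' (\<phi> a) = map (\<lambda>g. g a) gs"
  shows "computable True inp (\<lambda>a. h (\<phi> a))"
proof -
  have "list_computable inp gs" by (intro computable_list gs)
  then obtain K1 s1 t1 where t1: "poly_bounded t1"
      "\<And>a. total (map (\<lambda>g. g a) gs) \<le> t1 (total (inp a))"
    and P1: "\<And>ins outs b. distinct (outs @ ins) \<Longrightarrow> length outs = length gs \<Longrightarrow>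
        set (outs @ ins) \<subseteq> {..<b} \<Longrightarrow>
        \<exists>P. (\<forall>N K'. K1 \<le> K' \<and> b + s1 \<le> N \<longrightarrow> valid N K' P) \<and>
           runs_list ins outs b s1 t1 inp gs P"
    by (rule list_computableE) blast
  obtain K2 s2 t2 where t2: "poly_bounded t2"
      "\<And>a. length (h a) \<le> t2 (total (inp' a))"
    and P2: "\<And>ins out b. distinct (out # ins) \<Longrightarrow> set ins \<subseteq> {..<b} \<Longrightarrow> out \<notin> {b..<b + s2} \<Longrightarrow>
           \<exists>P. (\<forall>N K'. K2 \<le> K' \<and> b + s2 \<le> N \<and> out < N \<longrightarrow> valid N K' P) \<and>
                runs keep ins out b s2 t2 inp' h P"
    using h by (rule computableE) blast
  \<comment> \<open>Monotonicity of \<open>t2\<close> enters here: only an upper bound is known for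
    the total length of the intermediate strings.\<close>
  have bound: "t2 (total (inp' (\<phi> a))) \<le> t2 (t1 (total (inp a)))" for a
    using t1(2)[of a] t2(1) unfolding inp' poly_bounded_def by (blast dest: monoD)
  let ?k = "length gs"
  show ?thesis
  proof (rule computableI[where t = "\<lambda>n. t1 n + t2 (t1 n)" and s = "?k + (s1 + s2)" and K = "max K1 K2"])
    show "poly_bounded (\<lambda>n. t1 n + t2 (t1 n))"
      by (rule poly_bounded_add[OF t1(1) poly_bounded_comp[OF t2(1) t1(1)]])
    fix ins :: "nat list" and out b
    assume *: "distinct (out # ins)" "set ins \<subseteq> {..<b}" "out \<notin> {b..<b + (?k + (s1 + s2))}"
    let ?outs = "[b..<b + ?k]"
    obtain Q1 where Q1: "\<And>N K'. K1 \<le> K' \<Longrightarrow> b + ?k + s1 \<le> N \<Longrightarrow> valid N K' Q1"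
        "runs_list ins ?outs (b + ?k) s1 t1 inp gs Q1"
      using P1[of ?outs ins "b + ?k"] * by fastforce
    obtain Q2 where Q2: "\<And>N K'. K2 \<le> K' \<Longrightarrow> b + ?k + s1 + s2 \<le> N \<Longrightarrow> out < N \<Longrightarrow> valid N K' Q2"
        "runs keep ?outs out (b + ?k + s1) s2 t2 inp' h Q2"
      using P2[of out ?outs "b + ?k + s1"] * by fastforce
    show "\<exists>P. (\<forall>N K'. max K1 K2 \<le> K' \<and> b + (?k + (s1 + s2)) \<le> N \<and> out < N \<longrightarrow> valid N K' P) \<and>
        runs True ins out b (?k + (s1 + s2)) (\<lambda>n. t1 n + t2 (t1 n)) inp (\<lambda>a. h (\<phi> a)) P"
    proof (intro exI[of _ "Seq Q1 Q2"] conjI allI impI)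
      fix N K' assume "max K1 K2 \<le> K' \<and> b + (?k + (s1 + s2)) \<le> N \<and> out < N"
      then show "valid N K' (Seq Q1 Q2)" using Q1(1) Q2(1) by auto
    next
      show "runs True ins out b (?k + (s1 + s2)) (\<lambda>n. t1 n + t2 (t1 n)) inp (\<lambda>a. h (\<phi> a)) (Seq Q1 Q2)"
        unfolding runs_def
      proof (intro allI impI)
        fix a Ts
        assume Ts: "map Ts ins = map string_tape (inp a)" "Ts out = blank"
          and bl: "\<forall>j \<in> {b..<b + (?k + (s1 + s2))}. Ts j = blank"
        obtain m Us where Us: "m \<le> t1 (total (inp a))" "exec Q1 Ts m Us"
            "map Us ?outs = map (\<lambda>g. string_tape (g a)) gs"
            "\<And>j. j \<notin> set ?outs \<Longrightarrow> j \<notin> {b + ?k..<b + ?k + s1} \<Longrightarrow> Us j = Ts j"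
          using Q1(2)[unfolded runs_list_def, rule_format, OF Ts(1)] bl by fastforce
        have 1: "map Us ?outs = map string_tape (inp' (\<phi> a))"
          using Us(3) by (simp add: inp')
        have 2: "Us out = blank"
          using Ts(2) * by (subst Us(4)) auto
        have "\<forall>j \<in> {b + ?k + s1..<b + ?k + s1 + s2}. Us j = blank"
          using bl by (auto simp: Us(4))
        from Q2(2)[unfolded runs_def, rule_format, OF 1 2 this[rule_format]]
        obtain n Vs where Vs: "n \<le> t2 (total (inp' (\<phi> a)))" "exec Q2 Us n Vs"
          "Vs out = string_tape (h (\<phi> a))"
          "\<And>j. j \<noteq> out \<Longrightarrow> j \<notin> {b + ?k + s1..<b + ?k + s1 + s2} \<Longrightarrow> j \<notin> set ?outs \<Longrightarrow> Vs j = Us j"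
          by auto
        have "\<forall>j. j \<noteq> out \<longrightarrow> j \<notin> {b..<b + (?k + (s1 + s2))} \<longrightarrow> Vs j = Ts j"
          using Vs(4) Us(4) by auto
        moreover have "exec (Seq Q1 Q2) Ts (m + n) Vs" using Us(2) Vs(2) by (rule exec_Seq)
        moreover have "m + n \<le> t1 (total (inp a)) + t2 (t1 (total (inp a)))"
          using Us(1) Vs(1) bound[of a] by simp
        ultimately show "\<exists>n Us. n \<le> t1 (total (inp a)) + t2 (t1 (total (inp a))) \<and>
          exec (Seq Q1 Q2) Ts n Us \<and> Us out = string_tape (h (\<phi> a)) \<and>
          (\<forall>j. j \<noteq> out \<longrightarrow> j \<notin> {b..<b + (?k + (s1 + s2))} \<longrightarrow> True \<or> j \<notin> set ins \<longrightarrow> Us j = Ts j)"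
          using Vs(3) by blast
      qed
    qed
  qed
qed

subsection \<open>Elementary programs\<close>

definition sym_tape :: "nat list \<Rightarrow> int \<Rightarrow> tape" where
  "sym_tape w h = ((\<lambda>i. if 0 \<le> i \<and> i < int (length w) then w ! nat i else 0), h)"

abbreviation end_tape :: "nat list \<Rightarrow> tape" where
  "end_tape w \<equiv> sym_tape w (int (length w))"

lemma string_tape_conv: "string_tape w = sym_tape (map bit_sym w) 0"
  by (auto simp: string_tape_def sym_tape_def fun_eq_iff)

lemma scan_sym_tape: "h < length w \<Longrightarrow> scan (sym_tape w (int h)) = w ! h"
  by (simp add: sym_tape_def)

lemma scan_end_tape: "scan (end_tape w) = 0"
  by (simp add: sym_tape_def)

lemma scan_sym_tape_left: "scan (sym_tape w (- 1)) = 0"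
  by (simp add: sym_tape_def)

lemma act_keep: "act (scan t, d) t = (fst t, move d (snd t))"
  by (cases t) simp

lemma sym_tape_move: "snd (sym_tape w h) = h" "(fst (sym_tape w h), h') = sym_tape w h'"
  by (simp_all add: sym_tape_def)

lemma act_write: "act (s, Rightward) (end_tape w) = end_tape (w @ [s])"
  by (auto simp: sym_tape_def nth_append fun_eq_iff nat_eq_iff)

lemma bit_sym_pos [simp]: "bit_sym b \<noteq> 0"
  by (simp add: bit_sym_def)

lemma bit_sym_less: "bit_sym b < 3"
  by (simp add: bit_sym_def)

lemma bit_sym_eq_2 [simp]: "bit_sym b = 2 \<longleftrightarrow> b"
  by (simp add: bit_sym_def)

definition shift :: "nat \<Rightarrow> dir \<Rightarrow> prog" where
  "shift i d = Act (\<lambda>r. (idle r)(i := (r i, d)))"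

lemma exec_shift: "exec (shift i d) Ts 1 (Ts(i := (fst (Ts i), move d (snd (Ts i)))))"
  using exec_Act[of "\<lambda>r. (idle r)(i := (r i, d))" Ts]
  by (simp add: shift_def) (simp add: scans_def act_keep)

lemma valid_shift: "i < N \<Longrightarrow> valid N K (shift i d)"
  by (auto simp: shift_def idle_def)

lemma exec_cong:
  "exec P Ts n Us \<Longrightarrow> n = n' \<Longrightarrow> Ts = Ts' \<Longrightarrow> Us = Us' \<Longrightarrow> exec P Ts' n' Us'"
  by simp

lemma exec_resultI:
  "exec P Ts n Us \<Longrightarrow> n \<le> t \<Longrightarrow> Q Us \<Longrightarrow> R Us \<Longrightarrow>
    \<exists>n Us. n \<le> t \<and> exec P Ts n Us \<and> Q Us \<and> R Us"
  by blast

text \<open>The first move leaves the blank on which the head may stand behind the word; the loop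
  ends on the blank at cell \<open>-1\<close>, one cell too far.\<close>

definition rewind :: "nat \<Rightarrow> prog" where
  "rewind i = Seq (shift i Leftward) (Seq (While (\<lambda>r. r i \<noteq> 0) (shift i Leftward)) (shift i Rightward))"

lemma valid_rewind: "i < N \<Longrightarrow> valid N K (rewind i)"
  by (simp add: rewind_def valid_shift)

lemma exec_rewind_loop:
  assumes "0 \<notin> set w" "h \<le> length w"
  shows "exec (While (\<lambda>r. r i \<noteq> 0) (shift i Leftward)) (Ts(i := sym_tape w (int h - 1)))
    (2 * h + 1) (Ts(i := sym_tape w (- 1)))"
  using assms(2)
proof (induction h)
  case 0
  have "\<not> scans (Ts(i := sym_tape w (- 1))) i \<noteq> 0"
    by (simp add: scans_def scan_sym_tape_left)
  from exec_While_False[where c = "\<lambda>r. r i \<noteq> 0" and P = "shift i Leftward", OF this] show ?case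
    by (rule exec_cong) (auto simp: fun_eq_iff)
next
  case (Suc h)
  have "w ! h \<in> set w" using Suc.prems by simp
  then have "w ! h \<noteq> 0" using assms(1) by metis
  then have "scans (Ts(i := sym_tape w (int (Suc h) - 1))) i \<noteq> 0"
    using Suc.prems by (simp add: scans_def scan_sym_tape)
  moreover have "exec (shift i Leftward) (Ts(i := sym_tape w (int (Suc h) - 1))) 1
      (Ts(i := sym_tape w (int h - 1)))"
    using exec_shift[of i Leftward "Ts(i := sym_tape w (int (Suc h) - 1))"]
    by (simp add: sym_tape_def)
  moreover have "exec (While (\<lambda>r. r i \<noteq> 0) (shift i Leftward)) (Ts(i := sym_tape w (int h - 1)))
      (2 * h + 1) (Ts(i := sym_tape w (- 1)))"
    by (rule exec_cong[OF Suc.IH]) (use Suc.prems in \<open>auto simp: fun_eq_iff\<close>)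
  ultimately have "exec (While (\<lambda>r. r i \<noteq> 0) (shift i Leftward))
      (Ts(i := sym_tape w (int (Suc h) - 1))) (1 + 1 + (2 * h + 1)) (Ts(i := sym_tape w (- 1)))"
    by (rule exec_While_True[where c = "\<lambda>r. r i \<noteq> 0"])
  then show ?case by (rule exec_cong) (auto simp: fun_eq_iff)
qed

lemma exec_rewind:
  assumes "0 \<notin> set w" "h \<le> length w" "Ts i = sym_tape w (int h)"
  shows "exec (rewind i) Ts (2 * h + 3) (Ts(i := sym_tape w 0))"
proof -
  have 1: "exec (shift i Leftward) Ts 1 (Ts(i := sym_tape w (int h - 1)))"
    using exec_shift[of i Leftward Ts] assms(3) by (simp add: sym_tape_def)
  have 2: "exec (shift i Rightward) (Ts(i := sym_tape w (- 1))) 1 (Ts(i := sym_tape w 0))"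
    using exec_shift[of i Rightward "Ts(i := sym_tape w (- 1))"] by (simp add: sym_tape_def)
  from exec_Seq[OF 1 exec_Seq[OF exec_rewind_loop[OF assms(1,2)] 2]]
  show ?thesis unfolding rewind_def by (rule exec_cong) simp_all
qed

lemma zero_notin_bit_syms [simp]: "0 \<notin> bit_sym ` A"
  by (auto simp: bit_sym_def)

lemma exec_rewind_string:
  assumes "Ts i = end_tape (map bit_sym w)"
  shows "exec (rewind i) Ts (2 * length w + 3) (Ts(i := string_tape w))"
  using exec_rewind[of "map bit_sym w" "length w" Ts i] assms by (simp add: string_tape_conv)

definition copy :: "nat \<Rightarrow> nat \<Rightarrow> prog" where
  "copy i j = While (\<lambda>r. r i \<noteq> 0)
     (Act (\<lambda>r. (idle r)(i := (r i, Rightward), j := (r i, Rightward))))"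

lemma valid_copy: "i < N \<Longrightarrow> j < N \<Longrightarrow> valid N K (copy i j)"
  by (auto simp: copy_def idle_def)

text \<open>The source is any tape that carries \<open>w\<close> followed by a blank: the output
  tape of a simulated machine may hold further symbols elsewhere.\<close>

lemma exec_copy:
  assumes "i \<noteq> j" "\<And>k. k < length w \<Longrightarrow> c (h + int k) = w ! k" "c (h + int (length w)) = 0"
    and "0 \<notin> set w" "Ts i = (c, h)" "Ts j = end_tape u"
  shows "exec (copy i j) Ts (2 * length w + 1)
    (Ts(i := (c, h + int (length w)), j := end_tape (u @ w)))"
  using assms
proof (induction w arbitrary: h u Ts)
  case Nil
  then have "\<not> scans Ts i \<noteq> 0" by (simp add: scans_def)
  then have "exec (copy i j) Ts 1 Ts"
    unfolding copy_def by (rule exec_While_False)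
  then show ?case by (rule exec_cong) (use Nil in \<open>auto simp: fun_eq_iff\<close>)
next
  case (Cons x w)
  let ?f = "\<lambda>r. (idle r)(i := (r i, Rightward), j := (r i, Rightward))"
  define Us where "Us = Ts(i := (c, h + 1), j := end_tape (u @ [x]))"
  have ci: "c h = x" "x \<noteq> 0" using Cons.prems(2)[of 0] Cons.prems(4) by auto
  then have cx: "c(h := x) = c" by auto
  from ci have sc: "scans Ts i = x" "x \<noteq> 0" using Cons.prems by (auto simp: scans_def)
  have "act_all (?f (scans Ts)) Ts = Us"
    using Cons.prems(1,5,6) cx sc(1) act_write[of x u] by (simp add: Us_def)
  with exec_Act[of ?f Ts] have 1: "exec (Act ?f) Ts 1 Us" by simp
  have "exec (copy i j) Us (2 * length w + 1)
     (Us(i := (c, h + 1 + int (length w)), j := end_tape ((u @ [x]) @ w)))"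
  proof (rule Cons.IH)
    show "c (h + 1 + int k) = w ! k" if "k < length w" for k
      using Cons.prems(2)[of "Suc k"] that by (simp add: algebra_simps)
    show "c (h + 1 + int (length w)) = 0" using Cons.prems(3) by (simp add: algebra_simps)
  qed (use Cons.prems in \<open>auto simp: Us_def\<close>)
  then have 2: "exec (copy i j) Us (2 * length w + 1)
     (Ts(i := (c, h + int (length (x # w))), j := end_tape (u @ x # w)))"
    by (rule exec_cong) (use Cons.prems(1) in \<open>auto simp: Us_def fun_eq_iff\<close>)
  have "scans Ts i \<noteq> 0" using sc by simp
  from exec_While_True[of "\<lambda>r. r i \<noteq> 0", OF this 1 2[unfolded copy_def]] show ?case
    unfolding copy_def by (rule exec_cong) (auto simp: fun_eq_iff)
qed

lemma exec_copy_string: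
  assumes "i \<noteq> j" "Ts i = string_tape w" "Ts j = end_tape u"
  shows "exec (copy i j) Ts (2 * length w + 1)
    (Ts(i := end_tape (map bit_sym w), j := end_tape (u @ map bit_sym w)))"
proof -
  have "exec (copy i j) Ts (2 * length (map bit_sym w) + 1)
    (Ts(i := (fst (string_tape w), 0 + int (length (map bit_sym w))), j := end_tape (u @ map bit_sym w)))"
    by (rule exec_copy) (use assms in \<open>auto simp: string_tape_def\<close>)
  moreover have "(fst (string_tape w), 0 + int (length (map bit_sym w))) = end_tape (map bit_sym w)"
    by (simp add: string_tape_conv sym_tape_def)
  ultimately show ?thesis by simp
qed

definition append_string :: "nat \<Rightarrow> nat \<Rightarrow> prog" where
  "append_string i j = Seq (copy i j) (rewind i)"

lemma valid_append_string: "i < N \<Longrightarrow> j < N \<Longrightarrow> valid N K (append_string i j)"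
  by (simp add: append_string_def valid_copy valid_rewind)

lemma exec_append_string:
  assumes "i \<noteq> j" "Ts i = string_tape w" "Ts j = end_tape u"
  shows "exec (append_string i j) Ts (4 * length w + 4) (Ts(j := end_tape (u @ map bit_sym w)))"
proof -
  let ?Us = "Ts(i := end_tape (map bit_sym w), j := end_tape (u @ map bit_sym w))"
  have "exec (rewind i) ?Us (2 * length w + 3) (?Us(i := string_tape w))"
    using assms(1) by (intro exec_rewind_string) simp
  from exec_Seq[OF exec_copy_string[OF assms] this] show ?thesis
    unfolding append_string_def
    by (rule exec_cong) (use assms in \<open>auto simp: fun_eq_iff\<close>)
qed

text \<open>The length of the word is bounded by a constant, so the loop is unrolled into
  \<open>k\<close> actions that idle once the word is exhausted.\<close>

fun emit :: "((nat \<Rightarrow> nat) \<Rightarrow> nat list) \<Rightarrow> nat \<Rightarrow> nat \<Rightarrow> prog" where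
  "emit f out 0 = Act idle"
| "emit f out (Suc k) = Seq (emit f out k)
     (Act (\<lambda>r. (idle r)(out := if k < length (f r) then (f r ! k, Rightward) else (r out, Stay))))"

lemma valid_emit:
  assumes "out < N" "\<And>r. set (f r) \<subseteq> {..<K}"
  shows "valid N K (emit f out k)"
proof (induction k)
  case (Suc k)
  have "f r ! k < K" if "k < length (f r)" for r
    using assms(2)[of r] that nth_mem by blast
  with Suc assms(1) show ?case by (auto simp: idle_def)
qed (simp add: idle_def)

text \<open>The word must not depend on the symbol under the output head, since that symbol changes
  as the head advances.\<close>

lemma exec_emit:
  assumes "Ts out = end_tape u" "\<And>r x. f (r(out := x)) = f r"
  shows "exec (emit f out k) Ts (Suc k) (Ts(out := end_tape (u @ take k (f (scans Ts)))))"
proof (induction k)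
  case 0
  have "Ts = Ts(out := end_tape u)" using assms(1) by (auto simp: fun_eq_iff)
  then show ?case using exec_Act[of idle Ts] by simp
next
  case (Suc k)
  let ?w = "f (scans Ts)"
  let ?Us = "Ts(out := end_tape (u @ take k ?w))"
  have "scans ?Us = (scans Ts)(out := scan (?Us out))" by (auto simp: scans_def)
  then have fU: "f (scans ?Us) = ?w" using assms(2) by metis
  let ?f = "\<lambda>r. (idle r)(out := if k < length (f r) then (f r ! k, Rightward) else (r out, Stay))"
  have "act_all (?f (scans ?Us)) ?Us = Ts(out := end_tape (u @ take (Suc k) ?w))"
  proof (cases "k < length ?w")
    case True
    with fU show ?thesis using act_write[of "?w ! k" "u @ take k ?w"]
      by (simp add: take_Suc_conv_app_nth)
  next
    case False
    with fU have "?f (scans ?Us) = idle (scans ?Us)" by (auto simp: idle_def fun_eq_iff)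
    then have "act_all (?f (scans ?Us)) ?Us = ?Us" by simp
    with False show ?thesis by simp
  qed
  with exec_Act[of ?f ?Us] have "exec (Act ?f) ?Us 1 (Ts(out := end_tape (u @ take (Suc k) ?w)))"
    by simp
  from exec_Seq[OF Suc this] show ?case unfolding emit.simps
    by (rule exec_cong) (auto simp: fun_eq_iff)
qed

lemma blank_conv: "blank = end_tape []"
  by (simp add: string_tape_conv)

section \<open>Projections, concatenation and repetition\<close>

lemma computable_nth:
  assumes "\<And>a. length (inp a) = k" "i < k"
  shows "computable True inp (\<lambda>a. inp a ! i)"
proof (rule computableI[where t = "\<lambda>n. 6 * n + 7" and s = 0 and K = 0])
  show "poly_bounded (\<lambda>n. 6 * n + 7)" by (intro poly_bounded_intros)
  have le: "length (inp a ! i) \<le> total (inp a)" for a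
    using assms by (simp add: total_def member_le_sum_list)
  fix ins :: "nat list" and out b
  assume *: "distinct (out # ins)" "set ins \<subseteq> {..<b}" "out \<notin> {b..<b + 0}"
  show "\<exists>P. (\<forall>N K'. 0 \<le> K' \<and> b + 0 \<le> N \<and> out < N \<longrightarrow> valid N K' P) \<and>
      runs True ins out b 0 (\<lambda>n. 6 * n + 7) inp (\<lambda>a. inp a ! i) P"
  proof (cases "length ins = k")
    case True
    then have i: "ins ! i \<in> set ins" using assms(2) by simp
    show ?thesis
    proof (intro exI[of _ "Seq (append_string (ins ! i) out) (rewind out)"] conjI allI impI)
      show "valid N K' (Seq (append_string (ins ! i) out) (rewind out))"
        if "0 \<le> K' \<and> b + 0 \<le> N \<and> out < N" for N K'
        using that i * by (auto intro!: valid_append_string valid_rewind)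
      show "runs True ins out b 0 (\<lambda>n. 6 * n + 7) inp (\<lambda>a. inp a ! i)
          (Seq (append_string (ins ! i) out) (rewind out))"
        unfolding runs_def
      proof (intro allI impI)
        fix a Ts
        assume Ts: "map Ts ins = map string_tape (inp a)" "Ts out = blank"
        have 1: "Ts (ins ! i) = string_tape (inp a ! i)"
          using arg_cong[OF Ts(1), of "\<lambda>l. l ! i"] True assms by simp
        have 2: "exec (append_string (ins ! i) out) Ts (4 * length (inp a ! i) + 4)
            (Ts(out := end_tape (map bit_sym (inp a ! i))))" (is "exec _ _ _ ?Us")
          using exec_append_string[of "ins ! i" out Ts, OF _ 1, of "[]"] i * Ts(2)
          by (auto simp: blank_conv)
        have "exec (rewind out) ?Us (2 * length (inp a ! i) + 3) (?Us(out := string_tape (inp a ! i)))"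
          by (rule exec_rewind_string) simp
        from exec_Seq[OF 2 this]
        show "\<exists>n Us. n \<le> 6 * total (inp a) + 7 \<and>
            exec (Seq (append_string (ins ! i) out) (rewind out)) Ts n Us \<and>
            Us out = string_tape (inp a ! i) \<and>
            (\<forall>j. j \<noteq> out \<longrightarrow> j \<notin> {b..<b + 0} \<longrightarrow> True \<or> j \<notin> set ins \<longrightarrow> Us j = Ts j)"
          by (rule exec_resultI) (use le[of a] in auto)
      qed
    qed
  next
    case False
    \<comment> \<open>With a wrong number of input tapes the premise of \<open>runs\<close> is never
      met, so any program will do.\<close>
    then have "runs True ins out b 0 (\<lambda>n. 6 * n + 7) inp (\<lambda>a. inp a ! i) (Act idle)"
      using assms(1) unfolding runs_def by (metis length_map)
    then show ?thesis by (intro exI[of _ "Act idle"]) (simp add: idle_def)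
  qed
qed

lemma two_strings_simps [simp]: "two_strings (u, v) = [u, v]" "length (two_strings p) = 2"
  by (auto simp: two_strings_def split: prod.splits)

lemma one_string_simps [simp]: "length (one_string x) = 1"
  by (simp add: one_string_def)

lemma computable_two_stringsI:
  assumes "poly_bounded t"
    and valid: "\<And>i j out b N K'. K \<le> K' \<Longrightarrow> i < N \<Longrightarrow> j < N \<Longrightarrow> out < N \<Longrightarrow> b + s \<le> N \<Longrightarrow>
      valid N K' (P i j out b)"
    and exec: "\<And>i j out b u v Ts. distinct [i, j, out] \<Longrightarrow> i < b \<Longrightarrow> j < b \<Longrightarrow> out \<notin> {b..<b + s} \<Longrightarrow>
      Ts i = string_tape u \<Longrightarrow> Ts j = string_tape v \<Longrightarrow> Ts out = blank \<Longrightarrow>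
      (\<And>k. k \<in> {b..<b + s} \<Longrightarrow> Ts k = blank) \<Longrightarrow>
      \<exists>n Us. n \<le> t (length u + length v) \<and> exec (P i j out b) Ts n Us \<and>
        Us out = string_tape (F u v) \<and>
        (\<forall>k. k \<notin> {i, j, out} \<longrightarrow> k \<notin> {b..<b + s} \<longrightarrow> Us k = Ts k)"
  shows "computable False two_strings (\<lambda>(u, v). F u v)"
proof (rule computableI[OF assms(1)])
  fix ins :: "nat list" and out b
  assume *: "distinct (out # ins)" "set ins \<subseteq> {..<b}" "out \<notin> {b..<b + s}"
  show "\<exists>P. (\<forall>N K'. K \<le> K' \<and> b + s \<le> N \<and> out < N \<longrightarrow> valid N K' P) \<and>
      runs False ins out b s t two_strings (\<lambda>(u, v). F u v) P"
  proof (cases "\<exists>i j. ins = [i, j]")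
    case True
    then obtain i j where ij: "ins = [i, j]" by blast
    have "runs False ins out b s t two_strings (\<lambda>(u, v). F u v) (P i j out b)"
      unfolding runs_def
    proof (intro allI impI)
      fix a Ts
      assume Ts: "map Ts ins = map string_tape (two_strings a)" "Ts out = blank"
        "\<forall>j \<in> {b..<b + s}. Ts j = blank"
      obtain u v where a: "a = (u, v)" by (cases a)
      show "\<exists>n Us. n \<le> t (total (two_strings a)) \<and> exec (P i j out b) Ts n Us \<and>
          Us out = string_tape (case a of (u, v) \<Rightarrow> F u v) \<and>
          (\<forall>k. k \<noteq> out \<longrightarrow> k \<notin> {b..<b + s} \<longrightarrow> False \<or> k \<notin> set ins \<longrightarrow> Us k = Ts k)"
        using exec[of i j out b Ts u v] Ts * by (auto simp: a ij total_def)
    qed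
    moreover have "\<forall>N K'. K \<le> K' \<and> b + s \<le> N \<and> out < N \<longrightarrow> valid N K' (P i j out b)"
      using * ij by (auto intro!: valid)
    ultimately show ?thesis by blast
  next
    case False
    then have "length ins \<noteq> 2" by (auto simp: length_Suc_conv numeral_2_eq_2)
    then have "runs False ins out b s t two_strings (\<lambda>(u, v). F u v) (Act idle)"
      unfolding runs_def by (metis length_map two_strings_simps(2))
    then show ?thesis by (intro exI[of _ "Act idle"]) (simp add: idle_def)
  qed
qed

lemma computable_append: "computable False two_strings (\<lambda>(u, v). u @ v)"
proof (rule computable_two_stringsI[where t = "\<lambda>n. 6 * n + 11" and s = 0 and K = 0 and
    P = "\<lambda>i j out b. Seq (append_string i out) (Seq (append_string j out) (rewind out))"])
  show "poly_bounded (\<lambda>n. 6 * n + 11)" by (intro poly_bounded_intros)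
  show "valid N K' (Seq (append_string i out) (Seq (append_string j out) (rewind out)))"
    if "i < N" "j < N" "out < N" for i j out N K'
    using that by (simp add: valid_append_string valid_rewind)
  fix i j out b :: nat and u v Ts
  assume d: "distinct [i, j, out]" and Ts: "Ts i = string_tape u" "Ts j = string_tape v" "Ts out = blank"
  let ?Us = "Ts(out := end_tape ([] @ map bit_sym u))"
  have 1: "exec (append_string i out) Ts (4 * length u + 4) ?Us"
    using d Ts by (intro exec_append_string) (auto simp: blank_conv)
  have 2: "exec (append_string j out) ?Us (4 * length v + 4)
      (?Us(out := end_tape (([] @ map bit_sym u) @ map bit_sym v)))" (is "exec _ _ _ ?Vs")
    using d Ts by (intro exec_append_string) auto
  have "exec (rewind out) ?Vs (2 * length (u @ v) + 3) (?Vs(out := string_tape (u @ v)))"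
    by (rule exec_rewind_string) simp
  from exec_Seq[OF 1 exec_Seq[OF 2 this]]
  show "\<exists>n Us. n \<le> 6 * (length u + length v) + 11 \<and>
      exec (Seq (append_string i out) (Seq (append_string j out) (rewind out))) Ts n Us \<and>
      Us out = string_tape (u @ v) \<and>
      (\<forall>k. k \<notin> {i, j, out} \<longrightarrow> k \<notin> {b..<b + 0} \<longrightarrow> Us k = Ts k)"
    by (rule exec_resultI) auto
qed

text \<open>The head on tape \<open>i\<close> serves as the counter: \<open>m\<close> is the number
  of bits of \<open>u\<close> still to be read, hence of copies still to be written.\<close>

lemma exec_repeat_loop:
  assumes d: "distinct [i, j, out]" and j: "Ts j = string_tape v"
    and "h + m = length u" "Ts i = sym_tape (map bit_sym u) (int h)" "Ts out = end_tape w"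
  shows "exec (While (\<lambda>r. r i \<noteq> 0) (Seq (append_string j out) (shift i Rightward))) Ts
    (m * (4 * length v + 6) + 1)
    (Ts(i := end_tape (map bit_sym u), out := end_tape (w @ concat (replicate m (map bit_sym v)))))"
  using assms
proof (induction m arbitrary: h w Ts)
  case 0
  then have "\<not> scans Ts i \<noteq> 0"
    using scan_end_tape[of "map bit_sym u"] by (simp add: scans_def)
  then have "exec (While (\<lambda>r. r i \<noteq> 0) (Seq (append_string j out) (shift i Rightward))) Ts 1 Ts"
    by (rule exec_While_False)
  then show ?case by (rule exec_cong) (use 0 in \<open>auto simp: fun_eq_iff\<close>)
next
  case (Suc m)
  have c: "scans Ts i \<noteq> 0"
    using Suc.prems by (simp add: scans_def scan_sym_tape)
  let ?Us = "Ts(out := end_tape (w @ map bit_sym v))"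
  let ?Vs = "?Us(i := sym_tape (map bit_sym u) (int (Suc h)))"
  have "exec (append_string j out) Ts (4 * length v + 4) ?Us"
    using Suc.prems by (intro exec_append_string) auto
  moreover have "exec (shift i Rightward) ?Us 1 ?Vs"
    using exec_shift[of i Rightward ?Us] Suc.prems by (simp add: sym_tape_move add.commute)
  ultimately have 1: "exec (Seq (append_string j out) (shift i Rightward)) Ts (4 * length v + 4 + 1) ?Vs"
    by (rule exec_Seq)
  have 2: "exec (While (\<lambda>r. r i \<noteq> 0) (Seq (append_string j out) (shift i Rightward))) ?Vs
    (m * (4 * length v + 6) + 1)
    (?Vs(i := end_tape (map bit_sym u),
      out := end_tape ((w @ map bit_sym v) @ concat (replicate m (map bit_sym v)))))"
    by (rule Suc.IH[of _ "Suc h"]) (use Suc.prems in auto)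
  from exec_While_True[of "\<lambda>r. r i \<noteq> 0", OF c 1 2] show ?case
    by (rule exec_cong) (use Suc.prems in \<open>auto simp: fun_eq_iff\<close>)
qed

lemma length_concat_replicate: "length (concat (replicate m v)) = m * length v"
  by (induction m) auto

lemma computable_repeat: "computable False two_strings (\<lambda>(u, v). concat (replicate (length u) v))"
proof (rule computable_two_stringsI[where t = "\<lambda>n. n * (4 * n + 6) + 1 + (2 * (n * n) + 3)"
    and s = 0 and K = 0 and
    P = "\<lambda>i j out b. Seq (While (\<lambda>r. r i \<noteq> 0) (Seq (append_string j out) (shift i Rightward)))
      (rewind out)"])
  let ?t = "\<lambda>n. n * (4 * n + 6) + 1 + (2 * (n * n) + 3) :: nat"
  show "poly_bounded ?t" by (intro poly_bounded_intros)
  have le: "m * n \<le> (m + n) * (m + n)" for m n :: nat by (intro mult_le_mono) auto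
  show "valid N K' (Seq (While (\<lambda>r. r i \<noteq> 0) (Seq (append_string j out) (shift i Rightward)))
      (rewind out))" if "i < N" "j < N" "out < N" for i j out N K'
    using that by (simp add: valid_append_string valid_rewind valid_shift)
  fix i j out b :: nat and u v Ts
  assume d: "distinct [i, j, out]" and Ts: "Ts i = string_tape u" "Ts j = string_tape v" "Ts out = blank"
  let ?w = "concat (replicate (length u) v)"
  have w: "concat (replicate (length u) (map bit_sym v)) = map bit_sym ?w"
    by (simp add: map_concat)
  let ?Us = "Ts(i := end_tape (map bit_sym u), out := end_tape (map bit_sym ?w))"
  have 1: "exec (While (\<lambda>r. r i \<noteq> 0) (Seq (append_string j out) (shift i Rightward))) Ts
    (length u * (4 * length v + 6) + 1) ?Us"
    using exec_repeat_loop[of i j out Ts v 0 "length u" u "[]"] d Ts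
    by (simp add: blank_conv string_tape_conv w)
  have "exec (rewind out) ?Us (2 * length ?w + 3) (?Us(out := string_tape ?w))"
    by (rule exec_rewind_string) simp
  from exec_Seq[OF 1 this]
  have ex: "exec (Seq (While (\<lambda>r. r i \<noteq> 0) (Seq (append_string j out) (shift i Rightward)))
      (rewind out)) Ts (length u * (4 * length v + 6) + 1 + (2 * length ?w + 3))
      (?Us(out := string_tape ?w))" .
  have "length u * (4 * length v + 6) + 1 + (2 * length ?w + 3) \<le> ?t (length u + length v)"
    unfolding length_concat_replicate
    by (intro add_mono mult_le_mono le order_refl) auto
  from ex this show "\<exists>n Us. n \<le> ?t (length u + length v) \<and>
      exec (Seq (While (\<lambda>r. r i \<noteq> 0) (Seq (append_string j out) (shift i Rightward)))
      (rewind out)) Ts n Us \<and> Us out = string_tape ?w \<and>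
      (\<forall>k. k \<notin> {i, j, out} \<longrightarrow> k \<notin> {b..<b + 0} \<longrightarrow> Us k = Ts k)"
    by (rule exec_resultI) auto
qed

subsection \<open>Synchronous transducers with two input tapes\<close>

text \<open>Reading in lockstep lets one string act as a clock or yardstick for the other, as in the
  subtraction of unary numbers and in \<open>fit\<close>.\<close>

fun transduce :: "(nat \<Rightarrow> bool option \<Rightarrow> bool option \<Rightarrow> nat) \<Rightarrow>
    (nat \<Rightarrow> bool option \<Rightarrow> bool option \<Rightarrow> bool list) \<Rightarrow> (nat \<Rightarrow> bool list) \<Rightarrow>
    nat \<Rightarrow> bool list \<Rightarrow> bool list \<Rightarrow> bool list" where
  "transduce nx em fin q [] [] = fin q"
| "transduce nx em fin q (a # u) [] =
     em q (Some a) None @ transduce nx em fin (nx q (Some a) None) u []"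
| "transduce nx em fin q [] (b # v) =
     em q None (Some b) @ transduce nx em fin (nx q None (Some b)) [] v"
| "transduce nx em fin q (a # u) (b # v) =
     em q (Some a) (Some b) @ transduce nx em fin (nx q (Some a) (Some b)) u v"

fun head :: "'a list \<Rightarrow> 'a option" where
  "head [] = None"
| "head (x # xs) = Some x"

lemma transduce_step:
  "u \<noteq> [] \<or> v \<noteq> [] \<Longrightarrow> transduce nx em fin q u v =
    em q (head u) (head v) @ transduce nx em fin (nx q (head u) (head v)) (tl u) (tl v)"
  by (cases u; cases v) auto

definition sym_bit :: "nat \<Rightarrow> bool option" where
  "sym_bit x = (if x = 0 then None else Some (x = 2))"

text \<open>The cells to the left of the head are unrestricted, since a transducer never looks
  back.\<close>

definition upcoming :: "tape \<Rightarrow> bool list \<Rightarrow> bool" where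
  "upcoming t u \<longleftrightarrow> (\<forall>k < length u. fst t (snd t + int k) = bit_sym (u ! k)) \<and>
     fst t (snd t + int (length u)) = 0"

lemma upcoming_string_tape: "upcoming (string_tape u) u"
  by (simp add: upcoming_def string_tape_def)

lemma upcoming_Nil: "upcoming t [] \<Longrightarrow> scan t = 0"
  by (cases t) (simp add: upcoming_def)

lemma upcoming_Cons: "upcoming t (a # u) \<Longrightarrow> scan t = bit_sym a"
  by (cases t) (force simp: upcoming_def)

lemma upcoming_scan: "upcoming t u \<Longrightarrow> sym_bit (scan t) = head u"
  by (cases u) (auto simp: sym_bit_def upcoming_Nil upcoming_Cons)

lemma upcoming_scan_0: "upcoming t u \<Longrightarrow> scan t = 0 \<longleftrightarrow> u = []"
  by (cases u) (auto simp: upcoming_Nil upcoming_Cons)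

lemma upcoming_move:
  assumes "upcoming t u"
  shows "upcoming (act (scan t, if scan t = 0 then Stay else Rightward) t) (tl u)"
proof (cases u)
  case Nil
  with assms show ?thesis by (simp add: upcoming_scan_0)
next
  case (Cons a u')
  then have "scan t \<noteq> 0" using assms by (simp add: upcoming_scan_0)
  moreover have "fst t (snd t + 1 + int k) = bit_sym (u' ! k)" if "k < length u'" for k
    using assms that unfolding upcoming_def Cons
    by (metis (no_types, lifting) Suc_less_eq ab_semigroup_add_class.add_ac(1) length_Cons
      nth_Cons_Suc of_nat_Suc)
  moreover have "fst t (snd t + 1 + int (length u')) = 0"
    using assms by (simp add: upcoming_def Cons algebra_simps)
  ultimately show ?thesis
    by (simp add: Cons upcoming_def act_keep)
qed

text \<open>A control state is stored as a single tape symbol, so the alphabet must be at least as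
  large as the set of states; a blank tape then stands for state \<open>0\<close>.\<close>

definition cell :: "nat \<Rightarrow> tape" where
  "cell q = ((\<lambda>_. 0)(0 := q), 0)"

lemma cell_simps [simp]: "scan (cell q) = q" "act (q', Stay) (cell q) = cell q'"
  by (simp_all add: cell_def)

lemma blank_cell: "blank = cell 0"
  by (simp add: cell_def string_tape_def fun_eq_iff)

lemma scans_upd: "scans (Ts(i := t)) = (scans Ts)(i := scan t)"
  by (auto simp: scans_def)

definition transducer_loop where
  "transducer_loop nx em L i j out b = While (\<lambda>r. r i \<noteq> 0 \<or> r j \<noteq> 0)
     (Seq (emit (\<lambda>r. map bit_sym (em (r b) (sym_bit (r i)) (sym_bit (r j)))) out L)
       (Act (\<lambda>r. (idle r)(b := (nx (r b) (sym_bit (r i)) (sym_bit (r j)), Stay),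
          i := (r i, if r i = 0 then Stay else Rightward),
          j := (r j, if r j = 0 then Stay else Rightward)))))"

definition transducer where
  "transducer nx em fin L i j out b = Seq (transducer_loop nx em L i j out b)
     (Seq (emit (\<lambda>r. map bit_sym (fin (r b))) out L) (rewind out))"

lemma valid_transducer:
  assumes "\<And>q x y. nx q x y < S" "K \<ge> S" "K \<ge> 3" "i < N" "j < N" "out < N" "b + 1 \<le> N"
  shows "valid N K (transducer nx em fin L i j out b)"
proof -
  have *: "bit_sym ` A \<subseteq> {..<K}" for A
    using assms(3) bit_sym_less by (meson image_subsetI lessThan_iff less_le_trans)
  have "nx q x y < K" for q x y
    using assms(1,2) less_le_trans by blast
  then have "valid N K (Act (\<lambda>r. (idle r)(b := (nx (r b) (sym_bit (r i)) (sym_bit (r j)), Stay),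
          i := (r i, if r i = 0 then Stay else Rightward),
          j := (r j, if r j = 0 then Stay else Rightward))))"
    using assms by (auto simp: idle_def)
  then show ?thesis
    unfolding transducer_def transducer_loop_def using assms *
    by (simp add: valid_emit valid_rewind del: valid.simps(1))
qed

text \<open>The bits \<open>fin q'\<close> are still missing when the loop ends; they are emitted
  later from the state left on tape \<open>b\<close>. A round costs one step for the test,
  \<open>L + 1\<close> for the output and one for the transition.\<close>

lemma exec_transducer_loop:
  assumes d: "distinct [i, j, out, b]"
    and L: "\<And>q x y. length (em q x y) \<le> L"
    and "upcoming (Ts i) u" "upcoming (Ts j) v" "Ts b = cell q" "Ts out = end_tape w"
  shows "\<exists>n Us q' z. n \<le> (length u + length v) * (L + 3) + 1 \<and>
    exec (transducer_loop nx em L i j out b) Ts n Us \<and> Us b = cell q' \<and>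
    Us out = end_tape (w @ map bit_sym z) \<and> z @ fin q' = transduce nx em fin q u v \<and>
    length z \<le> L * (length u + length v) \<and> (\<forall>k. k \<notin> {i, j, out, b} \<longrightarrow> Us k = Ts k)"
  using assms(3-)
proof (induction "length u + length v" arbitrary: u v q w Ts rule: less_induct)
  case less
  let ?c = "\<lambda>r :: nat \<Rightarrow> nat. r i \<noteq> 0 \<or> r j \<noteq> 0"
  have c: "?c (scans Ts) \<longleftrightarrow> u \<noteq> [] \<or> v \<noteq> []"
    using less.prems(1,2) by (simp add: scans_def upcoming_scan_0)
  show ?case
  proof (cases "u = [] \<and> v = []")
    case True
    then have "exec (transducer_loop nx em L i j out b) Ts 1 Ts"
      unfolding transducer_loop_def using c by (intro exec_While_False) simp
    with True less.prems show ?thesis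
      by (intro exI[of _ 1] exI[of _ Ts] exI[of _ q] exI[of _ "[]"]) auto
  next
    case False
    let ?x = "head u" and ?y = "head v"
    let ?E = "\<lambda>r. map bit_sym (em (r b) (sym_bit (r i)) (sym_bit (r j)))"
    let ?f = "\<lambda>r. (idle r)(b := (nx (r b) (sym_bit (r i)) (sym_bit (r j)), Stay),
          i := (r i, if r i = 0 then Stay else Rightward),
          j := (r j, if r j = 0 then Stay else Rightward))"
    have sc: "scans Ts b = q" "sym_bit (scans Ts i) = ?x" "sym_bit (scans Ts j) = ?y"
      using less.prems by (auto simp: scans_def upcoming_scan)
    let ?Us = "Ts(out := end_tape (w @ map bit_sym (em q ?x ?y)))"
    have "exec (emit ?E out L) Ts (Suc L) (Ts(out := end_tape (w @ take L (?E (scans Ts)))))"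
      using d less.prems(4) by (intro exec_emit) auto
    then have 1: "exec (emit ?E out L) Ts (Suc L) ?Us"
      using L[of q ?x ?y] by (simp add: sc)
    define Vs where "Vs = act_all (?f (scans ?Us)) ?Us"
    have 2: "exec (Act ?f) ?Us 1 Vs"
      unfolding Vs_def by (rule exec_Act)
    have d': "i \<noteq> out" "j \<noteq> out" "b \<noteq> out" "i \<noteq> b" "j \<noteq> b" using d by auto
    have Vi: "Vs i = act (scan (Ts i), if scan (Ts i) = 0 then Stay else Rightward) (Ts i)"
      and Vj: "Vs j = act (scan (Ts j), if scan (Ts j) = 0 then Stay else Rightward) (Ts j)"
      using d by (auto simp: Vs_def scans_def)
    have Vb: "Vs b = cell (nx q ?x ?y)"
      using d' less.prems(3) by (simp add: Vs_def scans_upd sc)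
    have Vo: "Vs k = ?Us k" if "k \<notin> {i, j, b}" for k
      using that act_idle[of "?Us k"]
      by (simp add: Vs_def act_all_def idle_def scans_def split: if_splits)
    have lt: "length (tl u) + length (tl v) < length u + length v"
      using False by (cases u; cases v) auto
    have "upcoming (Vs i) (tl u)" "upcoming (Vs j) (tl v)"
      unfolding Vi Vj using upcoming_move less.prems(1,2) by blast+
    moreover have "Vs out = end_tape (w @ map bit_sym (em q ?x ?y))"
      using d by (subst Vo) auto
    ultimately obtain n Ws q' z where IH: "n \<le> (length (tl u) + length (tl v)) * (L + 3) + 1"
      "exec (transducer_loop nx em L i j out b) Vs n Ws" "Ws b = cell q'"
      "Ws out = end_tape ((w @ map bit_sym (em q ?x ?y)) @ map bit_sym z)"
      "z @ fin q' = transduce nx em fin (nx q ?x ?y) (tl u) (tl v)"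
      "length z \<le> L * (length (tl u) + length (tl v))"
      "\<And>k. k \<notin> {i, j, out, b} \<Longrightarrow> Ws k = Vs k"
      using less.hyps[of "tl u" "tl v" Vs, OF lt _ _ Vb] by blast
    have ex: "exec (transducer_loop nx em L i j out b) Ts (1 + (Suc L + 1) + n) Ws"
      unfolding transducer_loop_def
      by (rule exec_While_True[OF _ exec_Seq[OF 1 2] IH(2)[unfolded transducer_loop_def]])
        (use c False in simp)
    have "(length (tl u) + length (tl v) + 1) * (L + 3) \<le> (length u + length v) * (L + 3)"
      using lt by (intro mult_le_mono1) simp
    then have "1 + (Suc L + 1) + n \<le> (length u + length v) * (L + 3) + 1"
      using IH(1) by simp
    moreover have "length (em q ?x ?y @ z) \<le> L * (length u + length v)"
    proof -
      have "L * (length (tl u) + length (tl v) + 1) \<le> L * (length u + length v)"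
        using lt by (intro mult_le_mono2) simp
      with IH(6) L[of q ?x ?y] show ?thesis by simp
    qed
    moreover have "(em q ?x ?y @ z) @ fin q' = transduce nx em fin q u v"
      using IH(5) False by (subst transduce_step) auto
    moreover have "\<forall>k. k \<notin> {i, j, out, b} \<longrightarrow> Ws k = Ts k"
      using IH(7) Vo by auto
    moreover have "Ws out = end_tape (w @ map bit_sym (em q ?x ?y @ z))"
      using IH(4) by simp
    ultimately show ?thesis using ex IH(3) by blast
  qed
qed

lemma computable_transduce:
  assumes S: "\<And>q x y. nx q x y < S" and L: "\<And>q x y. length (em q x y) \<le> L" "\<And>q. length (fin q) \<le> L"
  shows "computable False two_strings (\<lambda>(u, v). transduce nx em fin 0 u v)"
proof (rule computable_two_stringsI[where t = "\<lambda>n. n * (L + 3) + 1 + (Suc L + (2 * (L * n + L) + 3))"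
    and s = 1 and K = "max 3 S" and P = "transducer nx em fin L"])
  let ?t = "\<lambda>n. n * (L + 3) + 1 + (Suc L + (2 * (L * n + L) + 3)) :: nat"
  show "poly_bounded ?t" unfolding Suc_eq_plus1 by (intro poly_bounded_intros)
  show "valid N K' (transducer nx em fin L i j out b)"
    if "max 3 S \<le> K'" "i < N" "j < N" "out < N" "b + 1 \<le> N" for N K' i j out b
    by (rule valid_transducer) (use that S in auto)
  fix i j out b :: nat and u v Ts
  assume d: "distinct [i, j, out]" "i < b" "j < b" "out \<notin> {b..<b + 1}"
    and Ts: "Ts i = string_tape u" "Ts j = string_tape v" "Ts out = blank"
      "\<And>k. k \<in> {b..<b + 1} \<Longrightarrow> Ts k = blank"
  have d': "distinct [i, j, out, b]" using d by auto
  have Tb: "Ts b = cell 0" using Ts(4)[of b] by (simp add: blank_cell)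
  have up: "upcoming (Ts i) u" "upcoming (Ts j) v" "Ts out = end_tape []"
    using Ts by (simp_all add: upcoming_string_tape blank_conv)
  obtain n Us q' z where 1: "n \<le> (length u + length v) * (L + 3) + 1"
      "exec (transducer_loop nx em L i j out b) Ts n Us" "Us b = cell q'"
      "Us out = end_tape ([] @ map bit_sym z)" "z @ fin q' = transduce nx em fin 0 u v"
      "length z \<le> L * (length u + length v)" "\<And>k. k \<notin> {i, j, out, b} \<Longrightarrow> Us k = Ts k"
    using exec_transducer_loop[where em = em and nx = nx and fin = fin,
        OF d' L(1) up(1,2) Tb up(3)] by blast
  let ?Vs = "Us(out := end_tape (map bit_sym (z @ fin q')))"
  have "exec (emit (\<lambda>r. map bit_sym (fin (r b))) out L) Us (Suc L)
      (Us(out := end_tape (([] @ map bit_sym z) @ take L (map bit_sym (fin (scans Us b))))))"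
    by (rule exec_emit) (use 1(4) d' in \<open>simp_all del: map_append\<close>)
  then have 2: "exec (emit (\<lambda>r. map bit_sym (fin (r b))) out L) Us (Suc L) ?Vs"
    using L(2)[of q'] 1(3) by (simp add: scans_def)
  have "exec (rewind out) ?Vs (2 * length (z @ fin q') + 3) (?Vs(out := string_tape (z @ fin q')))"
    by (rule exec_rewind_string) simp
  from exec_Seq[OF 1(2) exec_Seq[OF 2 this]]
  have "exec (transducer nx em fin L i j out b) Ts
      (n + (Suc L + (2 * length (z @ fin q') + 3))) (?Vs(out := string_tape (z @ fin q')))"
    unfolding transducer_def .
  moreover have "n + (Suc L + (2 * length (z @ fin q') + 3)) \<le> ?t (length u + length v)"
    using 1(1,6) L(2)[of q'] by simp
  moreover have "(?Vs(out := string_tape (z @ fin q'))) out = string_tape (transduce nx em fin 0 u v)"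
    using 1(5) by simp
  moreover have "\<forall>k. k \<notin> {i, j, out} \<longrightarrow> k \<notin> {b..<b + 1} \<longrightarrow>
      (?Vs(out := string_tape (z @ fin q'))) k = Ts k"
    using 1(7) by simp
  ultimately show "\<exists>n Us. n \<le> ?t (length u + length v) \<and>
      exec (transducer nx em fin L i j out b) Ts n Us \<and>
      Us out = string_tape (transduce nx em fin 0 u v) \<and>
      (\<forall>k. k \<notin> {i, j, out} \<longrightarrow> k \<notin> {b..<b + 1} \<longrightarrow> Us k = Ts k)"
    by (rule exec_resultI)
qed

subsection \<open>Simulating Turing machines\<close>

text \<open>The program keeps the control state of \<open>T\<close> on tape \<open>s\<close> and logs the moves of the head of
  the output tape on tape \<open>lg\<close>: undoing them at the end brings this head back to cell \<open>0\<close>.\<close>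

fun dir_sym :: "dir \<Rightarrow> nat" where
  "dir_sym Leftward = 1"
| "dir_sym Stay = 2"
| "dir_sym Rightward = 3"

definition sym_dir_inv :: "nat \<Rightarrow> dir" where
  "sym_dir_inv x = (if x = 1 then Rightward else if x = 2 then Stay else Leftward)"

text \<open>The idle branch handles symbols foreign to \<open>T\<close>: \<open>wf_tm\<close>
  constrains \<open>delta\<close> only on the states and symbols of \<open>T\<close>, whereas the
  program uses a larger alphabet that also encodes states and directions.\<close>

definition sim_acts :: "tm \<Rightarrow> nat list \<Rightarrow> nat \<Rightarrow> nat \<Rightarrow> (nat \<Rightarrow> nat) \<Rightarrow> nat \<Rightarrow> nat \<times> dir" where
  "sim_acts T tps s lg r =
     (if r s < num_states T \<and> set (map r tps) \<subseteq> {..<num_syms T}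
      then case delta T (r s) (map r tps) of (q', acts) \<Rightarrow>
        (\<lambda>j. if j = s then (q', Stay)
             else if j = lg then (dir_sym (snd (last acts)), Rightward)
             else case map_of (zip tps acts) j of Some a \<Rightarrow> a | None \<Rightarrow> (r j, Stay))
      else idle r)"

definition simulate :: "tm \<Rightarrow> nat list \<Rightarrow> nat \<Rightarrow> nat \<Rightarrow> prog" where
  "simulate T tps s lg = While (\<lambda>r. r s \<noteq> num_states T) (Act (sim_acts T tps s lg))"

definition undo_moves :: "nat \<Rightarrow> nat \<Rightarrow> prog" where
  "undo_moves src lg = Seq (shift lg Leftward) (While (\<lambda>r. r lg \<noteq> 0)
     (Act (\<lambda>r. (idle r)(src := (r src, sym_dir_inv (r lg)), lg := (r lg, Leftward)))))"

lemma wf_tm_delta: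
  assumes "wf_tm T" "q < num_states T" "length ss = num_tapes T" "set ss \<subseteq> {..<num_syms T}"
    and "delta T q ss = (q', acts)"
  shows "q' \<le> num_states T" "length acts = num_tapes T" "fst ` set acts \<subseteq> {..<num_syms T}"
  using assms unfolding wf_tm_def by fastforce+

lemma valid_simulate:
  assumes T: "wf_tm T" "length tps = num_tapes T" and K: "K > num_syms T" "K > num_states T" "K \<ge> 4"
    and N: "set tps \<subseteq> {..<N}" "s < N" "lg < N"
  shows "valid N K (simulate T tps s lg)"
proof -
  have "fst (sim_acts T tps s lg r j) < K \<and> (j \<ge> N \<longrightarrow> sim_acts T tps s lg r j = (r j, Stay))"
    if r: "\<forall>i. r i < K" for r j
  proof (cases "r s < num_states T \<and> set (map r tps) \<subseteq> {..<num_syms T}")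
    case True
    obtain q' acts where qa: "delta T (r s) (map r tps) = (q', acts)" by fastforce
    have wf: "q' \<le> num_states T" "length acts = num_tapes T" "fst ` set acts \<subseteq> {..<num_syms T}"
      using wf_tm_delta[OF T(1) _ _ _ qa] True T(2) by auto
    have "fst a < K" if "map_of (zip tps acts) j = Some a" for a
    proof -
      have "a \<in> set acts" using that by (meson map_of_SomeD set_zip_rightD)
      then have "fst a < num_syms T" using wf(3) by auto
      then show ?thesis using K by simp
    qed
    moreover have "map_of (zip tps acts) j = None" if "j \<ge> N"
      using that N(1) by (auto simp: map_of_eq_None_iff dest!: set_zip_leftD)
    moreover have "dir_sym d < K" for d using K by (cases d) auto
    ultimately show ?thesis
      using True qa wf K r N by (auto simp: sim_acts_def split: option.splits)
  qed (use r in \<open>auto simp: sim_acts_def idle_def\<close>)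
  then show ?thesis by (simp add: simulate_def)
qed

lemma valid_undo_moves: "src < N \<Longrightarrow> lg < N \<Longrightarrow> valid N K (undo_moves src lg)"
  by (auto simp: undo_moves_def valid_shift idle_def)

text \<open>The codes \<open>1\<close>, \<open>2\<close>, \<open>3\<close> of the directions minus
  \<open>2\<close> are signed displacements, so the sum over the log is the head position. None of
  the codes is the blank, which therefore delimits the log.\<close>

definition dir_sum :: "nat list \<Rightarrow> int" where
  "dir_sum D = (\<Sum>x\<leftarrow>D. int x - 2)"

lemma move_dir_sym: "move d h = h + (int (dir_sym d) - 2)"
  by (cases d) auto

text \<open>The last conjunct confines the nonblank cells of the output tape by the length of the
  log, and thereby bounds the output length by the simulated time.\<close>

definition sim_rel :: "tm \<Rightarrow> nat list \<Rightarrow> nat \<Rightarrow> nat \<Rightarrow> config \<Rightarrow> nat list \<Rightarrow> (nat \<Rightarrow> tape) \<Rightarrow> bool" where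
  "sim_rel T tps s lg cfg D Ts \<longleftrightarrow> fst cfg \<le> num_states T \<and> Ts s = cell (fst cfg) \<and> map Ts tps = snd cfg \<and>
     Ts lg = end_tape D \<and> set D \<subseteq> {1, 2, 3} \<and> snd (last (snd cfg)) = dir_sum D \<and>
     (\<forall>t \<in> set (snd cfg). \<forall>i. fst t i < num_syms T) \<and>
     (\<forall>i. fst (last (snd cfg)) i \<noteq> 0 \<longrightarrow> i < int (length D))"

lemma dir_sum_le: "set D \<subseteq> {1, 2, 3} \<Longrightarrow> dir_sum D \<le> int (length D)"
  by (induction D) (auto simp: dir_sum_def)

lemma sim_rel_step:
  assumes T: "wf_tm T" "length tps = num_tapes T" "num_tapes T > 0"
    and d: "distinct (s # lg # tps)" and q: "fst cfg < num_states T"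
    and rel: "sim_rel T tps s lg cfg D Ts"
  shows "\<exists>x. sim_rel T tps s lg (tm_step T cfg) (D @ [x]) (act_all (sim_acts T tps s lg (scans Ts)) Ts) \<and>
    (\<forall>j. j \<notin> set (s # lg # tps) \<longrightarrow> act_all (sim_acts T tps s lg (scans Ts)) Ts j = Ts j)"
proof -
  obtain q ts where cfg: "cfg = (q, ts)" by fastforce
  let ?ss = "map (scans Ts) tps"
  have ts: "ts = map Ts tps" using rel by (simp add: sim_rel_def cfg)
  have ss: "map (\<lambda>(c, h). c h) ts = ?ss"
    by (auto simp: ts scans_def split: prod.splits)
  have sq: "scans Ts s = q" using rel by (simp add: sim_rel_def cfg scans_def)
  have ssK: "set ?ss \<subseteq> {..<num_syms T}"
  proof
    fix x assume "x \<in> set ?ss"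
    then obtain j where j: "j \<in> set tps" "x = scan (Ts j)" by (auto simp: scans_def)
    have "\<forall>i. fst (Ts j) i < num_syms T" using rel j(1) by (auto simp: sim_rel_def cfg ts)
    then show "x \<in> {..<num_syms T}" using j(2) by (cases "Ts j") auto
  qed
  obtain q' acts where qa: "delta T q ?ss = (q', acts)" by fastforce
  have q_less: "q < num_states T" using q by (simp add: cfg)
  have wf: "q' \<le> num_states T" "length acts = num_tapes T" "fst ` set acts \<subseteq> {..<num_syms T}"
    using wf_tm_delta[OF T(1) q_less _ ssK qa] T(2) by auto
  have step: "tm_step T cfg = (q', map2 act acts ts)"
    using q_less qa ss by (simp add: tm_step_def cfg)
  let ?Us = "act_all (sim_acts T tps s lg (scans Ts)) Ts"
  let ?x = "dir_sym (snd (last acts))"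
  have acts: "sim_acts T tps s lg (scans Ts) = (\<lambda>j. if j = s then (q', Stay)
             else if j = lg then (?x, Rightward)
             else case map_of (zip tps acts) j of Some a \<Rightarrow> a | None \<Rightarrow> (scans Ts j, Stay))"
    using q_less ssK qa sq by (simp add: sim_acts_def)
  have Us_s: "?Us s = cell q'" using rel by (simp add: acts act_all_def sim_rel_def cfg)
  have Us_lg: "?Us lg = end_tape (D @ [?x])"
    using rel d act_write[of ?x D] by (simp add: acts act_all_def sim_rel_def)
  have Us_other: "?Us j = Ts j" if "j \<notin> set (s # lg # tps)" for j
  proof -
    have "map_of (zip tps acts) j = None"
      using that by (auto simp: map_of_eq_None_iff dest!: set_zip_leftD)
    with that have "sim_acts T tps s lg (scans Ts) j = (scans Ts j, Stay)" by (simp add: acts)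
    then show ?thesis by (simp add: act_all_def) (simp add: scans_def)
  qed
  have Us_tl: "map ?Us tps = map2 act acts ts"
  proof (rule nth_equalityI)
    show "length (map ?Us tps) = length (map2 act acts ts)" using wf(2) T(2) by (simp add: ts)
    fix i assume "i < length (map ?Us tps)"
    then have i: "i < length tps" by simp
    have "tps ! i \<noteq> s" "tps ! i \<noteq> lg" using d i by (auto simp: in_set_conv_nth)
    moreover have "map_of (zip tps acts) (tps ! i) = Some (acts ! i)"
      using d i wf(2) T(2) by (simp add: map_of_zip_nth)
    ultimately show "map ?Us tps ! i = map2 act acts ts ! i"
      using i wf(2) T(2) by (simp add: acts act_all_def ts)
  qed
  have ne: "acts \<noteq> []" "ts \<noteq> []" using wf(2) T by (auto simp: ts)
  have lens: "length acts = length ts" using wf(2) T by (simp add: ts)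
  have last: "last (map2 act acts ts) = act (last acts) (last ts)"
    using ne lens by (simp add: last_conv_nth)
  obtain a e where ae: "last acts = (a, e)" by fastforce
  obtain c h where ch: "last ts = (c, h)" by fastforce
  have h: "h = dir_sum D" using rel ch by (simp add: sim_rel_def cfg)
  have D: "set D \<subseteq> {1, 2, 3}" using rel by (simp add: sim_rel_def)
  \<comment> \<open>The head is at most one cell to the right per logged move, so a symbol written
    now lies within the bound given by the longer log.\<close>
  have "h \<le> int (length D)" using dir_sum_le[OF D] h by simp
  moreover have "i < int (length D)" if "c i \<noteq> 0" for i
    using rel ch that by (simp add: sim_rel_def cfg)
  ultimately have nz: "\<forall>i. fst (last (map2 act acts ts)) i \<noteq> 0 \<longrightarrow> i < int (length (D @ [?x]))"
    unfolding last ae ch by (auto simp: less_Suc_eq)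
      (metis add.commute less_add_one less_trans not_less zle_add1_eq_le)+
  have "fst t i < num_syms T" if "t \<in> set (map2 act acts ts)" for t i
  proof -
    obtain x where x: "x \<in> set (zip acts ts)" "t = (case x of (a0, t0) \<Rightarrow> act a0 t0)"
      using \<open>t \<in> set (map2 act acts ts)\<close> unfolding set_map by (rule imageE)
    obtain a0 t0 where "x = (a0, t0)" by (cases x)
    with x have k: "(a0, t0) \<in> set (zip acts ts)" "t = act a0 t0" by simp_all
    obtain a' e' where 1: "a0 = (a', e')" by fastforce
    obtain c' h' where 2: "t0 = (c', h')" by fastforce
    have "a0 \<in> set acts" "t0 \<in> set ts" using k by (auto dest: set_zip_leftD set_zip_rightD)
    then have "a' < num_syms T" "\<And>j. c' j < num_syms T"
      using wf(3) rel 1 2 by (force simp: sim_rel_def cfg)+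
    with k 1 2 show ?thesis by simp
  qed
  moreover have "snd (last (map2 act acts ts)) = dir_sum (D @ [?x])"
    unfolding last ae ch using h by (simp add: dir_sum_def move_dir_sym)
  moreover have "?x \<in> {1, 2, 3}" by (cases "snd (last acts)") auto
  ultimately have "sim_rel T tps s lg (tm_step T cfg) (D @ [?x]) ?Us"
    unfolding sim_rel_def step fst_conv snd_conv
    using wf(1) Us_s Us_lg Us_tl nz D by auto
  with Us_other show ?thesis by blast
qed

lemma exec_simulate:
  assumes T: "wf_tm T" "length tps = num_tapes T" "num_tapes T > 0"
    and d: "distinct (s # lg # tps)"
    and "fst ((tm_step T ^^ n) cfg) = num_states T"
    and "sim_rel T tps s lg cfg D Ts"
  shows "\<exists>m Us D'. m \<le> 2 * n + 1 \<and> exec (simulate T tps s lg) Ts m Us \<and>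
    sim_rel T tps s lg ((tm_step T ^^ n) cfg) D' Us \<and> length D' \<le> length D + n \<and>
    (\<forall>j. j \<notin> set (s # lg # tps) \<longrightarrow> Us j = Ts j)"
  using assms(5,6)
proof (induction n arbitrary: cfg D Ts)
  case 0
  then have "exec (simulate T tps s lg) Ts 1 Ts"
    unfolding simulate_def by (intro exec_While_False) (simp add: scans_def sim_rel_def)
  with 0 show ?case by (intro exI[of _ 1] exI[of _ Ts] exI[of _ D]) auto
next
  case (Suc n)
  show ?case
  proof (cases "fst cfg = num_states T")
    case True
    \<comment> \<open>The loop stops as soon as \<open>T\<close> halts, possibly before step
      \<open>n\<close>; the remaining iterates change nothing.\<close>
    then have "(tm_step T ^^ Suc n) cfg = cfg"
      using tm_step_halted[of "Suc n" T "snd cfg"] by (metis prod.collapse)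
    moreover have "exec (simulate T tps s lg) Ts 1 Ts"
      unfolding simulate_def using Suc.prems(2) True
      by (intro exec_While_False) (simp add: scans_def sim_rel_def)
    ultimately show ?thesis using Suc.prems
      by (intro exI[of _ 1] exI[of _ Ts] exI[of _ D]) (auto simp del: funpow.simps)
  next
    case False
    then have less: "fst cfg < num_states T" using Suc.prems(2) by (simp add: sim_rel_def)
    let ?f = "sim_acts T tps s lg"
    obtain x where x: "sim_rel T tps s lg (tm_step T cfg) (D @ [x]) (act_all (?f (scans Ts)) Ts)"
      "\<And>j. j \<notin> set (s # lg # tps) \<Longrightarrow> act_all (?f (scans Ts)) Ts j = Ts j"
      using sim_rel_step[OF T d less Suc.prems(2)] by blast
    have "fst ((tm_step T ^^ n) (tm_step T cfg)) = num_states T"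
      using Suc.prems(1) by (simp add: funpow_swap1)
    from Suc.IH[OF this x(1)] obtain m Us D' where IH: "m \<le> 2 * n + 1"
      "exec (simulate T tps s lg) (act_all (?f (scans Ts)) Ts) m Us"
      "sim_rel T tps s lg ((tm_step T ^^ n) (tm_step T cfg)) D' Us"
      "length D' \<le> length (D @ [x]) + n"
      "\<And>j. j \<notin> set (s # lg # tps) \<Longrightarrow> Us j = act_all (?f (scans Ts)) Ts j" by blast
    have c: "scans Ts s \<noteq> num_states T"
      using False Suc.prems(2) by (simp add: scans_def sim_rel_def)
    have "exec (simulate T tps s lg) Ts (1 + 1 + m) Us"
      unfolding simulate_def
      by (rule exec_While_True[OF _ exec_Act IH(2)[unfolded simulate_def]]) (use c in simp)
    moreover have "sim_rel T tps s lg ((tm_step T ^^ Suc n) cfg) D' Us"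
      using IH(3) by (simp add: funpow_swap1)
    moreover have "\<forall>j. j \<notin> set (s # lg # tps) \<longrightarrow> Us j = Ts j" using IH(5) x(2) by simp
    moreover have "1 + 1 + m \<le> 2 * Suc n + 1" "length D' \<le> length D + Suc n" using IH(1,4) by auto
    ultimately show ?thesis by blast
  qed
qed

text \<open>With the log head at cell \<open>j - 1\<close>, the displacement still to be undone is
  that of the first \<open>j\<close> moves.\<close>

lemma exec_undo_loop:
  assumes "src \<noteq> lg" "set D \<subseteq> {1, 2, 3}" "j \<le> length D"
  shows "exec (While (\<lambda>r. r lg \<noteq> 0)
     (Act (\<lambda>r. (idle r)(src := (r src, sym_dir_inv (r lg)), lg := (r lg, Leftward)))))
     (Ts(src := (c, dir_sum (take j D)), lg := sym_tape D (int j - 1))) (2 * j + 1)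
     (Ts(src := (c, 0), lg := sym_tape D (- 1)))"
  using assms(3)
proof (induction j)
  case 0
  have "\<not> scans (Ts(src := (c, 0), lg := sym_tape D (- 1))) lg \<noteq> 0"
    by (simp add: scans_def scan_sym_tape_left)
  from exec_While_False[where c = "\<lambda>r. r lg \<noteq> 0", OF this] show ?case
    by (rule exec_cong) (auto simp: fun_eq_iff dir_sum_def)
next
  case (Suc j)
  let ?f = "\<lambda>r. (idle r)(src := (r src, sym_dir_inv (r lg)), lg := (r lg, Leftward))"
  let ?Ts = "Ts(src := (c, dir_sum (take (Suc j) D)), lg := sym_tape D (int j))"
  let ?Us = "Ts(src := (c, dir_sum (take j D)), lg := sym_tape D (int j - 1))"
  have "D ! j \<in> set D" using Suc.prems by simp
  then have x: "D ! j \<in> {1, 2, 3}" using assms(2) by blast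
  have sc: "scans ?Ts lg = D ! j" using Suc.prems by (simp add: scans_def scan_sym_tape)
  have "dir_sum (take (Suc j) D) = dir_sum (take j D) + (int (D ! j) - 2)"
    using Suc.prems by (simp add: take_Suc_conv_app_nth dir_sum_def)
  then have "move (sym_dir_inv (D ! j)) (dir_sum (take (Suc j) D)) = dir_sum (take j D)"
    using x by (auto simp: sym_dir_inv_def)
  then have "act (scans ?Ts src, sym_dir_inv (D ! j)) (c, dir_sum (take (Suc j) D)) =
      (c, dir_sum (take j D))"
    using assms(1) by (simp add: scans_def)
  moreover have "act (D ! j, Leftward) (sym_tape D (int j)) = sym_tape D (int j - 1)"
    using act_keep[of "sym_tape D (int j)" Leftward] sc by (simp add: scans_def sym_tape_move)
  ultimately have "act_all (?f (scans ?Ts)) ?Ts = ?Us"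
    using assms(1) sc by simp
  with exec_Act[of ?f ?Ts] have 1: "exec (Act ?f) ?Ts 1 ?Us" by simp
  have 2: "exec (While (\<lambda>r. r lg \<noteq> 0) (Act ?f)) ?Us (2 * j + 1)
      (Ts(src := (c, 0), lg := sym_tape D (- 1)))"
    by (rule exec_cong[OF Suc.IH]) (use Suc.prems in \<open>auto simp: fun_eq_iff\<close>)
  have "scans ?Ts lg \<noteq> 0" using sc x by auto
  from exec_While_True[where c = "\<lambda>r. r lg \<noteq> 0", OF this 1 2] show ?case
    by (rule exec_cong) (auto simp: fun_eq_iff)
qed

lemma exec_undo_moves:
  assumes "src \<noteq> lg" "set D \<subseteq> {1, 2, 3}" "Ts src = (c, dir_sum D)" "Ts lg = end_tape D"
  shows "exec (undo_moves src lg) Ts (2 * length D + 2) (Ts(src := (c, 0), lg := sym_tape D (- 1)))"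
proof -
  have "exec (shift lg Leftward) Ts 1 (Ts(lg := sym_tape D (int (length D) - 1)))"
    using exec_shift[of lg Leftward Ts] assms(4) by (simp add: sym_tape_move)
  then have 1: "exec (shift lg Leftward) Ts 1
      (Ts(src := (c, dir_sum (take (length D) D)), lg := sym_tape D (int (length D) - 1)))"
    by (rule exec_cong) (use assms in \<open>auto simp: fun_eq_iff\<close>)
  from exec_Seq[OF 1 exec_undo_loop[OF assms(1,2) order_refl]] show ?thesis
    unfolding undo_moves_def by (rule exec_cong) auto
qed

lemma map_upt_eqI: "length xs = n \<Longrightarrow> (\<And>i. i < n \<Longrightarrow> f i = xs ! i) \<Longrightarrow> map f [0..<n] = xs"
  by (intro nth_equalityI) auto

text \<open>Tape \<open>b\<close> holds the state, tape \<open>b + 1\<close> the log, and the tapes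
  of \<open>T\<close> beyond its inputs follow. As \<open>T\<close> has more tapes than inputs, its
  output tape is among these, and the copy to \<open>out\<close> stops at the first blank. The
  simulation overwrites the input tapes, hence \<open>keep\<close> is false.\<close>

lemma polytime_computable_imp_computable:
  assumes "polytime_computable inp g"
  shows "computable False inp g"
proof -
  obtain T t0 where T: "wf_tm T" "polynomial_fun t0" "\<And>a. length (inp a) < num_tapes T"
    "\<And>a. tm_outputs_within T (inp a) (t0 (total (inp a))) (g a)"
    using assms unfolding polytime_computable_def total_def by blast
  obtain t where t: "poly_bounded t" "\<And>n. t0 n \<le> t n"
    using polynomial_fun_le[OF T(2)] by blast
  define m where "m = num_tapes T"
  have m: "m > 0" unfolding m_def using T(3) by (metis gr_zeroI not_less_zero)
  define P where "P = (\<lambda>ins out b.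
    let tps = ins @ [b + 2..<b + 2 + (m - length ins)] in
      Seq (simulate T tps b (b + 1)) (Seq (undo_moves (last tps) (b + 1))
        (Seq (copy (last tps) out) (rewind out))))"
  define t' where "t' = (\<lambda>n. (2 * t n + 1) + ((2 * t n + 2) + ((2 * t n + 1) + (2 * t n + 3))))"
  \<comment> \<open>The output is a stretch of nonblank cells starting at cell \<open>0\<close>, so
    the log is at least as long. This bounds the time for the final copy.\<close>
  have len_g: "length (g a) \<le> length D" if "sim_rel T tps s lg ((tm_step T ^^ n) (tm_init T (inp a))) D Ts"
    and "n = t0 (total (inp a))" for a D tps s lg Ts n
  proof (cases "g a = []")
    case False
    obtain q ts where qt: "(tm_step T ^^ n) (tm_init T (inp a)) = (q, ts)" by fastforce
    have "fst (last ts) (int (length (g a) - 1)) = bit_sym (g a ! (length (g a) - 1))"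
      using T(4)[of a] that(2) qt False by (simp add: tm_outputs_within_def)
    then have "fst (last ts) (int (length (g a) - 1)) \<noteq> 0" by simp
    moreover have "\<forall>i. fst (last ts) i \<noteq> 0 \<longrightarrow> i < int (length D)"
      using that(1) qt by (simp add: sim_rel_def)
    ultimately have "int (length (g a) - 1) < int (length D)" by blast
    then show ?thesis by simp
  qed simp
  have run: "runs False ins out b (m + 2) t' inp g (P ins out b)"
    if d: "distinct (out # ins)" "set ins \<subseteq> {..<b}" "out \<notin> {b..<b + (m + 2)}" for ins out b
    unfolding runs_def
  proof (intro allI impI)
    fix a Ts
    assume Ts: "map Ts ins = map string_tape (inp a)" "Ts out = blank"
      "\<forall>j \<in> {b..<b + (m + 2)}. Ts j = blank"
    define scr where "scr = [b + 2..<b + 2 + (m - length ins)]"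
    define tps where "tps = ins @ scr"
    have scr: "set scr = {b + 2..<b + 2 + (m - length ins)}" "distinct scr"
        "length scr = m - length ins"
      unfolding scr_def by (simp_all del: upt_Suc add: length_upt)
    define n where "n = t0 (total (inp a))"
    have len: "length ins = length (inp a)" using Ts(1) by (metis length_map)
    then have len_m: "length ins < m" using T(3)[of a] m_def by simp
    have ltps: "length tps = m" using len_m by (simp add: tps_def scr)
    have "scr \<noteq> []" using scr(3) len_m by auto
    then have src: "last tps \<in> {b + 2..<b + 2 + (m - length ins)}"
      unfolding scr(1)[symmetric] by (simp add: tps_def)
    have dist: "distinct (b # (b + 1) # tps)" using d by (auto simp: tps_def scr)
    have "\<forall>j \<in> set scr. Ts j = blank" using Ts(3) len_m by (auto simp: scr)
    then have "map Ts scr = replicate (length scr) blank"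
      by (simp add: map_replicate_const[symmetric] cong: map_cong)
    then have "map Ts scr = replicate (m - length ins) blank" by (simp add: scr)
    then have init: "tm_init T (inp a) = (0, map Ts tps)"
      using Ts(1) len by (simp add: tm_init_def tps_def m_def)
    have "last (map Ts tps) = Ts (last tps)" using ltps m by (intro last_map) auto
    also have "\<dots> = blank" using src Ts(3) by auto
    finally have last_blank: "last (map Ts tps) = blank" .
    have syms: "num_syms T \<ge> 3" using T(1) by (simp add: wf_tm_def)
    have "fst t i < num_syms T" if "t \<in> set (map Ts tps)" for t i
    proof -
      have "map Ts tps = map string_tape (inp a) @ replicate (m - length (inp a)) blank"
        using init by (simp add: tm_init_def m_def)
      then have "\<exists>w. t = string_tape w" using that by (auto simp: in_set_replicate)
      moreover have "bit_sym x < num_syms T" for x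
        using syms by (simp add: bit_sym_def)
      ultimately show ?thesis using syms by (auto simp: string_tape_def)
    qed
    note tape_syms = this
    have "sim_rel T tps b (b + 1) (tm_init T (inp a)) [] Ts"
    proof -
      have "Ts b = blank" "Ts (b + 1) = blank" using Ts(3) by auto
      then have "Ts b = cell 0" "Ts (b + 1) = end_tape []"
        by (simp_all only: blank_cell[symmetric] blank_conv[symmetric])
      moreover have "snd blank = dir_sum []" "fst blank i = 0" for i
        by (simp_all add: string_tape_def dir_sum_def)
      ultimately show ?thesis
        using last_blank tape_syms
        unfolding sim_rel_def init by simp
    qed
    moreover have "fst ((tm_step T ^^ n) (tm_init T (inp a))) = num_states T"
      using T(4)[of a] unfolding tm_outputs_within_def n_def by (auto split: prod.splits)
    ultimately obtain k1 Us D where Us: "k1 \<le> 2 * n + 1" "exec (simulate T tps b (b + 1)) Ts k1 Us"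
      "sim_rel T tps b (b + 1) ((tm_step T ^^ n) (tm_init T (inp a))) D Us" "length D \<le> n"
      "\<And>j. j \<notin> set (b # (b + 1) # tps) \<Longrightarrow> Us j = Ts j"
      using exec_simulate[OF T(1) _ _ dist, where D = "[]" and n = n] ltps m
      unfolding m_def by (metis add_0 list.size(3))
    obtain q ts where qt: "(tm_step T ^^ n) (tm_init T (inp a)) = (q, ts)" by fastforce
    have "map Us tps = ts" using Us(3) qt by (simp add: sim_rel_def)
    then have last_ts: "last ts = Us (last tps)" using ltps m last_map[of tps Us] by fastforce
    obtain c h where ch: "Us (last tps) = (c, h)" by fastforce
    have c: "\<And>i. i < length (g a) \<Longrightarrow> c (int i) = bit_sym (g a ! i)" "c (int (length (g a))) = 0"
      using T(4)[of a] qt last_ts ch by (simp_all add: tm_outputs_within_def n_def)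
    have h: "h = dir_sum D" and D: "set D \<subseteq> {1, 2, 3}" and lg: "Us (b + 1) = end_tape D"
      using Us(3) qt last_ts ch by (simp_all add: sim_rel_def)
    have len_ga: "length (g a) \<le> n" using len_g[OF Us(3) n_def] Us(4) by simp
    let ?Vs = "Us(last tps := (c, 0), b + 1 := sym_tape D (- 1))"
    have V: "exec (undo_moves (last tps) (b + 1)) Us (2 * length D + 2) ?Vs"
      by (rule exec_undo_moves) (use src D ch h lg in auto)
    have out: "out \<notin> set (b # (b + 1) # tps)"
      using d(1,3) len_m by (auto simp: tps_def scr)
    let ?Ws = "?Vs(last tps := (c, 0 + int (length (map bit_sym (g a)))),
      out := end_tape ([] @ map bit_sym (g a)))"
    have W: "exec (copy (last tps) out) ?Vs (2 * length (map bit_sym (g a)) + 1) ?Ws"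
    proof (rule exec_copy)
      show "last tps \<noteq> out" using out src d(3) by auto
      show "?Vs out = end_tape []"
        using out Us(5)[OF out] Ts(2) \<open>last tps \<noteq> out\<close> by (auto simp: blank_conv)
      show "?Vs (last tps) = (c, 0)" using src by auto
    qed (use c in auto)
    have X: "exec (rewind out) ?Ws (2 * length (g a) + 3) (?Ws(out := string_tape (g a)))"
      by (rule exec_rewind_string) simp
    have "exec (P ins out b) Ts (k1 + (2 * length D + 2 +
        (2 * length (map bit_sym (g a)) + 1 + (2 * length (g a) + 3)))) (?Ws(out := string_tape (g a)))"
      unfolding P_def Let_def scr_def[symmetric] tps_def[symmetric]
      by (intro exec_Seq[OF Us(2)] exec_Seq[OF V] exec_Seq[OF W] X)
    moreover have "k1 + (2 * length D + 2 + (2 * length (map bit_sym (g a)) + 1 + (2 * length (g a) + 3)))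
        \<le> t' (total (inp a))"
      using Us(1,4) len_ga t(2)[of "total (inp a)"] by (simp add: t'_def n_def)
    moreover have "(?Ws(out := string_tape (g a))) out = string_tape (g a)" by simp
    moreover have "\<forall>j. j \<noteq> out \<longrightarrow> j \<notin> {b..<b + (m + 2)} \<longrightarrow> False \<or> j \<notin> set ins \<longrightarrow>
        (?Ws(out := string_tape (g a))) j = Ts j"
    proof (intro allI impI)
      fix j
      assume that: "j \<noteq> out" "j \<notin> {b..<b + (m + 2)}" "False \<or> j \<notin> set ins"
      have "j \<notin> set (b # (b + 1) # tps)" "j \<noteq> last tps" "j \<noteq> b + 1"
        using that src by (auto simp: tps_def scr)
      then show "(?Ws(out := string_tape (g a))) j = Ts j" using that(1) Us(5) by simp
    qed
    ultimately show "\<exists>n Us. n \<le> t' (total (inp a)) \<and> exec (P ins out b) Ts n Us \<and>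
        Us out = string_tape (g a) \<and>
        (\<forall>j. j \<noteq> out \<longrightarrow> j \<notin> {b..<b + (m + 2)} \<longrightarrow> False \<or> j \<notin> set ins \<longrightarrow> Us j = Ts j)"
      by (rule exec_resultI)
  qed
  have tb: "poly_bounded t'" unfolding t'_def by (intro poly_bounded_intros t)
  show ?thesis
  proof (rule computableI[OF tb, where s = "m + 2" and K = "num_syms T + num_states T + 4"])
    fix ins :: "nat list" and out b
    assume *: "distinct (out # ins)" "set ins \<subseteq> {..<b}" "out \<notin> {b..<b + (m + 2)}"
    show "\<exists>P. (\<forall>N K'. num_syms T + num_states T + 4 \<le> K' \<and> b + (m + 2) \<le> N \<and> out < N \<longrightarrow>
        valid N K' P) \<and> runs False ins out b (m + 2) t' inp g P"
    proof (cases "length ins < m")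
      case True
      have "valid N K' (P ins out b)"
        if "num_syms T + num_states T + 4 \<le> K'" "b + (m + 2) \<le> N" "out < N" for N K'
      proof -
        let ?tps = "ins @ [b + 2..<b + 2 + (m - length ins)]"
        have "set ?tps \<subseteq> {..<N}" using * that by auto
        moreover from this have "last ?tps < N" using True last_in_set[of ?tps] by fastforce
        moreover have "length ?tps = num_tapes T"
          using True unfolding length_append length_upt m_def by linarith
        ultimately show ?thesis
          unfolding P_def Let_def using that T(1)
          by (simp add: valid_simulate valid_undo_moves valid_copy valid_rewind)
      qed
      then show ?thesis using run[OF *] by blast
    next
      case False
      then have "runs False ins out b (m + 2) t' inp g (Act idle)"
        using T(3) unfolding runs_def m_def by (metis length_map)
      then show ?thesis by (intro exI[of _ "Act idle"]) (simp add: idle_def)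
    qed
  qed
qed

subsection \<open>Closure properties\<close>

lemma computable_binary:
  assumes "computable False two_strings (\<lambda>(u, v). F u v)"
    and "computable True inp g" "computable True inp h"
  shows "computable True inp (\<lambda>a. F (g a) (h a))"
  using computable_comp[OF assms(1), of "[g, h]" inp "\<lambda>a. (g a, h a)"] assms(2,3) by auto

lemmas computable_binary_append = computable_binary[OF computable_append]

text \<open>A transduction of a single string is run on two copies of it.\<close>

lemma computable_map_transduce:
  assumes "computable True inp g"
    and "\<And>q x y. nx q x y < S" "\<And>q x y. length (em q x y) \<le> L" "\<And>q. length (fin q) \<le> L"
  shows "computable True inp (\<lambda>a. transduce nx em fin 0 (g a) (g a))"
  by (rule computable_binary[OF computable_transduce assms(1,1)]) (rule assms)+

lemma list_pair_induct:
  assumes "P [] []" "\<And>a u. P u [] \<Longrightarrow> P (a # u) []" "\<And>b v. P [] v \<Longrightarrow> P [] (b # v)"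
    and "\<And>a u b v. P u v \<Longrightarrow> P (a # u) (b # v)"
  shows "P u v"
proof -
  have Nil: "P [] v" for v by (induction v) (use assms in auto)
  show ?thesis
  proof (induction u arbitrary: v)
    case (Cons a u)
    then show ?case using assms by (cases v) auto
  qed (rule Nil)
qed

lemma transduce_const: "transduce nx (\<lambda>_ _ _. []) (\<lambda>_. w) q u v = w"
  by (induction u v arbitrary: q rule: list_pair_induct) auto

text \<open>The constant is the final output of a transducer that reads some available string and
  writes nothing on the way.\<close>

lemma computable_const:
  assumes "computable True inp g"
  shows "computable True inp (\<lambda>a. w)"
  using computable_map_transduce[OF assms, where nx = "\<lambda>_ _ _. 0" and S = 1
      and em = "\<lambda>_ _ _. []" and fin = "\<lambda>_. w" and L = "length w"]
  by (simp add: transduce_const)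

section \<open>Arithmetic on numbers in unary\<close>

abbreviation unary_computable :: "('a \<Rightarrow> bool list list) \<Rightarrow> ('a \<Rightarrow> nat) \<Rightarrow> bool" where
  "unary_computable inp v \<equiv> computable True inp (\<lambda>a. replicate (v a) True)"

lemma unary_add:
  assumes "unary_computable inp v" "unary_computable inp w"
  shows "unary_computable inp (\<lambda>a. v a + w a)"
  using computable_binary_append[OF assms] by (simp add: replicate_add)

lemma concat_replicate_replicate:
  "concat (replicate m (replicate n x)) = replicate (m * n) x"
  by (induction m) (auto simp: replicate_add)

lemma unary_mult:
  assumes "unary_computable inp v" "unary_computable inp w"
  shows "unary_computable inp (\<lambda>a. v a * w a)"
  using computable_binary[OF computable_repeat assms] by (simp add: concat_replicate_replicate)

lemma unary_diff:
  assumes "unary_computable inp v" "unary_computable inp w"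
  shows "unary_computable inp (\<lambda>a. v a - w a)"
proof -
  define em :: "nat \<Rightarrow> bool option \<Rightarrow> bool option \<Rightarrow> bool list" where
    "em = (\<lambda>q x y. if x \<noteq> None \<and> y = None then [True] else [])"
  have eq: "transduce (\<lambda>_ _ _. 0) em (\<lambda>_. []) q u v = replicate (length u - length v) True" for q u v
    by (induction u v arbitrary: q rule: list_pair_induct) (auto simp: em_def)
  have "computable False two_strings (\<lambda>(u, v). transduce (\<lambda>_ _ _. 0) em (\<lambda>_. []) 0 u v)"
    by (rule computable_transduce[where S = 1 and L = 1]) (auto simp: em_def)
  from computable_binary[OF this assms] show ?thesis by (simp add: eq)
qed

lemma unary_div:
  assumes "unary_computable inp v" "D > 0"
  shows "unary_computable inp (\<lambda>a. v a div D)"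
proof -
  define nx :: "nat \<Rightarrow> bool option \<Rightarrow> bool option \<Rightarrow> nat" where
    "nx = (\<lambda>q x y. if Suc q < D then Suc q else 0)"
  define em :: "nat \<Rightarrow> bool option \<Rightarrow> bool option \<Rightarrow> bool list" where
    "em = (\<lambda>q x y. if Suc q < D then [] else [True])"
  \<comment> \<open>Being in state \<open>q\<close> amounts to having already read \<open>q\<close>
    bits of an unfinished group of \<open>D\<close>.\<close>
  have eq: "transduce nx em (\<lambda>_. []) q u u = replicate ((length u + q) div D) True" if "q < D" for q u
    using that
  proof (induction u arbitrary: q)
    case (Cons b u)
    show ?case
    proof (cases "Suc q < D")
      case True
      with Cons.IH[of "Suc q"] show ?thesis by (simp add: nx_def em_def)
    next
      case False
      then have "length (b # u) + q = length u + D" using Cons.prems by simp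
      then have "(length (b # u) + q) div D = Suc (length u div D)"
        using assms(2) by (simp only: div_add_self2)
      with False Cons.IH[of 0] assms(2) show ?thesis by (simp add: nx_def em_def)
    qed
  qed simp
  have "computable True inp (\<lambda>a. transduce nx em (\<lambda>_. []) 0 (replicate (v a) True) (replicate (v a) True))"
    by (rule computable_map_transduce[OF assms(1), where S = D and L = 1])
      (use assms(2) in \<open>auto simp: nx_def em_def\<close>)
  then show ?thesis using assms(2) by (simp add: eq)
qed

lemma unary_length:
  assumes "computable True inp g"
  shows "unary_computable inp (\<lambda>a. length (g a))"
proof -
  have eq: "transduce (\<lambda>_ _ _. 0) (\<lambda>_ _ _. [True]) (\<lambda>_. []) q u u = replicate (length u) True" for q u
    by (induction u arbitrary: q) auto
  show ?thesis
    using computable_map_transduce[OF assms, where nx = "\<lambda>_ _ _. 0" and S = 1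
        and em = "\<lambda>_ _ _. [True]" and fin = "\<lambda>_. []" and L = 1]
    by (simp add: eq)
qed

lemma unary_const: "unary_computable inp v \<Longrightarrow> unary_computable inp (\<lambda>a. c)"
  by (rule computable_const)

lemma unary_power: "unary_computable inp v \<Longrightarrow> unary_computable inp (\<lambda>a. v a ^ d)"
proof (induction d)
  case 0
  then show ?case using unary_const[of inp v 1] by simp
next
  case (Suc d)
  then show ?case using unary_mult[of inp v "\<lambda>a. v a ^ d"] by simp
qed

lemma unary_choose: "unary_computable inp v \<Longrightarrow> unary_computable inp (\<lambda>a. v a choose i)"
proof (induction i)
  case 0
  then show ?case using unary_const[of inp v 1] by simp
next
  case (Suc i)
  \<comment> \<open>The division is exact, and for \<open>n < i\<close> both sides vanish, so
    truncated subtraction does no harm.\<close>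
  have "(n choose Suc i) = (n - i) * (n choose i) div Suc i" for n
    using binomial_absorption[of i n] binomial_absorb_comp[of n i] nonzero_mult_div_cancel_left[of "Suc i"]
    by (metis nat.simps(3))
  moreover have "unary_computable inp (\<lambda>a. (v a - i) * (v a choose i) div Suc i)"
    using Suc by (intro unary_div unary_mult unary_diff unary_const[of inp v]) auto
  ultimately show ?case by simp
qed

lemma unary_sum:
  assumes "unary_computable inp v" "\<And>i. unary_computable inp (w i)"
  shows "unary_computable inp (\<lambda>a. \<Sum>i\<le>(d::nat). w i a)"
proof (induction d)
  case 0
  then show ?case using assms by simp
next
  case (Suc d)
  then show ?case using unary_add[OF Suc assms(2)] by simp
qed

section \<open>Integer-valued polynomials\<close>

lemma degree_shift_diff:
  fixes P :: "real poly"
  assumes "degree P > 0"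
  shows "degree (pcompose P [:1, 1:] - P) < degree P"
proof -
  have "degree (pcompose P [:1, 1:]) = degree P" by (simp add: degree_pcompose)
  moreover have "lead_coeff (pcompose P [:1, 1:]) = lead_coeff P" by (simp add: lead_coeff_comp)
  ultimately have "coeff (pcompose P [:1, 1:] - P) (degree P) = 0" by simp
  moreover have "degree (pcompose P [:1, 1:] - P) \<le> degree P"
    using \<open>degree (pcompose P [:1, 1:]) = degree P\<close> by (simp add: degree_diff_le)
  ultimately show ?thesis
    using assms by (metis degree_0 leading_coeff_0_iff le_neq_implies_less)
qed

text \<open>Newton's forward difference formula. The coefficients of an integer-valued polynomial
  need not be integers, but those in the basis of binomial coefficients are. The difference has
  smaller degree, because the leading terms cancel; summing its expansion raises every lower index
  by one, and \<open>f 0\<close> is the new constant term.\<close>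

lemma integer_polynomial_newton:
  fixes P :: "real poly" and f :: "nat \<Rightarrow> int"
  assumes "\<And>n. real_of_int (f n) = poly P (real n)"
  shows "\<exists>d c. \<forall>n. f n = (\<Sum>i\<le>d. c i * int (n choose i))"
  using assms
proof (induction "degree P" arbitrary: P f rule: less_induct)
  case less
  show ?case
  proof (cases "degree P = 0")
    case True
    then obtain a where "P = [:a:]" by (rule degree_eq_zeroE)
    then have "f n = f 0" for n using less.prems[of n] less.prems[of 0] by simp
    then have "\<forall>n. f n = (\<Sum>i\<le>0. (\<lambda>_. f 0) i * int (n choose i))" by simp
    then show ?thesis by (intro exI)
  next
    case False
    let ?Q = "pcompose P [:1, 1:] - P"
    have "real_of_int (f (Suc n) - f n) = poly ?Q (real n)" for n
      using less.prems[of n] less.prems[of "Suc n"] by (simp add: poly_pcompose)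
    then obtain d c where c: "\<And>n. f (Suc n) - f n = (\<Sum>i\<le>d. c i * int (n choose i))"
      using less.hyps[of ?Q "\<lambda>n. f (Suc n) - f n"] degree_shift_diff[of P] False by auto
    \<comment> \<open>The difference equation is summed; Pascal's rule carries the step.\<close>
    have A: "f n = f 0 + (\<Sum>i\<le>d. c i * int (n choose Suc i))" for n
    proof (induction n)
      case (Suc n)
      have "f (Suc n) = f n + (\<Sum>i\<le>d. c i * int (n choose i))" using c[of n] by simp
      also have "\<dots> = f 0 + (\<Sum>i\<le>d. c i * int (n choose Suc i) + c i * int (n choose i))"
        by (subst Suc) (simp add: sum.distrib)
      finally show ?case by (simp add: algebra_simps)
    qed simp
    have B: "(\<Sum>i\<le>Suc d. (case i of 0 \<Rightarrow> f 0 | Suc j \<Rightarrow> c j) * int (n choose i)) =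
        f 0 + (\<Sum>i\<le>d. c i * int (n choose Suc i))" for n
      by (subst sum.atMost_Suc_shift) simp
    have "\<forall>n. f n = (\<Sum>i\<le>Suc d. (case i of 0 \<Rightarrow> f 0 | Suc j \<Rightarrow> c j) * int (n choose i))"
      unfolding B by (intro allI A)
    then show ?thesis by (intro exI)
  qed
qed

text \<open>Positive and negative Newton coefficients are summed separately. As the value is a
  natural number, the truncated difference of the two sums is the true one.\<close>

lemma unary_polynomial:
  assumes "unary_computable inp v" "polynomial_fun f"
  shows "unary_computable inp (\<lambda>a. f (v a))"
proof -
  obtain P where P: "\<And>n. real (f n) = poly P (real n)"
    using assms(2) unfolding polynomial_fun_def by blast
  have "real_of_int (int (f n)) = poly P (real n)" for n using P by simp
  then obtain d c where c: "\<And>n. int (f n) = (\<Sum>i\<le>d. c i * int (n choose i))"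
    using integer_polynomial_newton[of "\<lambda>n. int (f n)" P] by blast
  have "f n = (\<Sum>i\<le>d. nat (c i) * (n choose i)) - (\<Sum>i\<le>d. nat (- c i) * (n choose i))" for n
  proof -
    have "int (f n) = (\<Sum>i\<le>d. int (nat (c i)) * int (n choose i) - int (nat (- c i)) * int (n choose i))"
      unfolding c by (intro sum.cong refl) (auto simp: left_diff_distrib[symmetric])
    then have "int (f n) = int (\<Sum>i\<le>d. nat (c i) * (n choose i)) - int (\<Sum>i\<le>d. nat (- c i) * (n choose i))"
      by (simp add: sum_subtractf)
    then show ?thesis by linarith
  qed
  moreover have "unary_computable inp
      (\<lambda>a. (\<Sum>i\<le>d. nat (c i) * (v a choose i)) - (\<Sum>i\<le>d. nat (- c i) * (v a choose i)))"
    by (intro unary_diff unary_sum[OF assms(1)] unary_mult unary_choose unary_const[OF assms(1)] assms(1))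
  ultimately show ?thesis by simp
qed

subsection \<open>Padding\<close>

text \<open>A block of ones closed by a zero can be recognised without knowing its length, and even
  by two states.\<close>

definition unpad :: "bool list \<Rightarrow> bool list" where
  "unpad x = tl (dropWhile id x)"

lemma unpad_pad [simp]: "unpad (replicate m True @ False # z) = z"
  by (induction m) (auto simp: unpad_def)

lemma computable_unpad:
  assumes "computable True inp g"
  shows "computable True inp (\<lambda>a. unpad (g a))"
proof -
  define nx :: "nat \<Rightarrow> bool option \<Rightarrow> bool option \<Rightarrow> nat" where
    "nx = (\<lambda>q x y. if q = 0 \<and> x = Some True then 0 else 1)"
  define em :: "nat \<Rightarrow> bool option \<Rightarrow> bool option \<Rightarrow> bool list" where
    "em = (\<lambda>q x y. if q = 0 then [] else [x = Some True])"
  have 1: "transduce nx em (\<lambda>_. []) (Suc 0) u u = u" for u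
    by (induction u) (auto simp: nx_def em_def)
  have 0: "transduce nx em (\<lambda>_. []) 0 u u = unpad u" for u
    by (induction u) (auto simp: nx_def em_def unpad_def 1[unfolded nx_def em_def])
  show ?thesis
    using computable_map_transduce[OF assms, where nx = nx and S = 2 and em = em
        and fin = "\<lambda>_. []" and L = 1]
    by (simp add: 0) (simp add: nx_def em_def)
qed

text \<open>Filling up matters as well as cutting: on an input that is not a padded string, a
  candidate may be shorter than the witness length.\<close>

definition fit :: "nat \<Rightarrow> bool list \<Rightarrow> bool list" where
  "fit k y = take k y @ replicate (k - length y) False"

lemma length_fit [simp]: "length (fit k y) = k"
  by (simp add: fit_def)

lemma fit_append: "length y = k \<Longrightarrow> fit k (y @ z) = y"
  by (simp add: fit_def)

lemma computable_fit:
  assumes "unary_computable inp v" "computable True inp g"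
  shows "computable True inp (\<lambda>a. fit (v a) (g a))"
proof -
  define em :: "nat \<Rightarrow> bool option \<Rightarrow> bool option \<Rightarrow> bool list" where
    "em = (\<lambda>q x y. if x = None then [] else [y = Some True])"
  have "transduce (\<lambda>_ _ _. 0) em (\<lambda>_. []) q u v = fit (length u) v" for q u v
    by (induction u v arbitrary: q rule: list_pair_induct) (auto simp: em_def fit_def)
  moreover have "computable False two_strings (\<lambda>(u, v). transduce (\<lambda>_ _ _. 0) em (\<lambda>_. []) 0 u v)"
    by (rule computable_transduce[where S = 1 and L = 1]) (auto simp: em_def)
  from computable_binary[OF this assms] have
    "computable True inp (\<lambda>a. transduce (\<lambda>_ _ _. 0) em (\<lambda>_. []) 0 (replicate (v a) True) (g a))" .
  ultimately show ?thesis by simp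
qed

subsection \<open>Acceptance probabilities\<close>

definition accept_prob :: "qcircuit \<Rightarrow> real" where
  "accept_prob C = qprob C (\<lambda>w. decode_output w \<noteq> None)"

definition gate_ok :: "nat \<Rightarrow> gate \<Rightarrow> bool" where
  "gate_ok n g \<longleftrightarrow> distinct (gate_qubits g) \<and> set (gate_qubits g) \<subseteq> {..<n}"

lemma finite_bool_lists: "finite {z :: bool list. length z = n}"
  using finite_lists_length_eq[of "UNIV :: bool set" n] by simp

lemma cmod_hadamard:
  "(cmod ((a + b) / complex_of_real (sqrt 2)))\<^sup>2 + (cmod ((a - b) / complex_of_real (sqrt 2)))\<^sup>2 =
    (cmod a)\<^sup>2 + (cmod b)\<^sup>2"
  unfolding norm_divide power_divide cmod_power2
  by (simp add: field_simps power2_eq_square)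

lemma sum_involution:
  fixes n :: nat and F :: "bool list \<Rightarrow> real"
  assumes "\<And>z. length z = n \<Longrightarrow> length (\<pi> z) = n \<and> \<pi> (\<pi> z) = z"
  shows "(\<Sum>z | length z = n. F (\<pi> z)) = (\<Sum>z | length z = n. F z)"
  by (rule sum.reindex_bij_witness[where i = \<pi> and j = \<pi>]) (use assms in auto)

lemma apply_gate_norm:
  assumes "gate_ok n g"
  shows "(\<Sum>z | length z = n. (cmod (apply_gate g \<psi> z))\<^sup>2) = (\<Sum>z | length z = n. (cmod (\<psi> z))\<^sup>2)"
proof (cases g)
  case (Had i)
  let ?f = "\<lambda>z :: bool list. z[i := \<not> z ! i]"
  have i: "i < n" using assms Had by (simp add: gate_ok_def)
  have inv: "length z = n \<Longrightarrow> length (?f z) = n \<and> ?f (?f z) = z" for z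
    using i by simp
  have pair: "(cmod (apply_gate g \<psi> z))\<^sup>2 + (cmod (apply_gate g \<psi> (?f z)))\<^sup>2 =
      (cmod (\<psi> z))\<^sup>2 + (cmod (\<psi> (?f z)))\<^sup>2" if "length z = n" for z
  proof (cases "z ! i")
    case True
    then have "z[i := True] = z" by (metis list_update_id)
    with True i that show ?thesis
      using cmod_hadamard[of "\<psi> (z[i := False])" "\<psi> z"] by (simp add: Had)
  next
    case False
    then have "z[i := False] = z" by (metis list_update_id)
    with False i that show ?thesis
      using cmod_hadamard[of "\<psi> z" "\<psi> (z[i := True])"] by (simp add: Had)
  qed
  \<comment> \<open>Adding to each basis state its partner with bit \<open>i\<close> flipped counts
    everything twice, so it is enough to compare the two amplitudes of one pair.\<close>
  have double: "2 * (\<Sum>z | length z = n. F z) = (\<Sum>z | length z = n. F z + F (?f z))"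
    for F :: "bool list \<Rightarrow> real"
    using sum_involution[OF inv, of F] by (simp add: sum.distrib)
  have "2 * (\<Sum>z | length z = n. (cmod (apply_gate g \<psi> z))\<^sup>2) = 2 * (\<Sum>z | length z = n. (cmod (\<psi> z))\<^sup>2)"
    unfolding double using pair by (intro sum.cong) auto
  then show ?thesis by simp
next
  case (Phase i)
  then show ?thesis by (auto simp: norm_mult intro!: sum.cong)
next
  case (PhaseInv i)
  then show ?thesis by (auto simp: norm_mult intro!: sum.cong)
next
  case (CNot i j)
  let ?f = "\<lambda>z :: bool list. z[j := (z ! j \<noteq> z ! i)]"
  have "length z = n \<Longrightarrow> length (?f z) = n \<and> ?f (?f z) = z" for z
    using assms CNot by (cases "z ! i") (auto simp: gate_ok_def)
  from sum_involution[OF this, of "\<lambda>z. (cmod (\<psi> z))\<^sup>2"] show ?thesis by (simp add: CNot)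
next
  case (Toffoli i j k)
  let ?f = "\<lambda>z :: bool list. z[k := (z ! k \<noteq> (z ! i \<and> z ! j))]"
  have "length z = n \<Longrightarrow> length (?f z) = n \<and> ?f (?f z) = z" for z
    using assms Toffoli by (cases "z ! i \<and> z ! j") (auto simp: gate_ok_def)
  from sum_involution[OF this, of "\<lambda>z. (cmod (\<psi> z))\<^sup>2"] show ?thesis by (simp add: Toffoli)
qed

lemma apply_gates_norm:
  assumes "\<forall>g \<in> set gs. gate_ok n g"
  shows "(\<Sum>z | length z = n. (cmod (fold apply_gate gs \<psi> z))\<^sup>2) = (\<Sum>z | length z = n. (cmod (\<psi> z))\<^sup>2)"
  using assms by (induction gs arbitrary: \<psi>) (auto simp: apply_gate_norm)

lemma final_state_norm:
  assumes "wf_circuit C"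
  shows "(\<Sum>z | length z = width C. (cmod (final_state C z))\<^sup>2) = 1"
proof -
  have "(\<Sum>z | length z = width C. (cmod (final_state C z))\<^sup>2) =
      (\<Sum>z | length z = width C. (cmod (zero_state (width C) z))\<^sup>2)"
    unfolding final_state_def using assms by (intro apply_gates_norm) (auto simp: wf_circuit_def gate_ok_def)
  also have "\<dots> = (\<Sum>z | length z = width C. if z = replicate (width C) False then 1 else 0)"
    by (intro sum.cong) (auto simp: zero_state_def)
  also have "\<dots> = 1" by (simp add: finite_bool_lists)
  finally show ?thesis .
qed

lemma qprob_not:
  assumes "wf_circuit C"
  shows "qprob C (\<lambda>w. \<not> E w) = 1 - qprob C E"
proof -
  let ?A = "{z. length z = width C \<and> E (take (out_len C) z)}"
  let ?B = "{z. length z = width C \<and> \<not> E (take (out_len C) z)}"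
  have fin: "finite ?A" "finite ?B"
    using finite_bool_lists[of "width C"] by (auto intro: finite_subset[rotated])
  have "?A \<union> ?B = {z. length z = width C}" "?A \<inter> ?B = {}" by auto
  then have "qprob C E + qprob C (\<lambda>w. \<not> E w) = (\<Sum>z | length z = width C. (cmod (final_state C z))\<^sup>2)"
    using sum.union_disjoint[OF fin, of "\<lambda>z. (cmod (final_state C z))\<^sup>2"] by (simp add: qprob_def)
  then show ?thesis using final_state_norm[OF assms] by simp
qed

lemma qprob_mono:
  assumes "\<And>w. E w \<Longrightarrow> F w"
  shows "qprob C E \<le> qprob C F"
  unfolding qprob_def
proof (rule sum_mono2)
  show "finite {z. length z = width C \<and> F (take (out_len C) z)}"
    using finite_bool_lists[of "width C"] by (auto intro: finite_subset[rotated])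
qed (use assms in auto)

lemma qprob_nonneg: "0 \<le> qprob C E"
  unfolding qprob_def by (intro sum_nonneg) simp

lemma accept_prob_bounds:
  assumes "wf_circuit C"
  shows "0 \<le> accept_prob C" "accept_prob C \<le> 1"
  using qprob_nonneg[of C "\<lambda>w. decode_output w \<noteq> None"]
    qprob_nonneg[of C "\<lambda>w. \<not> decode_output w \<noteq> None"] qprob_not[OF assms, of "\<lambda>w. decode_output w \<noteq> None"]
  by (simp_all add: accept_prob_def)

text \<open>Whether the output is \<open>\<bottom>\<close> depends on qubit \<open>0\<close> alone
  once there is any output bit; hence a single gate can process acceptance, however long the output
  register is.\<close>

lemma decode_output_take:
  "decode_output (take k z) \<noteq> None \<longleftrightarrow> 0 < k \<and> z \<noteq> [] \<and> z ! 0"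
proof (cases z)
  case (Cons b z')
  then show ?thesis by (cases k; cases b) auto
qed simp

lemma accept_prob_eq:
  assumes "wf_circuit C" "0 < out_len C"
  shows "accept_prob C = (\<Sum>z | length z = width C \<and> z ! 0. (cmod (final_state C z))\<^sup>2)"
proof -
  have "width C > 0" using assms by (simp add: wf_circuit_def)
  then have "{z. length z = width C \<and> decode_output (take (out_len C) z) \<noteq> None} =
      {z. length z = width C \<and> z ! 0}"
    using assms(2) unfolding decode_output_take by auto
  then show ?thesis unfolding accept_prob_def qprob_def by (rule arg_cong)
qed

lemma accept_prob_no_output: "out_len C = 0 \<Longrightarrow> accept_prob C = 0"
  unfolding accept_prob_def qprob_def decode_output_take by simp

subsection \<open>Running two copies of a circuit\<close>

text \<open>Qubit \<open>i\<close> of copy \<open>j \<in> {0, 1}\<close> becomes qubit \<open>2 i + 1 + j\<close>.  This interleaving makes the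
  translation of circuit descriptions, with their numbers in unary, a finite-state transduction.\<close>

fun copy_gate :: "nat \<Rightarrow> gate \<Rightarrow> gate" where
  "copy_gate c (Had i) = Had (2 * i + 1 + c)"
| "copy_gate c (Phase i) = Phase (2 * i + 1 + c)"
| "copy_gate c (PhaseInv i) = PhaseInv (2 * i + 1 + c)"
| "copy_gate c (CNot i j) = CNot (2 * i + 1 + c) (2 * j + 1 + c)"
| "copy_gate c (Toffoli i j k) = Toffoli (2 * i + 1 + c) (2 * j + 1 + c) (2 * k + 1 + c)"

text \<open>The first four gates flip qubit \<open>0\<close>, since no single basis gate does.\<close>

definition nand :: "qcircuit \<Rightarrow> qcircuit" where
  "nand C = QCircuit (2 * width C + 1) 1
     ([Had 0, Phase 0, Phase 0, Had 0] @ map (copy_gate 0) (gates C) @ map (copy_gate 1) (gates C) @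
      (if out_len C = 0 then [] else [Toffoli 1 2 0]))"

lemma wf_nand:
  assumes "wf_circuit C"
  shows "wf_circuit (nand C)"
proof -
  have "gate_ok (2 * width C + 1) (copy_gate c g)" if "g \<in> set (gates C)" "c \<le> 1" for g c
  proof -
    have "gate_ok (width C) g" using assms that by (auto simp: wf_circuit_def gate_ok_def)
    then show ?thesis using that(2) by (cases g) (auto simp: gate_ok_def)
  qed
  then have "\<forall>g \<in> set (gates (nand C)). gate_ok (2 * width C + 1) g"
    using assms by (auto simp: nand_def wf_circuit_def) (auto simp: gate_ok_def)
  then show ?thesis by (auto simp: nand_def wf_circuit_def gate_ok_def)
qed

section \<open>Product states of one qubit and two interleaved registers\<close>

definition part :: "nat \<Rightarrow> nat \<Rightarrow> bool list \<Rightarrow> bool list" where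
  "part n c z = map (\<lambda>i. z ! (2 * i + 1 + c)) [0..<n]"

definition merge :: "nat \<Rightarrow> bool \<Rightarrow> bool list \<Rightarrow> bool list \<Rightarrow> bool list" where
  "merge n b u v = map (\<lambda>k. if k = 0 then b else if odd k then u ! (k div 2) else v ! (k div 2 - 1))
     [0..<2 * n + 1]"

lemma length_part [simp]: "length (part n c z) = n"
  by (simp add: part_def)

lemma length_merge [simp]: "length (merge n b u v) = 2 * n + 1"
  by (simp add: merge_def)

lemma part_merge:
  assumes "length u = n" "length v = n"
  shows "merge n b u v ! 0 = b" "part n 0 (merge n b u v) = u" "part n 1 (merge n b u v) = v"
proof -
  show "merge n b u v ! 0 = b" by (simp add: merge_def del: upt_Suc)
  show "part n 0 (merge n b u v) = u"
    using assms by (intro nth_equalityI) (auto simp: part_def merge_def simp del: upt_Suc)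
  show "part n 1 (merge n b u v) = v"
    using assms by (intro nth_equalityI) (auto simp: part_def merge_def simp del: upt_Suc)
qed

lemma merge_part:
  assumes "length z = 2 * n + 1"
  shows "merge n (z ! 0) (part n 0 z) (part n 1 z) = z"
proof (rule nth_equalityI)
  fix k assume "k < length (merge n (z ! 0) (part n 0 z) (part n 1 z))"
  then have k: "k < 2 * n + 1" by simp
  consider "k = 0" | j where "k = 2 * j + 1" | j where "k = 2 * j + 2"
    by (metis Suc_eq_plus1 add_2_eq_Suc' evenE mult_Suc_right not0_implies_Suc oddE add.commute)
  then show "merge n (z ! 0) (part n 0 z) (part n 1 z) ! k = z ! k"
    using k by cases (auto simp: merge_def part_def simp del: upt_Suc)
qed (use assms in simp)

lemma sum_merge:
  fixes F :: "bool list \<Rightarrow> real"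
  shows "(\<Sum>z | length z = 2 * n + 1 \<and> z ! 0. F z) =
    (\<Sum>u | length u = n. \<Sum>v | length v = n. F (merge n True u v))"
proof -
  have "(\<Sum>z | length z = 2 * n + 1 \<and> z ! 0. F z) =
      (\<Sum>(u, v) \<in> {u. length u = n} \<times> {v. length v = n}. F (merge n True u v))"
    by (rule sum.reindex_bij_witness[where i = "\<lambda>(u, v). merge n True u v" and
          j = "\<lambda>z. (part n 0 z, part n 1 z)"])
      (use merge_part in \<open>fastforce simp: part_merge[simplified]\<close>)+
  then show ?thesis by (simp add: sum.cartesian_product)
qed

lemma part_update_0: "part n c (z[0 := b]) = part n c z"
  by (simp add: part_def)

lemma part_update_same:
  "length z = 2 * n + 1 \<Longrightarrow> c \<le> 1 \<Longrightarrow> i < n \<Longrightarrow> part n c (z[2 * i + 1 + c := b]) = (part n c z)[i := b]"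
  by (intro nth_equalityI) (auto simp: part_def nth_list_update)

lemma part_update_other:
  "c \<le> 1 \<Longrightarrow> c' \<le> 1 \<Longrightarrow> c \<noteq> c' \<Longrightarrow> part n c (z[2 * i + 1 + c' := b]) = part n c z"
proof -
  assume c: "c \<le> 1" "c' \<le> 1" "c \<noteq> c'"
  have "z[2 * i + 1 + c' := b] ! (2 * j + 1 + c) = z ! (2 * j + 1 + c)" for j
    by (rule nth_list_update_neq) (use c in presburger)
  then show ?thesis by (simp only: part_def)
qed

lemma nth_part: "i < n \<Longrightarrow> part n c z ! i = z ! (2 * i + 1 + c)"
  by (simp add: part_def)

text \<open>The tensor product of a state \<open>h\<close> of qubit \<open>0\<close> with states
  \<open>\<phi>\<close> and \<open>\<chi>\<close> of the two copies, in the interleaved numbering.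
  Only strings of length \<open>2 * n + 1\<close> are basis states.\<close>

definition factors :: "nat \<Rightarrow> (bool \<Rightarrow> complex) \<Rightarrow> qstate \<Rightarrow> qstate \<Rightarrow> qstate \<Rightarrow> bool" where
  "factors n h \<phi> \<chi> \<psi> \<longleftrightarrow>
     (\<forall>z. length z = 2 * n + 1 \<longrightarrow> \<psi> z = h (z ! 0) * \<phi> (part n 0 z) * \<chi> (part n 1 z))"

lemma odd_less_div: "odd i \<Longrightarrow> i < Suc (2 * n) \<Longrightarrow> i div 2 < (n :: nat)"
  by presburger

lemma factors_zero_state:
  "factors n (\<lambda>b. if b then 0 else 1) (zero_state n) (zero_state n) (zero_state (2 * n + 1))"
  unfolding factors_def
proof (intro allI impI)
  fix z :: "bool list" assume z: "length z = 2 * n + 1"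
  have m: "merge n False (replicate n False) (replicate n False) = replicate (2 * n + 1) False"
    by (intro nth_equalityI) (auto simp: merge_def odd_less_div simp del: upt_Suc)
  have "z = replicate (2 * n + 1) False \<longleftrightarrow>
      \<not> z ! 0 \<and> part n 0 z = replicate n False \<and> part n 1 z = replicate n False"
  proof
    assume *: "\<not> z ! 0 \<and> part n 0 z = replicate n False \<and> part n 1 z = replicate n False"
    then show "z = replicate (2 * n + 1) False" using merge_part[OF z] m by simp
  qed (auto simp: part_def map_replicate_const nth_append simp del: replicate_Suc intro!: nth_equalityI)
  then show "zero_state (2 * n + 1) z =
      (if z ! 0 then 0 else 1) * zero_state n (part n 0 z) * zero_state n (part n 1 z)"
    unfolding zero_state_def by auto
qed

lemma factors_Had_0:
  "factors n h \<phi> \<chi> \<psi> \<Longrightarrow>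
    factors n (\<lambda>b. (h False + (if b then - 1 else 1) * h True) / complex_of_real (sqrt 2)) \<phi> \<chi>
      (apply_gate (Had 0) \<psi>)"
  by (simp add: factors_def part_update_0 field_simps)

lemma factors_Phase_0:
  "factors n h \<phi> \<chi> \<psi> \<Longrightarrow> factors n (\<lambda>b. (if b then \<i> else 1) * h b) \<phi> \<chi> (apply_gate (Phase 0) \<psi>)"
  by (simp add: factors_def)

text \<open>Two phase gates make a Pauli Z, and conjugating Z with the Hadamard gate gives the bit
  flip X.\<close>

lemma factors_flip:
  assumes "factors n (\<lambda>b. if b then 0 else 1) \<phi> \<chi> \<psi>"
  shows "factors n (\<lambda>b. if b then 1 else 0) \<phi> \<chi>
    (fold apply_gate [Had 0, Phase 0, Phase 0, Had 0] \<psi>)"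
proof -
  \<comment> \<open>The right-hand side has exactly the shape that the lemmas for the four gates
    produce.\<close>
  have eq: "(\<lambda>b. if b then 1 else 0) =
    (\<lambda>b. ((if False then \<i> else 1) * ((if False then \<i> else 1) *
         (((if False then 0 else 1) + (if False then - 1 else 1) * (if True then 0 else 1)) / complex_of_real (sqrt 2))) +
        (if b then - 1 else 1) * ((if True then \<i> else 1) * ((if True then \<i> else 1) *
         (((if False then 0 else 1) + (if True then - 1 else 1) * (if True then 0 else 1)) / complex_of_real (sqrt 2)))))
       / complex_of_real (sqrt 2))"
    by (auto simp: fun_eq_iff field_simps simp flip: of_real_mult)
  show ?thesis
    unfolding eq
    using factors_Had_0[OF factors_Phase_0[OF factors_Phase_0[OF factors_Had_0[OF assms]]]]
    by (simp del: apply_gate.simps)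
qed

lemma factors_copy_gate_0:
  assumes "factors n h \<phi> \<chi> \<psi>" "gate_ok n g"
  shows "factors n h (apply_gate g \<phi>) \<chi> (apply_gate (copy_gate 0 g) \<psi>)"
  using assms part_update_same[where c = 0] part_update_other[where c = 1 and c' = 0]
  by (cases g) (auto simp: factors_def gate_ok_def nth_part field_simps)

lemma factors_copy_gate_1:
  assumes "factors n h \<phi> \<chi> \<psi>" "gate_ok n g"
  shows "factors n h \<phi> (apply_gate g \<chi>) (apply_gate (copy_gate 1 g) \<psi>)"
  using assms part_update_same[where c = 1] part_update_other[where c = 0 and c' = 1]
  by (cases g) (auto simp: factors_def gate_ok_def nth_part field_simps)

lemma factors_copy_gates_0:
  "factors n h \<phi> \<chi> \<psi> \<Longrightarrow> \<forall>g \<in> set gs. gate_ok n g \<Longrightarrow>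
    factors n h (fold apply_gate gs \<phi>) \<chi> (fold apply_gate (map (copy_gate 0) gs) \<psi>)"
  by (induction gs arbitrary: \<phi> \<psi>) (auto simp: factors_copy_gate_0 simp del: copy_gate.simps)

lemma factors_copy_gates_1:
  "factors n h \<phi> \<chi> \<psi> \<Longrightarrow> \<forall>g \<in> set gs. gate_ok n g \<Longrightarrow>
    factors n h \<phi> (fold apply_gate gs \<chi>) (fold apply_gate (map (copy_gate 1) gs) \<psi>)"
  by (induction gs arbitrary: \<chi> \<psi>) (auto simp: factors_copy_gate_1 simp del: copy_gate.simps One_nat_def)

text \<open>Before the last gate the state is a product in which qubit \<open>0\<close> is set. The
  Toffoli gate, controlled by the first qubits \<open>1\<close> and \<open>2\<close> of the copies,
  clears it exactly where both accept; as the weights multiply, this part has weight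
  \<open>(accept_prob C)\<^sup>2\<close>.\<close>

lemma accept_prob_nand:
  assumes wf: "wf_circuit C"
  shows "accept_prob (nand C) = 1 - (accept_prob C)\<^sup>2"
proof -
  let ?n = "width C"
  let ?\<phi> = "final_state C"
  let ?h = "\<lambda>b. if b then 1 else 0 :: complex"
  let ?p = "\<lambda>u. (cmod (?\<phi> u))\<^sup>2"
  define \<psi> where "\<psi> = fold apply_gate ([Had 0, Phase 0, Phase 0, Had 0] @
      map (copy_gate 0) (gates C) @ map (copy_gate 1) (gates C)) (zero_state (2 * ?n + 1))"
  have ok: "\<forall>g \<in> set (gates C). gate_ok ?n g"
    using wf by (auto simp: wf_circuit_def gate_ok_def)
  have "factors ?n ?h ?\<phi> ?\<phi> \<psi>"
    unfolding \<psi>_def final_state_def fold_append o_apply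
    by (intro factors_copy_gates_1 factors_copy_gates_0 factors_flip factors_zero_state ok)
  then have \<psi>: "\<psi> (merge ?n b u v) = ?h b * ?\<phi> u * ?\<phi> v" if "length u = ?n" "length v = ?n" for b u v
    using that part_merge[OF that] by (simp add: factors_def)
  have final: "final_state (nand C) =
      fold apply_gate (if out_len C = 0 then [] else [Toffoli 1 2 0]) \<psi>"
    by (simp add: final_state_def nand_def \<psi>_def)
  have sums: "accept_prob (nand C) = (\<Sum>u | length u = ?n. \<Sum>v | length v = ?n.
      (cmod (final_state (nand C) (merge ?n True u v)))\<^sup>2)"
    using accept_prob_eq[OF wf_nand[OF wf]] sum_merge[where n = ?n and F = "\<lambda>z. (cmod (final_state (nand C) z))\<^sup>2"]
    by (simp add: nand_def)
  have total: "(\<Sum>u | length u = ?n. \<Sum>v | length v = ?n. ?p u * ?p v) = 1"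
    using final_state_norm[OF wf] by (simp add: sum_product[symmetric])
  show ?thesis
  proof (cases "out_len C = 0")
    case True
    \<comment> \<open>Without output bits \<open>C\<close> never accepts; the Toffoli gate is then
      absent, qubit \<open>0\<close> stays set and \<open>nand C\<close> accepts with
      certainty.\<close>
    have "accept_prob (nand C) = (\<Sum>u | length u = ?n. \<Sum>v | length v = ?n. ?p u * ?p v)"
      unfolding sums final using True
      by (intro sum.cong refl) (simp add: \<psi> norm_mult power_mult_distrib)
    then show ?thesis using total True by (simp add: accept_prob_no_output)
  next
    case False
    then have n: "?n > 0" using wf by (simp add: wf_circuit_def)
    have upd: "(merge ?n True u v)[0 := (True \<noteq> (merge ?n True u v ! 1 \<and> merge ?n True u v ! 2))] =
        merge ?n (\<not> (u ! 0 \<and> v ! 0)) u v" if "length u = ?n" "length v = ?n" for u v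
      using n by (intro nth_equalityI) (auto simp: merge_def nth_list_update simp del: upt_Suc)
    \<comment> \<open>The subtracted product can be nonzero only if both copies accept. In that case
      the amplitude comes from a string with qubit \<open>0\<close> cleared, where
      \<open>\<psi>\<close> vanishes.\<close>
    have "(cmod (final_state (nand C) (merge ?n True u v)))\<^sup>2 =
        ?p u * ?p v - (if u ! 0 then ?p u else 0) * (if v ! 0 then ?p v else 0)"
      if "length u = ?n" "length v = ?n" for u v
      unfolding final using False upd[OF that] part_merge(1)[OF that, of True]
      by (simp add: \<psi>[OF that] norm_mult power_mult_distrib)
    then have "accept_prob (nand C) = (\<Sum>u | length u = ?n. \<Sum>v | length v = ?n.
        ?p u * ?p v - (if u ! 0 then ?p u else 0) * (if v ! 0 then ?p v else 0))"
      unfolding sums by (intro sum.cong refl) auto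
    also have "\<dots> = 1 - (\<Sum>u | length u = ?n. if u ! 0 then ?p u else 0)\<^sup>2"
      using total by (simp add: sum_subtractf sum_product power2_eq_square)
    also have "(\<Sum>u | length u = ?n. if u ! 0 then ?p u else 0) = accept_prob C"
      using accept_prob_eq[OF wf] False finite_bool_lists[of ?n]
      by (simp add: sum.If_cases Collect_conj_eq)
    finally show ?thesis .
  qed
qed

subsection \<open>Translating circuit descriptions\<close>

definition run_transducer where
  "run_transducer nx em fin q w =
     transduce (\<lambda>q x y. nx q (x = Some True)) (\<lambda>q x y. em q (x = Some True)) fin q w w"

lemma run_transducer_simps [simp]:
  "run_transducer nx em fin q [] = fin q"
  "run_transducer nx em fin q (b # w) = em q b @ run_transducer nx em fin (nx q b) w"
  by (simp_all add: run_transducer_def)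

lemma computable_run_transducer:
  assumes "computable True inp g"
    and "\<And>q x. nx q x < S" "\<And>q x. length (em q x) \<le> L" "\<And>q. length (fin q) \<le> L"
  shows "computable True inp (\<lambda>a. run_transducer nx em fin 0 (g a))"
  unfolding run_transducer_def by (rule computable_map_transduce[OF assms(1)]) (rule assms)+

lemma run_transducer_done:
  assumes "\<And>x. nx q x = q" "\<And>x. em q x = []"
  shows "run_transducer nx em fin q w = fin q"
  by (induction w) (simp_all add: assms)

text \<open>A unary number is translated on the fly: \<open>em q True\<close> is what each further
  unit puts in front, and the closing zero produces the code of \<open>f 0\<close>. The maps from
  old to new qubit numbers are of this kind.\<close>

lemma run_transducer_nat:
  assumes "nx q True = q" "\<And>i. em q True @ enc_nat (f i) = enc_nat (f (Suc i))" "em q False = enc_nat (f 0)"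
  shows "run_transducer nx em fin q (enc_nat i @ w) = enc_nat (f i) @ run_transducer nx em fin (nx q False) w"
proof (induction i)
  case (Suc i)
  then show ?case using assms(1) assms(2)[of i] by (simp flip: append_assoc)
qed (simp add: assms(3))

lemma run_transducer_skip_nat:
  assumes "nx q True = q" "\<And>x. em q x = []"
  shows "run_transducer nx em fin q (enc_nat i @ w) = run_transducer nx em fin (nx q False) w"
  by (induction i) (simp_all add: assms)

text \<open>A one becomes two ones, and the zero that closes the width becomes a one and a zero:
  this turns \<open>m\<close> into \<open>2 * m + 1\<close>. Everything after the width is
  dropped.\<close>

definition nand_header :: "bool list \<Rightarrow> bool list" where
  "nand_header = run_transducer (\<lambda>q x. if q = 0 \<and> x then 0 else 1)
     (\<lambda>q x. if q = 0 then [True, x] else []) (\<lambda>_. []) 0"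

text \<open>States \<open>0\<close> and \<open>1\<close> skip the header, state \<open>2 + k\<close> has read \<open>k\<close> ones of a gate type, and state
  \<open>6 + k\<close> expects \<open>k\<close> further qubit numbers of the current gate.\<close>

definition copy_nx :: "nat \<Rightarrow> bool \<Rightarrow> nat" where
  "copy_nx q x =
     (if q \<le> 1 then (if x then q else q + 1)
      else if q \<le> 6 then (if x then min 6 (q + 1) else if q \<le> 4 then 7 else q + 3)
      else if x then min 9 q else if q = 7 then 2 else min 9 (q - 1))"

definition copy_em :: "nat \<Rightarrow> nat \<Rightarrow> bool \<Rightarrow> bool list" where
  "copy_em c q x =
     (if q \<le> 1 then [] else if q \<le> 6 then [x]
      else if x then [True, True] else replicate (1 + c) True @ [False])"

definition copy_gates :: "nat \<Rightarrow> bool list \<Rightarrow> bool list" where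
  "copy_gates c = run_transducer copy_nx (copy_em c) (\<lambda>_. []) 0"

text \<open>After the width has been skipped, the first bit of the next unary number tells whether
  the circuit has output bits.\<close>

definition nand_tail :: "bool list \<Rightarrow> bool list" where
  "nand_tail = run_transducer
     (\<lambda>q x. if q = 0 then (if x then 0 else 1) else if q = 1 then (if x then 2 else 3) else min 3 q)
     (\<lambda>_ _. []) (\<lambda>q. if q = 2 then enc_gate (Toffoli 1 2 0) else []) 0"

lemma enc_circuit_append:
  "enc_circuit C = enc_nat (width C) @ enc_nat (out_len C) @ concat (map enc_gate (gates C))"
  by (simp add: enc_circuit_def enc_nats_def del: enc_nat.simps)

lemma nand_header_enc: "nand_header (enc_nat m @ w) = enc_nat (2 * m + 1)"
proof -
  have "run_transducer (\<lambda>q x. if q = 0 \<and> x then 0 else 1) (\<lambda>q x. if q = 0 then [True, x] else [])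
      (\<lambda>_. []) (Suc 0) w = []" for w
    by (induction w) auto
  then show ?thesis
    unfolding nand_header_def
    by (subst run_transducer_nat[where f = "\<lambda>m. 2 * m + 1"]) simp_all
qed

lemma nand_tail_enc:
  "nand_tail (enc_nat m @ enc_nat k @ w) = (if k = 0 then [] else enc_gate (Toffoli 1 2 0))"
  unfolding nand_tail_def
  by (subst run_transducer_skip_nat, simp, simp, cases k)
    (simp_all add: run_transducer_done del: enc_gate.simps)

lemma copy_nat:
  assumes "q \<in> {7, 8, 9}"
  shows "run_transducer copy_nx (copy_em c) fin q (enc_nat i @ w) =
    enc_nat (2 * i + 1 + c) @ run_transducer copy_nx (copy_em c) fin (copy_nx q False) w"
  by (rule run_transducer_nat) (use assms in \<open>auto simp: copy_nx_def copy_em_def\<close>)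

lemma copy_gate_enc:
  "run_transducer copy_nx (copy_em c) fin 2 (enc_gate g @ w) =
    enc_gate (copy_gate c g) @ run_transducer copy_nx (copy_em c) fin 2 w"
proof -
  \<comment> \<open>The gate type is copied unchanged. The state reached fixes how many qubit
    numbers follow: one for types up to \<open>2\<close>, two for type \<open>3\<close>, three for
    type \<open>4\<close>.\<close>
  have op: "run_transducer copy_nx (copy_em c) fin 2 (enc_nat k @ v) =
      enc_nat k @ run_transducer copy_nx (copy_em c) fin (if k \<le> 2 then 7 else k + 5) v"
    if "k \<le> 4" for k v
  proof -
    have "k \<in> {0, 1, 2, 3, 4}" using that by auto
    then show ?thesis by (auto simp: copy_nx_def copy_em_def eval_nat_numeral)
  qed
  have nx: "copy_nx 7 False = 2" "copy_nx 8 False = 7" "copy_nx 9 False = 8"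
    by (simp_all add: copy_nx_def)
  show ?thesis
    by (cases g) (simp_all add: enc_nats_def op copy_nat nx del: enc_nat.simps)
qed

lemma copy_gates_enc:
  "copy_gates c (enc_nat m @ enc_nat k @ concat (map enc_gate gs)) =
    concat (map (\<lambda>g. enc_gate (copy_gate c g)) gs)"
proof -
  have gates: "run_transducer copy_nx (copy_em c) (\<lambda>_. []) 2 (concat (map enc_gate gs)) =
      concat (map (\<lambda>g. enc_gate (copy_gate c g)) gs)"
    by (induction gs) (simp_all add: copy_gate_enc del: enc_gate.simps)
  have "copy_nx 0 True = 0" "copy_nx 0 False = 1" "copy_nx 1 True = 1" "copy_nx 1 False = 2"
    "\<And>x. copy_em c 0 x = []" "\<And>x. copy_em c 1 x = []"
    by (simp_all add: copy_nx_def copy_em_def)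
  then show ?thesis
    unfolding copy_gates_def by (simp only: run_transducer_skip_nat gates)
qed

lemma enc_circuit_nand:
  "enc_circuit (nand C) = nand_header (enc_circuit C) @
    (enc_nat 1 @ concat (map enc_gate [Had 0, Phase 0, Phase 0, Had 0])) @
    copy_gates 0 (enc_circuit C) @ copy_gates 1 (enc_circuit C) @ nand_tail (enc_circuit C)"
  unfolding enc_circuit_append nand_header_enc copy_gates_enc nand_tail_enc
  by (simp add: nand_def o_def del: enc_nat.simps enc_gate.simps)

lemma computable_nand:
  assumes "computable True inp (\<lambda>a. enc_circuit (Z a))"
  shows "computable True inp (\<lambda>a. enc_circuit (nand (Z a)))"
proof -
  have "computable True inp (\<lambda>a. nand_header (enc_circuit (Z a)))"
    unfolding nand_header_def
    by (rule computable_run_transducer[OF assms, where S = 2 and L = 2]) auto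
  \<comment> \<open>The caps \<open>min 6\<close> and \<open>min 9\<close> in \<open>copy_nx\<close>
    keep all successors below \<open>10\<close>, also those of numbers that are never reached as
    states.\<close>
  moreover have "computable True inp (\<lambda>a. copy_gates c (enc_circuit (Z a)))" for c
    unfolding copy_gates_def
    by (rule computable_run_transducer[OF assms, where S = 10 and L = "2 + c"])
      (auto simp: copy_nx_def copy_em_def)
  moreover have "computable True inp (\<lambda>a. nand_tail (enc_circuit (Z a)))"
    unfolding nand_tail_def
    by (rule computable_run_transducer[OF assms, where S = 4 and L = "length (enc_gate (Toffoli 1 2 0))"])
      auto
  ultimately show ?thesis
    unfolding enc_circuit_nand by (intro computable_binary_append computable_const[OF assms])
qed

subsection \<open>Polynomial-time quantum algorithms\<close>

lemma computable_one_string: "computable True one_string (\<lambda>x. x)"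
  using computable_nth[of one_string 1 0] by (simp add: one_string_def)

lemma computable_two_strings: "computable True two_strings fst" "computable True two_strings snd"
  using computable_nth[of two_strings 2 0] computable_nth[of two_strings 2 1]
  by (simp_all add: two_strings_def case_prod_beta)

lemma polytime_qalg_comp_one:
  assumes "polytime_qalg one_string B" "computable True inp g" "\<And>a. length (inp a) = k"
  shows "polytime_qalg inp (\<lambda>a. B (g a))"
proof -
  have "computable False one_string (\<lambda>x. enc_circuit (B x))"
    using assms(1) unfolding polytime_qalg_def by (intro polytime_computable_imp_computable) simp
  then have "computable True inp (\<lambda>a. enc_circuit (B (g a)))"
    by (rule computable_comp[where gs = "[g]"]) (use assms(2) in \<open>simp_all add: one_string_def\<close>)
  then show ?thesis
    using assms computable_imp_polytime_computable unfolding polytime_qalg_def by blast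
qed

lemma polytime_qalg_comp_two:
  assumes "polytime_qalg two_strings M" "computable True inp g" "computable True inp h"
    and "\<And>a. length (inp a) = k"
  shows "polytime_qalg inp (\<lambda>a. M (g a, h a))"
proof -
  have "computable False two_strings (\<lambda>x. enc_circuit (M x))"
    using assms(1) unfolding polytime_qalg_def by (intro polytime_computable_imp_computable) simp
  then have "computable True inp (\<lambda>a. enc_circuit (M (g a, h a)))"
    by (rule computable_comp[where gs = "[g, h]"]) (use assms(2,3) in auto)
  then show ?thesis
    using assms computable_imp_polytime_computable unfolding polytime_qalg_def by blast
qed

lemma polytime_qalg_nand:
  assumes "polytime_qalg inp Z" "\<And>a. length (inp a) = k"
  shows "polytime_qalg inp (\<lambda>a. nand (Z a))"
proof -
  have "computable False inp (\<lambda>a. enc_circuit (Z a))"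
    using assms(1) unfolding polytime_qalg_def by (intro polytime_computable_imp_computable) simp
  \<comment> \<open>Composing with all projections makes the simulating program keep its
    inputs.\<close>
  then have "computable True inp (\<lambda>a. enc_circuit (Z a))"
    by (rule computable_comp[where gs = "map (\<lambda>i a. inp a ! i) [0..<k]" and \<phi> = "\<lambda>a. a"])
      (use computable_nth[of inp k] assms(2) in \<open>auto simp: o_def intro!: map_upt_eqI[symmetric]\<close>)
  then have "computable True inp (\<lambda>a. enc_circuit (nand (Z a)))"
    by (rule computable_nand)
  then show ?thesis
    using assms wf_nand computable_imp_polytime_computable unfolding polytime_qalg_def by blast
qed

lemma polytime_qalg_nand_funpow:
  assumes "polytime_qalg inp Z" "\<And>a. length (inp a) = k"
  shows "polytime_qalg inp (\<lambda>a. (nand ^^ n) (Z a))"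
proof (induction n)
  case (Suc n)
  then show ?case using polytime_qalg_nand[of inp "\<lambda>a. (nand ^^ n) (Z a)"] assms(2) by simp
qed (use assms(1) in simp)

text \<open>\<open>BQP\<close> fixes the whole output string, acceptance only its first bit. The two
  agree for a register of one bit, the form into which \<open>nand\<close> brings every
  circuit.\<close>

lemma qprob_bit:
  assumes "wf_circuit C" "out_len C = 1"
  shows "qprob C (\<lambda>w. w = [b]) = (if b then accept_prob C else 1 - accept_prob C)"
proof -
  have width: "width C > 0" using assms by (simp add: wf_circuit_def)
  have *: "take (out_len C) z = [b] \<longleftrightarrow> decode_output (take (out_len C) z) \<noteq> None \<longleftrightarrow> b"
    if "length z = width C" for z b
    using that width assms(2) unfolding decode_output_take by (cases z) auto
  have "{z. length z = width C \<and> take (out_len C) z = [b]} =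
      {z. length z = width C \<and> (decode_output (take (out_len C) z) \<noteq> None \<longleftrightarrow> b)}"
    using * by blast
  then have "qprob C (\<lambda>w. w = [b]) = qprob C (\<lambda>w. decode_output w \<noteq> None \<longleftrightarrow> b)"
    unfolding qprob_def by (rule arg_cong)
  then show ?thesis
    using qprob_not[OF assms(1), of "\<lambda>w. decode_output w \<noteq> None"] by (simp add: accept_prob_def)
qed

section \<open>Amplification of the gap\<close>

lemma wf_nand_funpow: "wf_circuit C \<Longrightarrow> wf_circuit ((nand ^^ n) C)"
  by (induction n) (auto simp: wf_nand)

lemma nand_step:
  assumes "wf_circuit C"
  shows "0 \<le> c \<Longrightarrow> c \<le> accept_prob C \<Longrightarrow> 1 - c\<^sup>2 \<le> d \<Longrightarrow> accept_prob (nand C) \<le> d"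
    and "accept_prob C \<le> c \<Longrightarrow> d \<le> 1 - c\<^sup>2 \<Longrightarrow> d \<le> accept_prob (nand C)"
proof -
  assume c: "0 \<le> c" "c \<le> accept_prob C" "1 - c\<^sup>2 \<le> d"
  then have "c\<^sup>2 \<le> (accept_prob C)\<^sup>2" by (intro power_mono)
  with c(3) show "accept_prob (nand C) \<le> d" unfolding accept_prob_nand[OF assms] by linarith
next
  assume c: "accept_prob C \<le> c" "d \<le> 1 - c\<^sup>2"
  then have "(accept_prob C)\<^sup>2 \<le> c\<^sup>2"
    using accept_prob_bounds(1)[OF assms] by (intro power_mono)
  with c(2) show "d \<le> accept_prob (nand C)" unfolding accept_prob_nand[OF assms] by linarith
qed

lemma nand_amplify:
  assumes wf: "wf_circuit C"
  shows "2/3 \<le> accept_prob C \<Longrightarrow> 2/3 \<le> accept_prob ((nand ^^ 6) C)"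
    and "accept_prob C \<le> 1/2 \<Longrightarrow> accept_prob ((nand ^^ 6) C) \<le> 1/3"
proof -
  note wfs = wf wf_nand[OF wf] wf_nand[OF wf_nand[OF wf]] wf_nand[OF wf_nand[OF wf_nand[OF wf]]]
    wf_nand[OF wf_nand[OF wf_nand[OF wf_nand[OF wf]]]]
    wf_nand[OF wf_nand[OF wf_nand[OF wf_nand[OF wf_nand[OF wf]]]]]
  have six: "(nand ^^ 6) C = nand (nand (nand (nand (nand (nand C)))))"
    by (simp add: eval_nat_numeral)
  {
    assume "2/3 \<le> accept_prob C"
    \<comment> \<open>The intermediate bounds are iterates of \<open>a \<mapsto> 1 - a * a\<close>,
      rounded to hundredths in the safe direction, alternately upper and lower bounds because the
      map is decreasing.\<close>
    then have "accept_prob (nand C) \<le> 56/100"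
      by (rule nand_step(1)[OF wfs(1), rotated]) (simp_all add: power2_eq_square)
    then have "68/100 \<le> accept_prob (nand (nand C))"
      by (rule nand_step(2)[OF wfs(2)]) (simp add: power2_eq_square)
    then have "accept_prob (nand (nand (nand C))) \<le> 54/100"
      by (rule nand_step(1)[OF wfs(3), rotated]) (simp_all add: power2_eq_square)
    then have "70/100 \<le> accept_prob (nand (nand (nand (nand C))))"
      by (rule nand_step(2)[OF wfs(4)]) (simp add: power2_eq_square)
    then have "accept_prob (nand (nand (nand (nand (nand C))))) \<le> 52/100"
      by (rule nand_step(1)[OF wfs(5), rotated]) (simp_all add: power2_eq_square)
    then show "2/3 \<le> accept_prob ((nand ^^ 6) C)"
      unfolding six by (rule nand_step(2)[OF wfs(6)]) (simp add: power2_eq_square)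
  next
    assume "accept_prob C \<le> 1/2"
    then have "75/100 \<le> accept_prob (nand C)"
      by (rule nand_step(2)[OF wfs(1)]) (simp add: power2_eq_square)
    then have "accept_prob (nand (nand C)) \<le> 44/100"
      by (rule nand_step(1)[OF wfs(2), rotated]) (simp_all add: power2_eq_square)
    then have "80/100 \<le> accept_prob (nand (nand (nand C)))"
      by (rule nand_step(2)[OF wfs(3)]) (simp add: power2_eq_square)
    then have "accept_prob (nand (nand (nand (nand C)))) \<le> 36/100"
      by (rule nand_step(1)[OF wfs(4), rotated]) (simp_all add: power2_eq_square)
    then have "87/100 \<le> accept_prob (nand (nand (nand (nand (nand C)))))"
      by (rule nand_step(2)[OF wfs(5)]) (simp add: power2_eq_square)
    then show "accept_prob ((nand ^^ 6) C) \<le> 1/3"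
      unfolding six by (rule nand_step(1)[OF wfs(6), rotated]) (simp_all add: power2_eq_square)
  }
qed

lemma BQP_if_accept_gap:
  assumes B: "polytime_qalg one_string B"
    and gap: "\<And>x. x \<in> L \<Longrightarrow> 2/3 \<le> accept_prob (B x)" "\<And>x. x \<notin> L \<Longrightarrow> accept_prob (B x) \<le> 1/2"
  shows "L \<in> BQP"
proof -
  let ?A = "\<lambda>x. (nand ^^ 6) (B x)"
  have A: "polytime_qalg one_string ?A"
    by (rule polytime_qalg_nand_funpow[OF B]) (rule one_string_simps)
  have wf: "wf_circuit (B x)" for x using B by (simp add: polytime_qalg_def)
  have "prob_bit ?A x b = (if b then accept_prob (?A x) else 1 - accept_prob (?A x))" for x b
    unfolding prob_bit_def
    by (rule qprob_bit[OF wf_nand_funpow[OF wf]]) (simp add: eval_nat_numeral nand_def)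
  then have "prob_bit ?A x (x \<in> L) \<ge> 2/3" for x
    using nand_amplify[OF wf, of x] gap[of x] by auto
  then show ?thesis unfolding BQP_def using A by blast
qed

section \<open>Inclusion of the classes and growth of polynomials\<close>

lemma prob_bit_exclusive:
  assumes "wf_circuit (M a)" "prob_bit M a False \<ge> 2/3"
  shows "prob_bit M a True < 2/3"
proof -
  have "prob_bit M a True \<le> qprob (M a) (\<lambda>w. \<not> w = [False])"
    unfolding prob_bit_def by (rule qprob_mono) simp
  then show ?thesis
    using assms qprob_not[OF assms(1), of "\<lambda>w. w = [False]"] by (simp add: prob_bit_def)
qed

text \<open>Witnesses have length \<open>0\<close>: the empty string is the only candidate, and the
  algorithm for \<open>L\<close> ignores it. The inclusion is what turns inequality of the classes
  into a language in \<open>NBQP - BQP\<close>.\<close>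

lemma BQP_subset_NBQP: "BQP \<subseteq> NBQP"
proof
  fix L assume "L \<in> BQP"
  then obtain A where A: "polytime_qalg one_string A" "\<And>x. prob_bit A x (x \<in> L) \<ge> 2/3"
    unfolding BQP_def by blast
  define M where "M = (\<lambda>a :: bool list \<times> bool list. A (fst a))"
  have M: "polytime_qalg two_strings M"
    unfolding M_def by (rule polytime_qalg_comp_one[OF A(1) computable_two_strings(1)]) simp
  have prob: "prob_bit M (x, y) b = prob_bit A x b" for x y b
    by (simp add: prob_bit_def M_def)
  have "nbqp_search_problem M (\<lambda>_. 0)"
    unfolding nbqp_search_problem_def prob using M A(2) polynomial_fun_const[of 0] by blast
  moreover have "prob_bit A x True \<ge> 2/3 \<longleftrightarrow> x \<in> L" for x
    using A(2)[of x] prob_bit_exclusive[of A x] A(1) by (cases "x \<in> L") (auto simp: polytime_qalg_def)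
  then have "L = search_language M (\<lambda>_. 0)"
    unfolding search_language_def solutions_def prob by auto
  ultimately show "L \<in> NBQP" unfolding NBQP_def by blast
qed

text \<open>The forward difference is a nonzero polynomial, so it has a fixed sign from some point
  on; as it takes integer values there, its absolute value is at least one. A negative sign would
  drive \<open>p\<close> below zero, so \<open>p\<close> eventually grows by at least one per
  step.\<close>

lemma nonconstant_polynomial_growth:
  assumes "polynomial_fun p" "\<not> (\<exists>c. \<forall>n. p n = c)"
  shows "\<exists>c. \<forall>k. k \<le> p k + c"
proof -
  obtain P where P: "\<And>n. real (p n) = poly P (real n)"
    using assms(1) unfolding polynomial_fun_def by blast
  define Q where "Q = pcompose P [:1, 1:] - P"
  have Q: "poly Q (real n) = real (p (Suc n)) - real (p n)" for n
    by (simp add: Q_def poly_pcompose P)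
  have "Q \<noteq> 0"
  proof
    assume "Q = 0"
    then have "p (Suc n) = p n" for n using Q[of n] by simp
    then have "p n = p 0" for n by (induction n) simp_all
    then show False using assms(2) by blast
  qed
  then consider "lead_coeff Q > 0" | "lead_coeff (- Q) > 0"
    using leading_coeff_neq_0[of Q] by fastforce
  then show ?thesis
  proof cases
    case 1
    then obtain N where N: "\<And>x. x \<ge> N \<Longrightarrow> poly Q x > 0"
      using poly_pinfty_gt_lc[of Q] by (metis less_le_trans)
    define K where "K = nat \<lceil>N\<rceil>"
    have step: "p (Suc n) \<ge> Suc (p n)" if "n \<ge> K" for n
    proof -
      have "real n \<ge> N" using that unfolding K_def by linarith
      then show ?thesis using N[of "real n"] Q[of n] by simp
    qed
    have "p (K + j) \<ge> j" for j
    proof (induction j)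
      case (Suc j)
      then show ?case using step[of "K + j"] by simp
    qed simp
    then have "k \<le> p k + K" for k
      by (cases "k \<ge> K") (metis add.commute le_add_diff_inverse add_le_cancel_right, simp)
    then show ?thesis by blast
  next
    case 2
    then obtain N where N: "\<And>x. x \<ge> N \<Longrightarrow> poly (- Q) x > 0"
      using poly_pinfty_gt_lc[of "- Q"] by (metis less_le_trans)
    define K where "K = nat \<lceil>N\<rceil>"
    have step: "Suc (p (Suc n)) \<le> p n" if "n \<ge> K" for n
    proof -
      have "real n \<ge> N" using that unfolding K_def by linarith
      then show ?thesis using N[of "real n"] Q[of n] by simp
    qed
    have "p (K + j) + j \<le> p K" for j
    proof (induction j)
      case (Suc j)
      then show ?case using step[of "K + j"] by simp
    qed simp
    from this[of "Suc (p K)"] show ?thesis by simp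
  qed
qed

text \<open>Since \<open>p' \<ge> p + 1\<close>, the claim reduces to
  \<open>(p - 1) * (p - 2) \<ge> 0\<close> over the integers. Equality holds for
  \<open>p = 1\<close> and \<open>p = 2\<close> with \<open>p' = p + 1\<close>.\<close>

lemma success_probability_ge:
  fixes p p' :: nat
  assumes "0 < p" "p < p'"
  shows "2/3 \<le> 1 - 2 * real p / (real p' * (real p + 2))"
proof -
  have "6 * p \<le> (p + 1) * (p + 2)"
  proof (cases "p = 1")
    case False
    then have "(p - 1) + 1 = p" "(p - 2) + 2 = p" using assms(1) by simp_all
    then obtain r where "p = r + 2" by metis
    then show ?thesis by (simp add: algebra_simps)
  qed simp
  also have "\<dots> \<le> p' * (p + 2)" using assms(2) by (intro mult_le_mono1) simp
  finally have "real (6 * p) \<le> real (p' * (p + 2))" by (rule of_nat_mono)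
  moreover have "0 < real p' * (real p + 2)" using assms by simp
  ultimately show ?thesis by (simp add: field_simps)
qed

section \<open>The reduction by padding\<close>

theorem proposition15:
  fixes p p' p'' :: "nat \<Rightarrow> nat"
  assumes "BQP \<noteq> NBQP"
    and "positive_polynomial p" and "positive_polynomial p'" and "positive_polynomial p''"
    and "\<forall>n. p' n > p n"
    and nonconstant: "\<not> (\<exists>c. \<forall>n. p n = c)"
  shows "\<exists>M. nbqp_search_problem M p \<and>
    (\<forall>f. solution_function M p f \<longrightarrow>
      \<not> (\<exists>B. polytime_qalg one_string B \<and>
            (\<forall>n x. length x = n \<and> x \<in> search_language M p \<longrightarrow>
               prob_output B x (close_output (f x) (1/2 - 1 / real (p n)))
                 \<ge> 1 - 2 * real (p n) / (real (p' n) * (real (p n) + 2))) \<and>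
            (\<forall>n x. length x = n \<and> x \<notin> search_language M p \<longrightarrow>
               prob_output B x (\<lambda>r. r = None) \<ge> 1/2 + 1 / real (p'' n))))"
proof -
  have p: "polynomial_fun p" using assms(2) by (simp add: positive_polynomial_def)
  obtain L where L: "L \<in> NBQP" "L \<notin> BQP"
    using assms(1) BQP_subset_NBQP by blast
  then obtain M0 p0 where M0: "nbqp_search_problem M0 p0" and L_eq: "L = search_language M0 p0"
    unfolding NBQP_def by blast
  have M0_poly: "polytime_qalg two_strings M0" and p0: "polynomial_fun p0"
    and M0_prob: "\<And>x y. length y = p0 (length x) \<Longrightarrow> \<exists>b. prob_bit M0 (x, y) b \<ge> 2/3"
    using M0 by (auto simp: nbqp_search_problem_def)
  obtain c where c: "\<And>k. k \<le> p k + c"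
    using nonconstant_polynomial_growth[OF p nonconstant] by blast
  obtain a d where ad: "\<And>n. p0 n \<le> a * (n + 1) ^ d"
    using polynomial_fun_le[OF p0] unfolding poly_bounded_def by (meson order_trans)
  \<comment> \<open>The block of ones has this length so that \<open>p (length (pad z))\<close>,
    which is at least \<open>length (pad z) - c\<close>, exceeds
    \<open>a * (length z + 1) ^ d\<close> and hence \<open>p0 (length z)\<close>.\<close>
  define pad where "pad = (\<lambda>z. replicate (c + a * (length z + 1) ^ d) True @ [False] @ z)"
  have unpad: "unpad (pad z) = z" for z by (simp add: pad_def)
  have p0_le: "p0 (length z) \<le> p (length (pad z))" for z
    using c[of "length (pad z)"] ad[of "length z"] by (simp add: pad_def)
  have pad: "computable True one_string pad"
    unfolding pad_def
    by (intro computable_binary_append unary_add unary_mult unary_power unary_length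
        computable_const[OF computable_one_string] computable_one_string)
  \<comment> \<open>Through \<open>unpad\<close> and \<open>fit\<close>, every run of
    \<open>M\<close> is a run of \<open>M0\<close> on a candidate of the right length. So the
    promise that one bit has probability at least \<open>2/3\<close> is inherited on all inputs,
    padded or not.\<close>
  define M where "M = (\<lambda>(x, y). M0 (unpad x, fit (p0 (length (unpad x))) y))"
  have M_prob: "prob_bit M (x, y) b = prob_bit M0 (unpad x, fit (p0 (length (unpad x))) y) b" for x y b
    by (simp add: M_def prob_bit_def)
  have "polytime_qalg two_strings M"
    unfolding M_def case_prod_beta
    by (intro polytime_qalg_comp_two[OF M0_poly, where k = 2] computable_fit
        unary_polynomial[OF _ p0] unary_length computable_unpad computable_two_strings) simp
  then have M: "nbqp_search_problem M p"
    unfolding nbqp_search_problem_def M_prob using p M0_prob by simp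
  have pad_iff: "pad z \<in> search_language M p \<longleftrightarrow> z \<in> L" for z
  proof
    assume "pad z \<in> search_language M p"
    then obtain y where "prob_bit M0 (z, fit (p0 (length z)) y) True \<ge> 2/3"
      by (auto simp: search_language_def solutions_def M_prob unpad)
    then show "z \<in> L" unfolding L_eq search_language_def solutions_def
      using length_fit[of "p0 (length z)" y] by blast
  next
    assume "z \<in> L"
    then obtain y where y: "length y = p0 (length z)" "prob_bit M0 (z, y) True \<ge> 2/3"
      unfolding L_eq search_language_def solutions_def by auto
    \<comment> \<open>The witness is lengthened by zeros, which \<open>fit\<close> cuts off
      again.\<close>
    have "y @ replicate (p (length (pad z)) - p0 (length z)) False \<in> solutions M p (pad z)"
      using y p0_le[of z] by (simp add: solutions_def M_prob unpad fit_append)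
    then show "pad z \<in> search_language M p" by (auto simp: search_language_def)
  qed
  show ?thesis
  proof (intro exI[of _ M] conjI M allI impI notI)
    fix f
    assume "\<exists>B. polytime_qalg one_string B \<and>
            (\<forall>n x. length x = n \<and> x \<in> search_language M p \<longrightarrow>
               prob_output B x (close_output (f x) (1/2 - 1 / real (p n)))
                 \<ge> 1 - 2 * real (p n) / (real (p' n) * (real (p n) + 2))) \<and>
            (\<forall>n x. length x = n \<and> x \<notin> search_language M p \<longrightarrow>
               prob_output B x (\<lambda>r. r = None) \<ge> 1/2 + 1 / real (p'' n))"
    then obtain B where B: "polytime_qalg one_string B"
      and yes: "\<And>x. x \<in> search_language M p \<Longrightarrow>
        prob_output B x (close_output (f x) (1/2 - 1 / real (p (length x))))
          \<ge> 1 - 2 * real (p (length x)) / (real (p' (length x)) * (real (p (length x)) + 2))"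
      and no: "\<And>x. x \<notin> search_language M p \<Longrightarrow>
        prob_output B x (\<lambda>r. r = None) \<ge> 1/2 + 1 / real (p'' (length x))"
      by auto
    have "L \<in> BQP"
    proof (rule BQP_if_accept_gap)
      show "polytime_qalg one_string (\<lambda>z. B (pad z))"
        by (rule polytime_qalg_comp_one[OF B pad]) simp
      fix z
      {
        assume "z \<in> L"
        let ?n = "length (pad z)"
        have "2/3 \<le> 1 - 2 * real (p ?n) / (real (p' ?n) * (real (p ?n) + 2))"
          using assms(2,5) by (intro success_probability_ge) (auto simp: positive_polynomial_def)
        also have "\<dots> \<le> prob_output B (pad z) (close_output (f (pad z)) (1/2 - 1 / real (p ?n)))"
          using yes[of "pad z"] pad_iff \<open>z \<in> L\<close> by simp
        also have "\<dots> \<le> accept_prob (B (pad z))"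
          unfolding prob_output_def accept_prob_def
          by (rule qprob_mono) (auto simp: close_output_def)
        finally show "2/3 \<le> accept_prob (B (pad z))" .
      next
        assume "z \<notin> L"
        have "1/2 \<le> 1/2 + 1 / real (p'' (length (pad z)))" by simp
        also have "\<dots> \<le> prob_output B (pad z) (\<lambda>r. r = None)"
          using no[of "pad z"] pad_iff \<open>z \<notin> L\<close> by simp
        finally have "1/2 \<le> qprob (B (pad z)) (\<lambda>w. decode_output w = None)"
          by (simp add: prob_output_def)
        moreover have "wf_circuit (B (pad z))" using B by (simp add: polytime_qalg_def)
        ultimately show "accept_prob (B (pad z)) \<le> 1/2"
          using qprob_not[of "B (pad z)" "\<lambda>w. decode_output w = None"] by (simp add: accept_prob_def)
      }
    qed
    with L(2) show False ..
  qed
qed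

end
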